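(* Fix the staggered mesh and the time step $\delta t$. Let $(\varepsilon^{(m)})_{m\in\mathbb N}$ be a sequence of positive real numbers tending to zero, and let the initial data $(\rho_0^{\varepsilon^{(m)}},\boldsymbol u_0^{\varepsilon^{(m)}})$, $m\in\mathbb N$, be ill-prepared (in the sense given in the context), with weak limit $\boldsymbol u_0$ of the initial velocities. Let $(\rho^{(m)},\boldsymbol u^{(m)})_{m\in\mathbb N}$ be a corresponding sequence of solutions of the implicit scheme (S) with $\varepsilon=\varepsilon^{(m)}$. (1) The sequence $(\rho^{(m)})_m$ tends to the constant function $1$ in $L^\infty((0,T);L^\gamma(\Omega))$ as $m\to+\infty$. Moreover, for all $q\in[1,\min(2,\gamma)]$ there exists $C>0$ such that $$\|\rho^{(m)}-1\|_{L^\infty((0,T);L^q(\Omega))}\le C\,\varepsilon^{(m)}\qquad\text{for $m$ large enough}.$$ (2) The sequences $(\boldsymbol u^{(m)})_m$ and $(\delta p^{(m)})_m$ are bounded in any discrete norm (which may depend on the fixed discretization). (3) If a subsequence of $(\boldsymbol u^{(m)},\delta p^{(m)})_m$ tends, in any discrete norm, to a limit $(\boldsymbol u,\delta p)$, then $(\boldsymbol u,\delta p)$ is a solution of the following implicit scheme for the incompressible Navier-Stokes equations, for $0\le n\le N-1$: $$\mathrm{div}(\boldsymbol u^{n+1})_K=0,\quad\forall K\in\mathcal M,$$ $$\frac1{\delta t}(\boldsymbol u_\sigma^{n+1}-\boldsymbol u_\sigma^n)+\mathbf{div}(\boldsymbol u^{n+1}\otimes\boldsymbol u^{n+1})_\sigma-\mathbf{div}(\boldsymbol\tau(\boldsymbol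 u^{n+1}))_\sigma+(\boldsymbol\nabla\delta p^{n+1})_\sigma=0,\quad\forall\sigma\in\mathcal E_{\rm int}.$$ In this limit scheme only the $L^2$-projection of $\boldsymbol u_0$ onto $E_{\mathcal T}(\Omega)=\{\boldsymbol v\in\mathbf H_{\mathcal E,0}(\Omega):\ \mathrm{div}(\boldsymbol v)_K=0\ \forall K\in\mathcal M\}$ is used as initial condition; that is, the velocities $(\boldsymbol u^n)_{1\le n\le N}$ determined by the scheme are unchanged if the initial velocity $\boldsymbol u^0$ is replaced by this projection.
   Context: Mesh. $d\in\{2,3\}$; $\Omega\subset\mathbb R^d$ is a bounded connected open set, polygonal ($d=2$) or polyhedral ($d=3$). $\mathcal M$ is a finite partition of $\Omega$ into triangles and convex quadrilaterals ($d=2$) or tetrahedra and convex hexahedra ($d=3$); $\mathcal E$ is the set of faces, and each face either lies in $\partial\Omega$ (set $\mathcal E_{\rm ext}$) or is the whole common face $\sigma=K|L$ of two distinct cells (set $\mathcal E_{\rm int}$). $\mathcal E(K)$ is the set of faces of $K$, $\boldsymbol n_{K,\sigma}$ the unit normal to $\sigma$ outward $K$, $|\cdot|$ the measure. Each $K$ is partitioned into half-diamond cells $D_{K,\sigma}$, $\sigma\in\mathcal E(K)$, of equal measure $|K|/\#\mathcal E(K)$ (the cone with basis $\sigma$ and vertex the mass center of $K$ if $K$ is a simplex, rectangle or cuboid; otherwise a given partition with the same connectivities). For $\sigma=K|L$, $D_\sigma=D_{K,\sigma}\cup D_{L,\sigma}$ (and $D_\sigma=D_{K,\sigma}$ for $\sigma\in\mathcal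 E_{\rm ext}\cap\mathcal E(K)$). $\bar{\mathcal E}(D_\sigma)$ is the set of faces of $D_\sigma$ (dual faces); $e=D_\sigma|D_{\sigma'}$ is the dual face separating $D_\sigma$ and $D_{\sigma'}$. $\mathcal T=(\mathcal M,\mathcal E)$. Spaces. $L_{\mathcal M}(\Omega)$: functions constant on each $K\in\mathcal M$. $\mathbf H_{\mathcal E,0}(\Omega)$: $\mathbb R^d$-valued functions constant on each $D_\sigma$, with value $0$ for $\sigma\in\mathcal E_{\rm ext}$. Operators. For $\rho\in L_{\mathcal M}(\Omega)$, $\boldsymbol u,\boldsymbol v\in\mathbf H_{\mathcal E,0}(\Omega)$: - $F_{K,\sigma}(\rho,\boldsymbol u)=|\sigma|\rho_\sigma\boldsymbol u_\sigma\cdot\boldsymbol n_{K,\sigma}$ for $\sigma=K|L$, with upwind $\rho_\sigma=\rho_K$ if $\boldsymbol u_\sigma\cdot\boldsymbol n_{K,\sigma}\ge0$, $\rho_\sigma=\rho_L$ otherwise; $F_{K,\sigma}=0$ on external faces; $\mathrm{div}(\rho\boldsymbol u)_K=|K|^{-1}\sum_{\sigma\in\mathcal E(K)}F_{K,\sigma}(\rho,\boldsymbol u)$; $\mathrm{div}(\boldsymbol u)_K=|K|^{-1}\sum_{\sigma\in\mathcal E(K)}|\sigma|\boldsymbol u_\sigma\cdot\boldsymbol n_{K,\sigma}$. - Dual density: $|D_\sigma|\rho_{D_\sigma}=|D_{K,\sigma}|\rho_K+|D_{L,\sigma}|\rho_L$ for $\sigma=K|L$. - Dual mass fluxes $F_{\sigma,e}(\rho,\boldsymbol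 u)$: zero if $e\subset\partial\Omega$; otherwise fixed linear combinations, with constant coefficients, of the primal fluxes at neighbouring faces such that, with $\xi_K^\sigma=|D_{K,\sigma}|/|K|$: (i) $F_{K,\sigma}+\sum_{e\in\bar{\mathcal E}(D_\sigma),e\subset K}F_{\sigma,e}=\xi_K^\sigma\sum_{\sigma'\in\mathcal E(K)}F_{K,\sigma'}$ for all $K$, $\sigma\in\mathcal E(K)$; (ii) $F_{\sigma,e}=-F_{\sigma',e}$ for $e=D_\sigma|D_{\sigma'}$; (iii) $|F_{\sigma,e}|\le\max_{\sigma'\in\mathcal E(K)}|F_{K,\sigma'}|$ for $e\subset K$. - $\mathbf{div}(\rho\boldsymbol u\otimes\boldsymbol v)_\sigma=|D_\sigma|^{-1}\sum_{e\in\bar{\mathcal E}(D_\sigma)}F_{\sigma,e}(\rho,\boldsymbol u)\boldsymbol v_e$, $\boldsymbol v_e=\frac12(\boldsymbol v_\sigma+\boldsymbol v_{\sigma'})$ for $e=D_\sigma|D_{\sigma'}$; $\mathbf{div}(\boldsymbol u\otimes\boldsymbol v)$ is this operator with $\rho\equiv1$. - $\mathbf{div}(\boldsymbol\tau(\boldsymbol u))_\sigma=-\frac{\mu}{|D_\sigma|}\sum_K\int_K\boldsymbol\nabla\hat{\boldsymbol u}\cdot\boldsymbol\nabla\zeta_\sigma-\frac{\mu+\lambda}{|D_\sigma|}\sum_K\int_K\mathrm{div}(\hat{\boldsymbol u})\boldsymbol\nabla\zeta_\sigma$, with $\mu>0$, $\mu+\lambda>0$, $\hat{\boldsymbol u}=\sum_\sigma\boldsymbol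 u_\sigma\zeta_\sigma$, and $(\zeta_\sigma)_{\sigma\in\mathcal E}$ the Crouzeix-Raviart (simplicial cells) / parametric Rannacher-Turek (quadrangular, hexahedral cells; reference space spanned by $1,x_i,x_i^2-x_{i+1}^2$, composed with the inverse $Q_1$ mapping) shape functions, with zero mean jump through internal faces and $|\sigma'|^{-1}\int_{\sigma'}\zeta_\sigma=\delta_{\sigma\sigma'}$. - For $q\in L_{\mathcal M}(\Omega)$ and $\sigma=K|L$: $(\boldsymbol\nabla q)_\sigma=\frac{|\sigma|}{|D_\sigma|}(q_L-q_K)\boldsymbol n_{K,\sigma}$. Equation of state: $p=\rho^\gamma$, $\gamma\ge1$; $p^n_K=(\rho^n_K)^\gamma$. $T>0$, $\delta t>0$, $N=\lfloor T/\delta t\rfloor$. Implicit scheme (S) with Mach number $\varepsilon>0$: $\rho^0_K=|K|^{-1}\int_K\rho_0^\varepsilon$, $\boldsymbol u^0_\sigma=|D_\sigma|^{-1}\int_{D_\sigma}\boldsymbol u_0^\varepsilon$ ($\sigma\in\mathcal E_{\rm int}$), and for $0\le n\le N-1$ find $\rho^{n+1}\in L_{\mathcal M}(\Omega)$, $\boldsymbol u^{n+1}\in\mathbf H_{\mathcal E,0}(\Omega)$ with $$\tfrac1{\delta t}(\rho_K^{n+1}-\rho_K^n)+\mathrm{div}(\rho^{n+1}\boldsymbol u^{n+1})_K=0\ \ \forall K\in\mathcal M,$$ $$\tfrac1{\delta t}(\rho_{D_\sigma}^{n+1}\boldsymbol u_\sigma^{n+1}-\rho_{D_\sigma}^n\boldsymbol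 u_\sigma^n)+\mathbf{div}(\rho^{n+1}\boldsymbol u^{n+1}\otimes\boldsymbol u^{n+1})_\sigma-\mathbf{div}(\boldsymbol\tau(\boldsymbol u^{n+1}))_\sigma+\tfrac1{\varepsilon^2}(\boldsymbol\nabla p^{n+1})_\sigma=0\ \ \forall\sigma\in\mathcal E_{\rm int}.$$ Ill-prepared data: $\rho_0^\varepsilon\in L^\infty(\Omega)$, $\rho_0^\varepsilon>0$ a.e., $\boldsymbol u_0^\varepsilon\in L^2(\Omega)^d$, and there is $C$ independent of $\varepsilon$ with $\|\boldsymbol u_0^\varepsilon\|_{L^2(\Omega)^d}+\frac1\varepsilon\|\rho_0^\varepsilon-1\|_{L^\infty(\Omega)}\le C$; moreover $\boldsymbol u_0^\varepsilon$ converges weakly in $L^2(\Omega)^d$ to some $\boldsymbol u_0$. Notation. $\delta p^n_K=(p^n_K-m(p^n))/\varepsilon^2$ with $m(p^n)=|\Omega|^{-1}\sum_K|K|p^n_K$, for $1\le n\le N$. Discrete solutions are identified with functions piecewise constant in time; the $L^\infty((0,T);L^q)$ norm is the maximum over the discrete times $0\le n\le N$ of the $L^q(\Omega)$ norms. A "discrete norm" is any norm on the (finite-dimensional) space of discrete functions. *)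

theory Defs
  imports "HOL-Analysis.Analysis" "HOL-Probability.Essential_Supremum"
begin

text \<open>
  The discretization is a record of the objects that are fixed once and for all.  Cells are closed
  polytopes, faces are their facets, and a discrete field is the function giving its value on each
  cell (scalar fields) or on each face (velocities).
  \<^item> \<open>half_dia K \<sigma>\<close> is the half-diamond cell \<open>D\<^sub>K\<^sub>,\<^sub>\<sigma>\<close>.
  \<^item> \<open>shape \<sigma> K\<close> is the restriction to \<open>K\<close> of the shape function \<open>\<zeta>\<^sub>\<sigma>\<close>, which may jump across faces;
    only its values on \<open>K\<close> matter.
  \<^item> A dual face \<open>e = D\<^sub>\<sigma>|D\<^sub>\<sigma>\<^sub>'\<close> included in \<open>K\<close> is represented by the triple \<open>K\<close>, \<open>\<sigma>\<close>, \<open>\<sigma>'\<close>, and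
    \<open>dual_coeff K \<sigma> \<sigma>' \<sigma>''\<close> is the coefficient of \<open>F\<^sub>K\<^sub>,\<^sub>\<sigma>\<^sub>'\<^sub>'\<close> in the dual flux \<open>F\<^sub>\<sigma>\<^sub>,\<^sub>e\<close>.
\<close>

type_synonym 'd region = "(real^'d) set"

record ('d::finite) discretization =
  domain :: "'d region"
  cells :: "'d region set"
  half_dia :: "'d region \<Rightarrow> 'd region \<Rightarrow> 'd region"
  shape :: "'d region \<Rightarrow> 'd region \<Rightarrow> real^'d \<Rightarrow> real"
  dual_coeff :: "'d region \<Rightarrow> 'd region \<Rightarrow> 'd region \<Rightarrow> 'd region \<Rightarrow> real"

abbreviation vol :: "(real^'d::finite) set \<Rightarrow> real" where
  "vol A \<equiv> measure lebesgue A"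


section \<open>Cells and faces\<close>

definition cell_faces :: "'d::finite region \<Rightarrow> 'd region set" where
  "cell_faces K = {\<sigma>. \<sigma> facet_of K}"

definition simplicial_cell :: "'d::finite region \<Rightarrow> bool" where
  "simplicial_cell K \<longleftrightarrow> int CARD('d) simplex K"

abbreviation ref_cube :: "'d::finite region" where
  "ref_cube \<equiv> cbox 0 (\<chi> i. 1)"

text \<open>\<open>v\<close> labels the vertices of a cell by those of the unit cube; \<open>Q1_map v\<close> is the multilinear
  mapping sending each vertex of the cube to the vertex of the cell with the same label.\<close>

definition Q1_map :: "(bool^'d \<Rightarrow> real^'d) \<Rightarrow> real^'d \<Rightarrow> real^'d::finite" where
  "Q1_map v x = (\<Sum>b\<in>UNIV. (\<Prod>i\<in>UNIV. if b $ i then x $ i else 1 - x $ i) *\<^sub>R v b)"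

text \<open>Convex quadrilaterals in dimension 2 and convex hexahedra in dimension 3: the vertices and
  facets correspond to those of the cube.  The last two conditions make the inverse \<open>Q\<^sub>1\<close> mapping of
  the parametric element meaningful; they are automatic for convex quadrilaterals.\<close>

definition hexahedral_via :: "(bool^'d \<Rightarrow> real^'d) \<Rightarrow> 'd::finite region \<Rightarrow> bool" where
  "hexahedral_via v K \<longleftrightarrow>
     inj v \<and> K = convex hull (range v) \<and> interior K \<noteq> {} \<and>
     range v = {x. x extreme_point_of K} \<and>
     cell_faces K = {convex hull (v ` {b. b $ i = s}) | i s. True} \<and>
     bij_betw (Q1_map v) ref_cube K \<and>
     (\<forall>x\<in>ref_cube. det (jacobian (Q1_map v) (at x)) \<noteq> 0)"

definition hexahedral_cell :: "'d::finite region \<Rightarrow> bool" where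
  "hexahedral_cell K \<longleftrightarrow> (\<exists>v. hexahedral_via v K)"

text \<open>Rectangles and cuboids, in any orientation.\<close>

definition rectangular_cell :: "'d::finite region \<Rightarrow> bool" where
  "rectangular_cell K \<longleftrightarrow>
     (\<exists>(p::real^'d) (f::real^'d \<Rightarrow> real^'d) (b::real^'d).
        orthogonal_transformation f \<and> (\<forall>i. 0 < b $ i) \<and> K = (\<lambda>x. p + f x) ` cbox 0 b)"

definition outward_normal :: "'d::finite region \<Rightarrow> 'd region \<Rightarrow> real^'d" where
  "outward_normal K \<sigma> = (THE n. norm n = 1 \<and> (\<forall>x\<in>\<sigma>. \<forall>y\<in>K. n \<bullet> (y - x) \<le> 0))"

text \<open>Surface measure on a \<open>(d-1)\<close>-dimensional flat set \<open>\<sigma>\<close>: Lebesgue measure on the prism with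
  basis \<open>\<sigma>\<close> and height 1, projected orthogonally onto the hyperplane of \<open>\<sigma>\<close>.\<close>

definition face_normal :: "'d::finite region \<Rightarrow> real^'d" where
  "face_normal \<sigma> = (SOME n. norm n = 1 \<and> (\<forall>x\<in>\<sigma>. \<forall>y\<in>\<sigma>. n \<bullet> (x - y) = 0))"

definition face_measure :: "'d::finite region \<Rightarrow> (real^'d) measure" where
  "face_measure \<sigma> =
     (let n = face_normal \<sigma>; p = (SOME p. p \<in> \<sigma>) in
       distr (restrict_space lborel {x + t *\<^sub>R n | x t. x \<in> \<sigma> \<and> 0 \<le> t \<and> t \<le> 1}) borel
         (\<lambda>y. y - (n \<bullet> (y - p)) *\<^sub>R n))"

definition area :: "'d::finite region \<Rightarrow> real" where
  "area \<sigma> = measure (face_measure \<sigma>) \<sigma>"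

definition face_mean :: "'d::finite region \<Rightarrow> (real^'d \<Rightarrow> real) \<Rightarrow> real" where
  "face_mean \<sigma> f = (LINT x:\<sigma>|face_measure \<sigma>. f x) / area \<sigma>"


section \<open>Mesh\<close>

text \<open>Bounded polygonal or polyhedral domain: the boundary is a finite union of \<open>(d-1)\<close>-dimensional
  polytopes.\<close>

definition polyhedral_domain :: "'d::finite region \<Rightarrow> bool" where
  "polyhedral_domain \<Omega> \<longleftrightarrow>
     open \<Omega> \<and> connected \<Omega> \<and> bounded \<Omega> \<and> \<Omega> \<noteq> {} \<and>
     (\<exists>P. finite P \<and> (\<forall>F\<in>P. polytope F \<and> aff_dim F = int CARD('d) - 1) \<and> frontier \<Omega> = \<Union>P)"

definition faces :: "'d::finite discretization \<Rightarrow> 'd region set" where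
  "faces D = (\<Union>K\<in>cells D. cell_faces K)"

definition ext_faces :: "'d::finite discretization \<Rightarrow> 'd region set" where
  "ext_faces D = {\<sigma> \<in> faces D. \<sigma> \<subseteq> frontier (domain D)}"

definition int_faces :: "'d::finite discretization \<Rightarrow> 'd region set" where
  "int_faces D = {\<sigma>. \<exists>K\<in>cells D. \<exists>L\<in>cells D.
     K \<noteq> L \<and> \<sigma> = K \<inter> L \<and> \<sigma> \<in> cell_faces K \<and> \<sigma> \<in> cell_faces L}"

definition mesh :: "'d::finite discretization \<Rightarrow> bool" where
  "mesh D \<longleftrightarrow>
     polyhedral_domain (domain D) \<and> finite (cells D) \<and>
     (\<forall>K\<in>cells D. simplicial_cell K \<or> hexahedral_cell K) \<and>
     \<Union>(cells D) = closure (domain D) \<and>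
     (\<forall>K\<in>cells D. interior K \<subseteq> domain D) \<and>
     (\<forall>K\<in>cells D. \<forall>L\<in>cells D. K \<noteq> L \<longrightarrow> interior K \<inter> interior L = {}) \<and>
     faces D = ext_faces D \<union> int_faces D \<and> ext_faces D \<inter> int_faces D = {}"

definition adjacent_cells :: "'d::finite discretization \<Rightarrow> 'd region \<Rightarrow> 'd region set" where
  "adjacent_cells D \<sigma> = {K \<in> cells D. \<sigma> \<in> cell_faces K}"

text \<open>The cell \<open>L\<close> such that \<open>\<sigma> = K|L\<close>.\<close>

definition opposite :: "'d::finite discretization \<Rightarrow> 'd region \<Rightarrow> 'd region \<Rightarrow> 'd region" where
  "opposite D K \<sigma> = (THE L. L \<in> adjacent_cells D \<sigma> \<and> L \<noteq> K)"


section \<open>Dual mesh\<close>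

definition mass_center :: "'d::finite region \<Rightarrow> real^'d" where
  "mass_center K = (1 / vol K) *\<^sub>R (LINT x:K|lebesgue. x)"

definition cone :: "'d::finite region \<Rightarrow> real^'d \<Rightarrow> 'd region" where
  "cone \<sigma> c = convex hull (insert c \<sigma>)"

text \<open>For a cell that is neither a simplex nor a cuboid, a partition with the same connectivities as
  for a cuboid is one that corresponds to the partition of the reference cube into cones under a
  homeomorphism mapping facets to facets.\<close>

definition same_connectivities ::
  "'d::finite region \<Rightarrow> ('d region \<Rightarrow> 'd region) \<Rightarrow> bool" where
  "same_connectivities K H \<longleftrightarrow>
     (\<exists>h g. homeomorphism (ref_cube :: 'd region) K h g \<and>
        (\<forall>f\<in>cell_faces (ref_cube :: 'd region).
           h ` f \<in> cell_faces K \<and> H (h ` f) = h ` cone f (mass_center ref_cube)))"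

definition half_diamonds :: "'d::finite discretization \<Rightarrow> bool" where
  "half_diamonds D \<longleftrightarrow> (\<forall>K\<in>cells D.
     (\<Union>\<sigma>\<in>cell_faces K. half_dia D K \<sigma>) = K \<and>
     (\<forall>\<sigma>\<in>cell_faces K. \<forall>\<sigma>'\<in>cell_faces K.
        \<sigma> \<noteq> \<sigma>' \<longrightarrow> negligible (half_dia D K \<sigma> \<inter> half_dia D K \<sigma>')) \<and>
     (\<forall>\<sigma>\<in>cell_faces K. half_dia D K \<sigma> \<in> sets lebesgue \<and>
        vol (half_dia D K \<sigma>) = vol K / card (cell_faces K)) \<and>
     (if simplicial_cell K \<or> rectangular_cell K
      then \<forall>\<sigma>\<in>cell_faces K. half_dia D K \<sigma> = cone \<sigma> (mass_center K)
      else same_connectivities K (half_dia D K)))"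

definition diamond :: "'d::finite discretization \<Rightarrow> 'd region \<Rightarrow> 'd region" where
  "diamond D \<sigma> = (\<Union>K\<in>adjacent_cells D \<sigma>. half_dia D K \<sigma>)"

text \<open>The faces \<open>\<sigma>'\<close> of \<open>K\<close> such that \<open>D\<^sub>\<sigma>\<close> and \<open>D\<^sub>\<sigma>\<^sub>'\<close> are separated by a dual face included in \<open>K\<close>.
  With cones, this dual face is the cone over \<open>\<sigma> \<inter> \<sigma>'\<close>, so it exists if and only if \<open>\<sigma> \<inter> \<sigma>'\<close> has
  dimension \<open>d-2\<close>.\<close>

definition dual_neighbours :: "'d::finite region \<Rightarrow> 'd region \<Rightarrow> 'd region set" where
  "dual_neighbours K \<sigma> =
     {\<sigma>' \<in> cell_faces K. \<sigma>' \<noteq> \<sigma> \<and> aff_dim (\<sigma> \<inter> \<sigma>') = int CARD('d) - 2}"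


section \<open>Discrete spaces and reconstructions\<close>

definition H0 :: "'d::finite discretization \<Rightarrow> ('d region \<Rightarrow> real^'d) set" where
  "H0 D = {u. \<forall>\<sigma>. \<sigma> \<notin> int_faces D \<longrightarrow> u \<sigma> = 0}"

text \<open>Closed cells (and closed diamonds) overlap on negligible sets only, so the following functions
  have the prescribed constant values almost everywhere.\<close>

definition cell_function ::
  "'d::finite discretization \<Rightarrow> ('d region \<Rightarrow> real) \<Rightarrow> real^'d \<Rightarrow> real" where
  "cell_function D q x = (\<Sum>K\<in>cells D. indicator K x * q K)"

definition face_function ::
  "'d::finite discretization \<Rightarrow> ('d region \<Rightarrow> real^'d) \<Rightarrow> real^'d \<Rightarrow> real^'d" where
  "face_function D u x = (\<Sum>\<sigma>\<in>faces D. indicator (diamond D \<sigma>) x *\<^sub>R u \<sigma>)"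


section \<open>Discrete operators\<close>

definition primal_flux :: "'d::finite discretization \<Rightarrow> ('d region \<Rightarrow> real) \<Rightarrow>
    ('d region \<Rightarrow> real^'d) \<Rightarrow> 'd region \<Rightarrow> 'd region \<Rightarrow> real" where
  "primal_flux D \<rho> u K \<sigma> =
     (if \<sigma> \<in> int_faces D
      then let un = u \<sigma> \<bullet> outward_normal K \<sigma> in
        area \<sigma> * (if un \<ge> 0 then \<rho> K else \<rho> (opposite D K \<sigma>)) * un
      else 0)"

definition div_mass :: "'d::finite discretization \<Rightarrow> ('d region \<Rightarrow> real) \<Rightarrow>
    ('d region \<Rightarrow> real^'d) \<Rightarrow> 'd region \<Rightarrow> real" where
  "div_mass D \<rho> u K = (\<Sum>\<sigma>\<in>cell_faces K. primal_flux D \<rho> u K \<sigma>) / vol K"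

definition div_vel :: "('d region \<Rightarrow> real^'d) \<Rightarrow> 'd::finite region \<Rightarrow> real" where
  "div_vel u K = (\<Sum>\<sigma>\<in>cell_faces K. area \<sigma> * (u \<sigma> \<bullet> outward_normal K \<sigma>)) / vol K"

definition dual_density ::
  "'d::finite discretization \<Rightarrow> ('d region \<Rightarrow> real) \<Rightarrow> 'd region \<Rightarrow> real" where
  "dual_density D \<rho> \<sigma> =
     (\<Sum>K\<in>adjacent_cells D \<sigma>. vol (half_dia D K \<sigma>) * \<rho> K) / vol (diamond D \<sigma>)"

definition dual_flux :: "'d::finite discretization \<Rightarrow> ('d region \<Rightarrow> real) \<Rightarrow>
    ('d region \<Rightarrow> real^'d) \<Rightarrow> 'd region \<Rightarrow> 'd region \<Rightarrow> 'd region \<Rightarrow> real" where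
  "dual_flux D \<rho> u K \<sigma> \<sigma>' =
     (\<Sum>\<sigma>''\<in>cell_faces K. dual_coeff D K \<sigma> \<sigma>' \<sigma>'' * primal_flux D \<rho> u K \<sigma>'')"

definition dual_flux_conditions :: "'d::finite discretization \<Rightarrow> bool" where
  "dual_flux_conditions D \<longleftrightarrow>
     (\<forall>\<rho>. \<forall>u\<in>H0 D. \<forall>K\<in>cells D. \<forall>\<sigma>\<in>cell_faces K.
        primal_flux D \<rho> u K \<sigma> + (\<Sum>\<sigma>'\<in>dual_neighbours K \<sigma>. dual_flux D \<rho> u K \<sigma> \<sigma>') =
          vol (half_dia D K \<sigma>) / vol K * (\<Sum>\<sigma>'\<in>cell_faces K. primal_flux D \<rho> u K \<sigma>') \<and>
        (\<forall>\<sigma>'\<in>dual_neighbours K \<sigma>.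
           dual_flux D \<rho> u K \<sigma> \<sigma>' = - dual_flux D \<rho> u K \<sigma>' \<sigma> \<and>
           \<bar>dual_flux D \<rho> u K \<sigma> \<sigma>'\<bar> \<le>
             Max ((\<lambda>\<sigma>''. \<bar>primal_flux D \<rho> u K \<sigma>''\<bar>) ` cell_faces K)))"

text \<open>Dual faces included in the boundary carry no flux and do not appear in the sum.\<close>

definition div_conv :: "'d::finite discretization \<Rightarrow> ('d region \<Rightarrow> real) \<Rightarrow>
    ('d region \<Rightarrow> real^'d) \<Rightarrow> ('d region \<Rightarrow> real^'d) \<Rightarrow> 'd region \<Rightarrow> real^'d" where
  "div_conv D \<rho> u v \<sigma> =
     (1 / vol (diamond D \<sigma>)) *\<^sub>R
       (\<Sum>K\<in>adjacent_cells D \<sigma>. \<Sum>\<sigma>'\<in>dual_neighbours K \<sigma>.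
          dual_flux D \<rho> u K \<sigma> \<sigma>' *\<^sub>R ((1/2) *\<^sub>R (v \<sigma> + v \<sigma>')))"

text \<open>The expression does not depend on the choice of \<open>K\<close>, since the outward normals of the two
  adjacent cells are opposite.\<close>

definition grad_disc ::
  "'d::finite discretization \<Rightarrow> ('d region \<Rightarrow> real) \<Rightarrow> 'd region \<Rightarrow> real^'d" where
  "grad_disc D q \<sigma> =
     (let K = (SOME K. K \<in> adjacent_cells D \<sigma>); L = opposite D K \<sigma> in
       (area \<sigma> / vol (diamond D \<sigma>) * (q L - q K)) *\<^sub>R outward_normal K \<sigma>)"


section \<open>Finite elements and diffusion\<close>

text \<open>The span of all the differences \<open>x\<^sub>i\<^sup>2 - x\<^sub>j\<^sup>2\<close> is that of the consecutive ones.\<close>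

definition RT_reference_space :: "(real^'d::finite \<Rightarrow> real) set" where
  "RT_reference_space = {g. \<exists>a b c. \<forall>x.
     g x = a + (\<Sum>i\<in>UNIV. b i * x $ i) + (\<Sum>i\<in>UNIV. \<Sum>j\<in>UNIV. c i j * ((x $ i)\<^sup>2 - (x $ j)\<^sup>2))}"

definition local_space :: "'d::finite region \<Rightarrow> (real^'d \<Rightarrow> real) set" where
  "local_space K = {f.
     (simplicial_cell K \<and> (\<exists>a b. \<forall>x\<in>K. f x = a + b \<bullet> x)) \<or>
     (\<exists>v. hexahedral_via v K \<and> (\<exists>g\<in>RT_reference_space. \<forall>x\<in>ref_cube. f (Q1_map v x) = g x))}"

text \<open>The mean value over \<open>\<sigma>'\<close> is prescribed for the traces from all the cells containing \<open>\<sigma>'\<close>, so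
  the mean jump through internal faces is zero.\<close>

definition shape_functions :: "'d::finite discretization \<Rightarrow> bool" where
  "shape_functions D \<longleftrightarrow> (\<forall>\<sigma>\<in>faces D. \<forall>K\<in>cells D.
     shape D \<sigma> K \<in> local_space K \<and>
     (\<forall>\<sigma>'\<in>cell_faces K. face_mean \<sigma>' (shape D \<sigma> K) = (if \<sigma>' = \<sigma> then 1 else 0)))"

definition grad :: "(real^'d::finite \<Rightarrow> real) \<Rightarrow> real^'d \<Rightarrow> real^'d" where
  "grad f x = (THE g. GDERIV f x :> g)"

definition hat :: "'d::finite discretization \<Rightarrow> ('d region \<Rightarrow> real^'d) \<Rightarrow>
    'd region \<Rightarrow> real^'d \<Rightarrow> real^'d" where
  "hat D u K x = (\<Sum>\<sigma>\<in>faces D. shape D \<sigma> K x *\<^sub>R u \<sigma>)"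

text \<open>The \<open>i\<close>-th component of the product of the jacobian matrix of \<open>\<^bold>u\<close> with \<open>\<nabla>\<zeta>\<close> is \<open>\<nabla>u\<^sub>i \<cdot> \<nabla>\<zeta>\<close>.\<close>

definition div_tau :: "'d::finite discretization \<Rightarrow> real \<Rightarrow> real \<Rightarrow>
    ('d region \<Rightarrow> real^'d) \<Rightarrow> 'd region \<Rightarrow> real^'d" where
  "div_tau D \<mu> lam u \<sigma> =
     - (\<mu> / vol (diamond D \<sigma>)) *\<^sub>R
         (\<Sum>K\<in>cells D. LINT x:interior K|lebesgue.
            jacobian (hat D u K) (at x) *v grad (shape D \<sigma> K) x)
     - ((\<mu> + lam) / vol (diamond D \<sigma>)) *\<^sub>R
         (\<Sum>K\<in>cells D. LINT x:interior K|lebesgue.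
            trace (jacobian (hat D u K) (at x)) *\<^sub>R grad (shape D \<sigma> K) x)"


definition staggered_discretization :: "'d::finite discretization \<Rightarrow> bool" where
  "staggered_discretization D \<longleftrightarrow>
     mesh D \<and> half_diamonds D \<and> shape_functions D \<and> dual_flux_conditions D"


section \<open>Time-dependent discrete fields and norms\<close>

text \<open>A family indexed by the relevant time steps is extended by zero to the other ones.\<close>

definition velocity_space ::
  "'d::finite discretization \<Rightarrow> nat \<Rightarrow> (nat \<Rightarrow> 'd region \<Rightarrow> real^'d) set" where
  "velocity_space D N = {u. (\<forall>n\<le>N. u n \<in> H0 D) \<and> (\<forall>n>N. \<forall>\<sigma>. u n \<sigma> = 0)}"

definition pressure_space ::
  "'d::finite discretization \<Rightarrow> nat \<Rightarrow> (nat \<Rightarrow> 'd region \<Rightarrow> real) set" where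
  "pressure_space D N = {q. \<forall>n K. n \<notin> {1..N} \<or> K \<notin> cells D \<longrightarrow> q n K = 0}"

definition discrete_norm ::
  "(nat \<Rightarrow> 's \<Rightarrow> 'v::real_vector) set \<Rightarrow> ((nat \<Rightarrow> 's \<Rightarrow> 'v) \<Rightarrow> real) \<Rightarrow> bool" where
  "discrete_norm X nrm \<longleftrightarrow>
     (\<forall>v\<in>X. 0 \<le> nrm v \<and> (nrm v = 0 \<longleftrightarrow> v = (\<lambda>n s. 0))) \<and>
     (\<forall>v\<in>X. \<forall>c. nrm (\<lambda>n s. c *\<^sub>R v n s) = \<bar>c\<bar> * nrm v) \<and>
     (\<forall>v\<in>X. \<forall>w\<in>X. nrm (\<lambda>n s. v n s + w n s) \<le> nrm v + nrm w)"

definition Lq_norm :: "'d::finite region \<Rightarrow> real \<Rightarrow> (real^'d \<Rightarrow> 'v::real_normed_vector) \<Rightarrow> real" where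
  "Lq_norm \<Omega> q f = (\<integral>x. norm (f x) powr q \<partial>lebesgue_on \<Omega>) powr (1 / q)"

definition Linf_Lq_norm ::
  "'d::finite region \<Rightarrow> nat \<Rightarrow> real \<Rightarrow> (nat \<Rightarrow> real^'d \<Rightarrow> real) \<Rightarrow> real" where
  "Linf_Lq_norm \<Omega> N q f = Max ((\<lambda>n. Lq_norm \<Omega> q (f n)) ` {0..N})"

definition in_L2 :: "'d::finite region \<Rightarrow> (real^'d \<Rightarrow> real^'d) \<Rightarrow> bool" where
  "in_L2 \<Omega> f \<longleftrightarrow>
     f \<in> borel_measurable (lebesgue_on \<Omega>) \<and> integrable (lebesgue_on \<Omega>) (\<lambda>x. (norm (f x))\<^sup>2)"

definition Linf_norm :: "'d::finite region \<Rightarrow> (real^'d \<Rightarrow> real) \<Rightarrow> ereal" where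
  "Linf_norm \<Omega> f = esssup (lebesgue_on \<Omega>) (\<lambda>x. ereal \<bar>f x\<bar>)"

definition in_Linf :: "'d::finite region \<Rightarrow> (real^'d \<Rightarrow> real) \<Rightarrow> bool" where
  "in_Linf \<Omega> f \<longleftrightarrow> f \<in> borel_measurable (lebesgue_on \<Omega>) \<and> Linf_norm \<Omega> f < \<infinity>"

definition weakly_tends_L2 ::
  "'d::finite region \<Rightarrow> (nat \<Rightarrow> real^'d \<Rightarrow> real^'d) \<Rightarrow> (real^'d \<Rightarrow> real^'d) \<Rightarrow> bool" where
  "weakly_tends_L2 \<Omega> f g \<longleftrightarrow> in_L2 \<Omega> g \<and>
     (\<forall>\<phi>. in_L2 \<Omega> \<phi> \<longrightarrow>
        (\<lambda>m. \<integral>x. f m x \<bullet> \<phi> x \<partial>lebesgue_on \<Omega>) \<longlonglongrightarrow> (\<integral>x. g x \<bullet> \<phi> x \<partial>lebesgue_on \<Omega>))"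


section \<open>Schemes\<close>

definition ill_prepared :: "'d::finite region \<Rightarrow> (nat \<Rightarrow> real) \<Rightarrow> (nat \<Rightarrow> real^'d \<Rightarrow> real) \<Rightarrow>
    (nat \<Rightarrow> real^'d \<Rightarrow> real^'d) \<Rightarrow> (real^'d \<Rightarrow> real^'d) \<Rightarrow> bool" where
  "ill_prepared \<Omega> \<epsilon> \<rho>0 u0 u0lim \<longleftrightarrow>
     (\<forall>m. in_Linf \<Omega> (\<rho>0 m) \<and> (AE x in lebesgue_on \<Omega>. 0 < \<rho>0 m x) \<and> in_L2 \<Omega> (u0 m)) \<and>
     (\<exists>C::real. \<forall>m.
        ereal (Lq_norm \<Omega> 2 (u0 m)) + ereal (1 / \<epsilon> m) * Linf_norm \<Omega> (\<lambda>x. \<rho>0 m x - 1) \<le> ereal C) \<and>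
     weakly_tends_L2 \<Omega> u0 u0lim"

definition initial_velocity ::
  "'d::finite discretization \<Rightarrow> (real^'d \<Rightarrow> real^'d) \<Rightarrow> 'd region \<Rightarrow> real^'d" where
  "initial_velocity D u0 \<sigma> =
     (if \<sigma> \<in> int_faces D
      then (1 / vol (diamond D \<sigma>)) *\<^sub>R (LINT x:diamond D \<sigma>|lebesgue. u0 x) else 0)"

definition implicit_scheme ::
  "'d::finite discretization \<Rightarrow> real \<Rightarrow> real \<Rightarrow> real \<Rightarrow> real \<Rightarrow> nat \<Rightarrow> real \<Rightarrow>
   (real^'d \<Rightarrow> real) \<Rightarrow> (real^'d \<Rightarrow> real^'d) \<Rightarrow>
   (nat \<Rightarrow> 'd region \<Rightarrow> real) \<Rightarrow> (nat \<Rightarrow> 'd region \<Rightarrow> real^'d) \<Rightarrow> bool" where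
  "implicit_scheme D \<gamma> \<mu> lam dt N \<epsilon> \<rho>0 u0 \<rho> u \<longleftrightarrow>
     u \<in> velocity_space D N \<and>
     (\<forall>K\<in>cells D. \<rho> 0 K = (LINT x:K|lebesgue. \<rho>0 x) / vol K) \<and>
     u 0 = initial_velocity D u0 \<and>
     (\<forall>n<N.
        (\<forall>K\<in>cells D. (\<rho> (Suc n) K - \<rho> n K) / dt + div_mass D (\<rho> (Suc n)) (u (Suc n)) K = 0) \<and>
        (\<forall>\<sigma>\<in>int_faces D.
           (1 / dt) *\<^sub>R (dual_density D (\<rho> (Suc n)) \<sigma> *\<^sub>R u (Suc n) \<sigma> - dual_density D (\<rho> n) \<sigma> *\<^sub>R u n \<sigma>)
           + div_conv D (\<rho> (Suc n)) (u (Suc n)) (u (Suc n)) \<sigma>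
           - div_tau D \<mu> lam (u (Suc n)) \<sigma>
           + (1 / \<epsilon>\<^sup>2) *\<^sub>R grad_disc D (\<lambda>K. \<rho> (Suc n) K powr \<gamma>) \<sigma> = 0))"

definition incompressible_scheme ::
  "'d::finite discretization \<Rightarrow> real \<Rightarrow> real \<Rightarrow> real \<Rightarrow> nat \<Rightarrow>
   (nat \<Rightarrow> 'd region \<Rightarrow> real^'d) \<Rightarrow> (nat \<Rightarrow> 'd region \<Rightarrow> real) \<Rightarrow> bool" where
  "incompressible_scheme D \<mu> lam dt N u q \<longleftrightarrow>
     u \<in> velocity_space D N \<and> q \<in> pressure_space D N \<and>
     (\<forall>n<N.
        (\<forall>K\<in>cells D. div_vel (u (Suc n)) K = 0) \<and>
        (\<forall>\<sigma>\<in>int_faces D.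
           (1 / dt) *\<^sub>R (u (Suc n) \<sigma> - u n \<sigma>)
           + div_conv D (\<lambda>K. 1) (u (Suc n)) (u (Suc n)) \<sigma>
           - div_tau D \<mu> lam (u (Suc n)) \<sigma>
           + grad_disc D (q (Suc n)) \<sigma> = 0))"

definition pressure_fluctuation :: "'d::finite discretization \<Rightarrow> real \<Rightarrow> nat \<Rightarrow> real \<Rightarrow>
    (nat \<Rightarrow> 'd region \<Rightarrow> real) \<Rightarrow> nat \<Rightarrow> 'd region \<Rightarrow> real" where
  "pressure_fluctuation D \<gamma> N \<epsilon> \<rho> n K =
     (if n \<in> {1..N} \<and> K \<in> cells D
      then (\<rho> n K powr \<gamma> - (\<Sum>L\<in>cells D. vol L * \<rho> n L powr \<gamma>) / vol (domain D)) / \<epsilon>\<^sup>2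
      else 0)"

definition div_free :: "'d::finite discretization \<Rightarrow> ('d region \<Rightarrow> real^'d) set" where
  "div_free D = {v \<in> H0 D. \<forall>K\<in>cells D. div_vel v K = 0}"

text \<open>The orthogonal projection of \<open>f\<close> onto \<open>div_free D\<close> with respect to the \<open>L\<^sup>2\<close> inner product.\<close>

definition L2_projection ::
  "'d::finite discretization \<Rightarrow> (real^'d \<Rightarrow> real^'d) \<Rightarrow> 'd region \<Rightarrow> real^'d" where
  "L2_projection D f = (THE P. P \<in> div_free D \<and>
     (\<forall>v\<in>div_free D.
        (\<integral>x. (f x - face_function D P x) \<bullet> face_function D v x \<partial>lebesgue_on (domain D)) = 0))"

end

(*
The mesh being fixed, everything takes place in a finite-dimensional space.  Upwinding keeps the
densities positive and makes the elastic potential satisfy a discrete balance whose pressure work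
compensates exactly that of the discrete kinetic energy balance, the pressure gradient being dual to
the divergence.  With the relative potential (zero, with zero derivative, at density 1) divided by
epsilon^2, the total energy is nonincreasing and, for ill-prepared data, initially bounded.  Since
the relative potential behaves like (rho - 1)^2 near 1, this gives |rho - 1| = O(epsilon) in every
cell and a bound for the velocities.  The momentum balance then bounds the gradient of the pressure
fluctuation, hence the fluctuation itself: it has zero mean and any two cells are joined by a chain
of cells sharing faces.  All operators are continuous in their finitely many arguments, so the scheme
passes to the limit.  The initial velocity may be projected because its projection error is a discrete
gradient, which the first pressure absorbs.
*)
theory Submission
  imports Defs
begin

section \<open>Facets of polytopes\<close>

text \<open>The definition of a mesh says neither that two cells sharing a face lie on opposite
  sides of it, nor that faces have positive area, nor that every cell is reached from every other
  through internal faces. These facts are derived from polytope geometry, since conservativity of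
  the fluxes and control of the pressure by its gradient rest on them. A second obstacle is
  \<open>grad\<close>: on a hexahedron it is under control only off a negligible set, and the
  Bochner integral of a nonintegrable function is zero, so the diffusion operator can be expanded in
  the face values only after products of shape gradients are shown to be integrable. Third, the
  relative potential is comparable to \<open>(r - 1)\<^sup>2\<close> only near 1; the constants
  \<open>\<gamma> * 2 powr (- \<bar>\<gamma> - 2\<bar>)\<close> and
  \<open>\<gamma> * 2 powr \<bar>\<gamma> - 2\<bar>\<close> bound its second derivative
  \<open>\<gamma> * r powr (\<gamma> - 2)\<close> on [1/2, 2]. The estimates therefore hold for
  large \<open>m\<close> only, and the finitely many other indices are absorbed by a maximum.
  Finally, the upwind density is discontinuous in the velocity; this is harmless in the limit
  because both candidates tend to 1.\<close>

lemma affine_hull_codim_one: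
  fixes \<sigma> :: "'a::euclidean_space set"
  assumes "aff_dim \<sigma> = int DIM('a) - 1" "n \<noteq> 0" "x \<in> \<sigma>" "\<And>y. y \<in> \<sigma> \<Longrightarrow> n \<bullet> y = n \<bullet> x"
  shows "affine hull \<sigma> = {y. n \<bullet> y = n \<bullet> x}"
proof (rule affine_dim_equal)
  show "affine {y. n \<bullet> y = n \<bullet> x}"
    by (rule affine_hyperplane)
  show "affine hull \<sigma> \<noteq> {}" using assms(3) by auto
  show "affine hull \<sigma> \<subseteq> {y. n \<bullet> y = n \<bullet> x}"
    by (rule hull_minimal) (use assms(4) affine_hyperplane in auto)
  show "aff_dim (affine hull \<sigma>) = aff_dim {y. n \<bullet> y = n \<bullet> x}"
    using assms(1,2) by (simp add: aff_dim_hyperplane)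
qed auto

text \<open>The part of \<open>n'\<close> orthogonal to \<open>n\<close> is a direction of the first
  hyperplane, hence also orthogonal to \<open>n'\<close>, hence to itself; so it vanishes.\<close>

lemma unit_normal_unique:
  fixes n n' :: "'a::euclidean_space"
  assumes "norm n = 1" "norm n' = 1" "{y. n \<bullet> y = n \<bullet> x} \<subseteq> {y. n' \<bullet> y = n' \<bullet> x}"
  shows "n' = n \<or> n' = - n"
proof -
  let ?w = "n' - (n' \<bullet> n) *\<^sub>R n"
  have n1: "n \<bullet> n = 1" using assms(1) by (simp add: dot_square_norm)
  have w: "n \<bullet> ?w = 0" by (simp add: inner_diff_right inner_commute n1)
  hence "x + ?w \<in> {y. n \<bullet> y = n \<bullet> x}" by (simp add: inner_add_right)
  hence "n' \<bullet> (x + ?w) = n' \<bullet> x" using assms(3) by blast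
  hence "n' \<bullet> ?w = 0" by (simp only: inner_add_right)
  hence "?w \<bullet> ?w = 0" using w by (simp add: inner_diff_left)
  hence e: "n' = (n' \<bullet> n) *\<^sub>R n" by simp
  hence "norm n' = \<bar>n' \<bullet> n\<bar> * norm n" by (metis norm_scaleR)
  hence "\<bar>n' \<bullet> n\<bar> = 1" using assms by simp
  hence "n' \<bullet> n = 1 \<or> n' \<bullet> n = -1" by linarith
  thus ?thesis using e by (metis scaleR_minus1_left scaleR_one)
qed

text \<open>The property under the definite description in \<open>outward_normal\<close>, named so
  that existence and uniqueness can be treated separately.\<close>

definition is_normal :: "'a::real_inner set \<Rightarrow> 'a set \<Rightarrow> 'a \<Rightarrow> bool" where
  "is_normal K \<sigma> n \<longleftrightarrow> norm n = 1 \<and> (\<forall>x\<in>\<sigma>. \<forall>y\<in>K. n \<bullet> (y - x) \<le> 0)"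

lemma is_normal_const:
  assumes "is_normal K \<sigma> n" "\<sigma> \<subseteq> K" "x \<in> \<sigma>" "y \<in> \<sigma>"
  shows "n \<bullet> y = n \<bullet> x"
  using assms unfolding is_normal_def by (smt (verit) inner_diff_right subsetD)

lemma is_normal_affine_hull:
  fixes K :: "'a::euclidean_space set"
  assumes "is_normal K \<sigma> n" "\<sigma> \<subseteq> K" "aff_dim \<sigma> = int DIM('a) - 1" "x \<in> \<sigma>"
  shows "affine hull \<sigma> = {y. n \<bullet> y = n \<bullet> x}"
proof (rule affine_hull_codim_one[OF assms(3)])
  show "n \<noteq> 0" using assms(1) by (auto simp: is_normal_def)
qed (use assms is_normal_const in blast)+

text \<open>A small move from \<open>z\<close> along \<open>n\<close> stays in \<open>K\<close> and
  increases the inner product, so the weak inequality is strict at interior points. This strictness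
  is what fixes the sign of a normal.\<close>

lemma is_normal_interior:
  fixes K :: "'a::euclidean_space set"
  assumes "is_normal K \<sigma> n" "x \<in> \<sigma>" "z \<in> interior K"
  shows "n \<bullet> z < n \<bullet> x"
proof -
  obtain e where e: "e > 0" "cball z e \<subseteq> K"
    using assms(3) by (meson mem_interior_cball)
  have n1: "n \<bullet> n = 1" "norm n = 1" using assms(1) by (simp_all add: is_normal_def dot_square_norm)
  have "z + e *\<^sub>R n \<in> K" using e n1 by (intro subsetD[OF e(2)]) (simp add: dist_norm)
  hence "n \<bullet> (z + e *\<^sub>R n - x) \<le> 0" using assms by (auto simp: is_normal_def)
  thus ?thesis using e n1 by (simp add: inner_diff_right inner_add_right)
qed

lemma facet_aff_dim:
  fixes K :: "'a::euclidean_space set"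
  assumes "interior K \<noteq> {}" "\<sigma> facet_of K"
  shows "aff_dim \<sigma> = int DIM('a) - 1" "\<sigma> \<subseteq> K" "\<sigma> \<noteq> {}"
  using assms aff_dim_nonempty_interior[of K] face_of_imp_subset
  by (auto simp: facet_of_def)

text \<open>A facet of a polytope is exposed; the supporting functional, once normalised, is a
  normal.\<close>

lemma is_normal_exists:
  fixes K :: "'a::euclidean_space set"
  assumes "polytope K" "interior K \<noteq> {}" "\<sigma> facet_of K"
  shows "\<exists>n. is_normal K \<sigma> n"
proof -
  have "\<sigma> face_of K" using assms(3) by (simp add: facet_of_def)
  hence "\<sigma> exposed_face_of K"
    using assms(1) exposed_face_of_polyhedron polytope_imp_polyhedron by blast
  then obtain a b where ab: "K \<subseteq> {x. a \<bullet> x \<le> b}" "\<sigma> = K \<inter> {x. a \<bullet> x = b}"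
    by (auto simp: exposed_face_of_def)
  have "aff_dim K = int DIM('a)" using assms(2) by (rule aff_dim_nonempty_interior)
  hence "\<sigma> \<noteq> K" using facet_aff_dim(1)[OF assms(2,3)] by auto
  \<comment> \<open>A zero functional would expose only the whole polytope or the empty set, and a
    facet is neither.\<close>
  have "a \<noteq> 0"
  proof
    assume "a = 0"
    hence "\<sigma> = K \<or> \<sigma> = {}" using ab by auto
    thus False using \<open>\<sigma> \<noteq> K\<close> facet_aff_dim(3)[OF assms(2,3)] by auto
  qed
  have "(1 / norm a) * (a \<bullet> (y - x)) \<le> 0" if "x \<in> \<sigma>" "y \<in> K" for x y
  proof (rule mult_nonneg_nonpos)
    show "a \<bullet> (y - x) \<le> 0" using that ab by (auto simp: inner_diff_right)
  qed simp
  hence "is_normal K \<sigma> ((1 / norm a) *\<^sub>R a)"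
    using \<open>a \<noteq> 0\<close> by (auto simp: is_normal_def)
  thus ?thesis by blast
qed

lemma is_normal_sign:
  fixes K :: "'a::euclidean_space set"
  assumes "is_normal K \<sigma> n" "\<sigma> \<subseteq> K" "is_normal L \<sigma> n'" "\<sigma> \<subseteq> L"
    "aff_dim \<sigma> = int DIM('a) - 1" "\<sigma> \<noteq> {}"
  shows "n' = n \<or> n' = - n"
proof -
  obtain x where x: "x \<in> \<sigma>" using assms by blast
  have "{y. n \<bullet> y = n \<bullet> x} \<subseteq> {y. n' \<bullet> y = n' \<bullet> x}"
    using is_normal_affine_hull[OF assms(1,2,5) x] is_normal_affine_hull[OF assms(3,4,5) x] by simp
  thus ?thesis using assms(1,3) unit_normal_unique by (metis is_normal_def)
qed

lemma is_normal_unique: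
  fixes K :: "'a::euclidean_space set"
  assumes "interior K \<noteq> {}" "\<sigma> facet_of K" "is_normal K \<sigma> n" "is_normal K \<sigma> n'"
  shows "n' = n"
proof (rule ccontr)
  assume "n' \<noteq> n"
  hence m: "n' = - n"
    using is_normal_sign[OF assms(3) _ assms(4)] facet_aff_dim[OF assms(1,2)] by blast
  obtain x z where "x \<in> \<sigma>" "z \<in> interior K" using assms(1) facet_aff_dim(3)[OF assms(1,2)] by blast
  with is_normal_interior[OF assms(3)] is_normal_interior[OF assms(4)]
  have "n \<bullet> z < n \<bullet> x" "n' \<bullet> z < n' \<bullet> x" by blast+
  thus False using m by simp
qed

lemma is_normal_outward_normal:
  fixes K :: "'d::finite region"
  assumes "polytope K" "interior K \<noteq> {}" "\<sigma> facet_of K"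
  shows "is_normal K \<sigma> (outward_normal K \<sigma>)"
proof -
  have "\<exists>!n. is_normal K \<sigma> n"
    using is_normal_exists[OF assms] is_normal_unique[OF assms(2,3)] by blast
  from theI'[OF this] show ?thesis
    by (simp add: outward_normal_def is_normal_def)
qed

text \<open>Near a relative interior point of a facet, \<open>K\<close> fills its side of the
  hyperplane: a point \<open>y\<close> of that side lies between a fixed interior point
  \<open>z\<close> and a point \<open>p\<close> of the hyperplane, and \<open>p\<close> falls into
  the facet when \<open>y\<close> is close to \<open>x\<close>.\<close>

lemma half_ball_subset:
  fixes K :: "'a::euclidean_space set"
  assumes K: "convex K" "z \<in> interior K" and n: "is_normal K \<sigma> n"
    and \<sigma>: "\<sigma> \<subseteq> K" "aff_dim \<sigma> = int DIM('a) - 1" and x: "x \<in> rel_interior \<sigma>"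
  shows "\<exists>e>0. ball x e \<inter> {y. n \<bullet> y \<le> n \<bullet> x} \<subseteq> K"
proof -
  have x\<sigma>: "x \<in> \<sigma>" using x rel_interior_subset by blast
  have hull: "affine hull \<sigma> = {y. n \<bullet> y = n \<bullet> x}"
    using is_normal_affine_hull[OF n \<sigma> x\<sigma>] .
  obtain r where r: "r > 0" "ball x r \<inter> affine hull \<sigma> \<subseteq> \<sigma>"
    using x by (auto simp: mem_rel_interior_ball)
  define a where "a = n \<bullet> x - n \<bullet> z"
  have a: "a > 0" using is_normal_interior[OF n x\<sigma> K(2)] by (simp add: a_def)
  define M where "M = norm (z - x)"
  have M: "M \<ge> 0" by (simp add: M_def)
  \<comment> \<open>The first bound gives \<open>t \<le> 1/2\<close>, so the stretching factor
    \<open>1 / (1 - t)\<close> is at most 2; the second then keeps \<open>p\<close> within distance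
    \<open>r\<close> of \<open>x\<close>.\<close>
  define e where "e = min (a/2) (r / (2 * (1 + M / a)))"
  have Ma: "1 + M / a > 0" using M a by (simp add: add_pos_nonneg)
  have e: "e > 0" using a r Ma by (simp add: e_def)
  have e2: "2 * (e + e / a * M) \<le> r"
  proof -
    have "e \<le> r / (2 * (1 + M / a))" by (simp add: e_def)
    hence "e * (2 * (1 + M / a)) \<le> r" using Ma by (simp add: pos_le_divide_eq)
    thus ?thesis by (simp add: algebra_simps)
  qed
  have "y \<in> K" if y: "norm (y - x) < e" "n \<bullet> y \<le> n \<bullet> x" for y
  proof -
    define s where "s = n \<bullet> x - n \<bullet> y"
    have s0: "s \<ge> 0" using y by (simp add: s_def)
    have "s = n \<bullet> (x - y)" by (simp add: s_def inner_diff_right)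
    also have "\<dots> \<le> norm n * norm (x - y)" by (rule norm_cauchy_schwarz)
    also have "\<dots> = norm (y - x)" using n by (simp add: is_normal_def norm_minus_commute)
    finally have s: "s \<le> norm (y - x)" .
    define t where "t = s / a"
    have t0: "t \<ge> 0" using s0 a by (simp add: t_def)
    have "e \<le> a / 2" unfolding e_def by (rule min.cobounded1)
    hence t1: "t \<le> 1/2" using s y a by (simp add: t_def divide_le_eq)
    have tM: "t * M \<le> e / a * M"
      using s y a M by (intro mult_right_mono) (auto simp: t_def divide_right_mono)
    \<comment> \<open>The intersection of the line from \<open>z\<close> through \<open>y\<close>
      with the hyperplane of \<sigma>.\<close>
    define p where "p = (1 / (1 - t)) *\<^sub>R (y - t *\<^sub>R z)"
    have yp: "y = (1 - t) *\<^sub>R p + t *\<^sub>R z" using t1 by (simp add: p_def)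
    have ta: "t * a = s" using a by (simp add: t_def)
    have "n \<bullet> (y - t *\<^sub>R z) = (1 - t) * (n \<bullet> x)"
      using ta by (simp add: inner_diff_right s_def a_def algebra_simps)
    hence np: "n \<bullet> p = n \<bullet> x" using t1 by (simp add: p_def)
    have "p - x = (1 / (1 - t)) *\<^sub>R ((y - x) - t *\<^sub>R (z - x))"
    proof -
      have "(1 - t) *\<^sub>R (p - x) = (y - x) - t *\<^sub>R (z - x)"
        using yp by (simp add: algebra_simps)
      hence "(1 / (1 - t)) *\<^sub>R ((1 - t) *\<^sub>R (p - x)) = (1 / (1 - t)) *\<^sub>R ((y - x) - t *\<^sub>R (z - x))"
        by simp
      thus ?thesis using t1 by simp
    qed
    hence "norm (p - x) = (1 / (1 - t)) * norm ((y - x) - t *\<^sub>R (z - x))" using t1 by simp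
    also have "\<dots> \<le> 2 * norm ((y - x) - t *\<^sub>R (z - x))"
      using t1 by (intro mult_right_mono) (auto simp: divide_le_eq)
    also have "\<dots> \<le> 2 * (norm (y - x) + t * M)"
      using norm_triangle_ineq4[of "y - x" "t *\<^sub>R (z - x)"] t0 by (simp add: M_def)
    also have "\<dots> < 2 * (e + e / a * M)" using y tM by simp
    finally have "norm (p - x) < r" using e2 by simp
    hence "p \<in> ball x r \<inter> affine hull \<sigma>"
      using np by (simp add: hull dist_norm norm_minus_commute)
    hence "p \<in> K" using r \<sigma> by blast
    moreover have "z \<in> K" using K(2) interior_subset by blast
    ultimately show ?thesis
      unfolding yp using t0 t1 by (intro convexD_alt[OF K(1)]) auto
  qed
  thus ?thesis using e by (intro exI[of _ e]) (auto simp: dist_norm norm_minus_commute)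
qed

text \<open>The two unit normals agree up to sign. If they were equal, both cells would contain the
  same half-ball, and its open part would lie in both interiors.\<close>

lemma facet_normals_opposite:
  fixes K :: "'a::euclidean_space set"
  assumes "polytope K" "interior K \<noteq> {}" "polytope L" "interior L \<noteq> {}"
    and disj: "interior K \<inter> interior L = {}"
    and \<sigma>: "\<sigma> facet_of K" "\<sigma> facet_of L" and n: "is_normal K \<sigma> n" "is_normal L \<sigma> n'"
  shows "n' = - n"
proof (rule ccontr)
  assume "n' \<noteq> - n"
  note K = facet_aff_dim[OF assms(2) \<sigma>(1)] and L = facet_aff_dim[OF assms(4) \<sigma>(2)]
  have eq: "n' = n"
    using \<open>n' \<noteq> - n\<close> is_normal_sign[OF n(1) K(2) n(2) L(2) K(1,3)] by blast
  have "convex \<sigma>" using \<sigma>(1) assms(1) facet_of_imp_face_of face_of_imp_convex by blast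
  then obtain x where x: "x \<in> rel_interior \<sigma>" using K(3) rel_interior_eq_empty by blast
  obtain z z' where z: "z \<in> interior K" "z' \<in> interior L" using assms by blast
  obtain e1 where e1: "e1 > 0" "ball x e1 \<inter> {y. n \<bullet> y \<le> n \<bullet> x} \<subseteq> K"
    using half_ball_subset[OF polytope_imp_convex[OF assms(1)] z(1) n(1) K(2,1) x] by blast
  obtain e2 where e2: "e2 > 0" "ball x e2 \<inter> {y. n \<bullet> y \<le> n \<bullet> x} \<subseteq> L"
    using half_ball_subset[OF polytope_imp_convex[OF assms(3)] z(2) n(2) L(2,1) x] eq by blast
  let ?U = "ball x (min e1 e2) \<inter> {y. n \<bullet> y < n \<bullet> x}"
  have U: "open ?U" by (intro open_Int open_ball open_halfspace_lt)
  have "?U \<subseteq> K" "?U \<subseteq> L" using e1(2) e2(2) by auto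
  hence "?U \<subseteq> interior K \<inter> interior L" using U interior_maximal by blast
  moreover have "x - (min e1 e2 / 2) *\<^sub>R n \<in> ?U"
    using n(1) e1 e2 by (auto simp: is_normal_def dist_norm inner_diff_right dot_square_norm)
  ultimately show False using disj by blast
qed

text \<open>The half-balls on the two sides of the facet, one in each cell, together form a
  ball.\<close>

lemma facet_point_interior_Un:
  fixes K :: "'a::euclidean_space set"
  assumes "polytope K" "interior K \<noteq> {}" "polytope L" "interior L \<noteq> {}"
    and "interior K \<inter> interior L = {}"
    and \<sigma>: "\<sigma> facet_of K" "\<sigma> facet_of L" and x: "x \<in> rel_interior \<sigma>"
  shows "x \<in> interior (K \<union> L)"
proof -
  note K = facet_aff_dim[OF assms(2) \<sigma>(1)] and L = facet_aff_dim[OF assms(4) \<sigma>(2)]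
  obtain n n' where n: "is_normal K \<sigma> n" "is_normal L \<sigma> n'"
    using is_normal_exists[OF assms(1,2) \<sigma>(1)] is_normal_exists[OF assms(3,4) \<sigma>(2)] by blast
  have eq: "n' = - n" using facet_normals_opposite assms n by blast
  obtain z z' where z: "z \<in> interior K" "z' \<in> interior L" using assms by blast
  obtain e1 where e1: "e1 > 0" "ball x e1 \<inter> {y. n \<bullet> y \<le> n \<bullet> x} \<subseteq> K"
    using half_ball_subset[OF polytope_imp_convex[OF assms(1)] z(1) n(1) K(2,1) x] by blast
  obtain e2 where e2: "e2 > 0" "ball x e2 \<inter> {y. n' \<bullet> y \<le> n' \<bullet> x} \<subseteq> L"
    using half_ball_subset[OF polytope_imp_convex[OF assms(3)] z(2) n(2) L(2,1) x] by blast
  have "ball x (min e1 e2) \<subseteq> K \<union> L"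
  proof
    fix y assume y: "y \<in> ball x (min e1 e2)"
    show "y \<in> K \<union> L"
    proof (cases "n \<bullet> y \<le> n \<bullet> x")
      case True thus ?thesis using y e1(2) by auto
    next
      case False
      hence "n' \<bullet> y \<le> n' \<bullet> x" using eq by simp
      thus ?thesis using y e2(2) by auto
    qed
  qed
  thus ?thesis using e1(1) e2(1) by (meson mem_interior min_less_iff_conj)
qed

text \<open>The projection maps the prism over \<sigma> into \<sigma>, so the area is the Lebesgue
  measure of the whole prism, which contains a ball.\<close>

lemma area_pos:
  fixes \<sigma> :: "'d::finite region"
  assumes "polytope \<sigma>" "\<sigma> \<noteq> {}" "aff_dim \<sigma> = int CARD('d) - 1"
  shows "area \<sigma> > 0"
proof -
  have dim: "aff_dim \<sigma> = int DIM(real^'d) - 1" using assms(3) by simp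
  have "\<exists>n. norm n = 1 \<and> (\<forall>x\<in>\<sigma>. \<forall>y\<in>\<sigma>. n \<bullet> (x - y) = 0)"
  proof -
    obtain a b where ab: "a \<noteq> 0" "\<sigma> \<subseteq> {x. a \<bullet> x = b}"
      using aff_lowdim_subset_hyperplane[of \<sigma>] dim by auto
    have "(1 / norm a) *\<^sub>R a \<bullet> (x - y) = 0" if "x \<in> \<sigma>" "y \<in> \<sigma>" for x y
      using that ab by (auto simp: inner_diff_right)
    moreover have "norm ((1 / norm a) *\<^sub>R a) = 1" using ab by simp
    ultimately show ?thesis by metis
  qed
  from someI_ex[OF this] have n: "norm (face_normal \<sigma>) = 1"
    "\<And>x y. x \<in> \<sigma> \<Longrightarrow> y \<in> \<sigma> \<Longrightarrow> face_normal \<sigma> \<bullet> (x - y) = 0"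
    by (auto simp: face_normal_def)
  define n where "n = face_normal \<sigma>"
  note n = n[folded n_def]
  define p where "p = (SOME p. p \<in> \<sigma>)"
  have p: "p \<in> \<sigma>" unfolding p_def using assms(2) by (simp add: some_in_eq)
  define P where "P = {x + t *\<^sub>R n | x t. x \<in> \<sigma> \<and> 0 \<le> t \<and> t \<le> 1}"
  define pr where "pr = (\<lambda>y. y - (n \<bullet> (y - p)) *\<^sub>R n)"
  have n1: "n \<bullet> n = 1" using n by (simp add: dot_square_norm)
  have P_alt: "P = (\<lambda>(x,t). x + t *\<^sub>R n) ` (\<sigma> \<times> {0..1})" 
  proof (intro set_eqI iffI)
    fix y assume "y \<in> P"
    then obtain x t where "y = x + t *\<^sub>R n" "(x, t) \<in> \<sigma> \<times> {0..1}" by (auto simp: P_def)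
    thus "y \<in> (\<lambda>(x,t). x + t *\<^sub>R n) ` (\<sigma> \<times> {0..1})" by (intro image_eqI[of _ _ "(x, t)"]) auto
  next
    fix y assume "y \<in> (\<lambda>(x,t). x + t *\<^sub>R n) ` (\<sigma> \<times> {0..1})"
    then obtain x t where "y = x + t *\<^sub>R n" "x \<in> \<sigma>" "0 \<le> t" "t \<le> 1" by auto
    thus "y \<in> P" unfolding P_def by blast
  qed
  have "compact P" unfolding P_alt
    by (intro compact_continuous_image compact_Times[OF polytope_imp_compact[OF assms(1)] compact_Icc])
       (auto simp: split_def intro!: continuous_intros)
  have prP: "pr y \<in> \<sigma>" if y: "y \<in> P" for y
  proof -
    obtain x t where xt: "y = x + t *\<^sub>R n" "x \<in> \<sigma>" using y unfolding P_def by blast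
    have "n \<bullet> (y - p) = t"
      using n(2)[OF xt(2) p] n1 by (simp add: xt inner_add_right inner_diff_right)
    thus ?thesis using xt by (simp add: pr_def)
  qed
  have Pm: "P \<in> sets borel" using \<open>compact P\<close> borel_compact by blast
  have \<sigma>m: "\<sigma> \<in> sets borel" using assms(1) polytope_imp_compact borel_compact by blast
  have prm: "pr \<in> borel_measurable (restrict_space lborel P)"
    by (intro measurable_restrict_space1) (auto simp: pr_def intro!: borel_measurable_continuous_onI continuous_intros)
  have "area \<sigma> = measure (distr (restrict_space lborel P) borel pr) \<sigma>"
    by (simp add: area_def face_measure_def Let_def P_def pr_def n_def p_def)
  also have "\<dots> = measure (restrict_space lborel P) (pr -` \<sigma> \<inter> space (restrict_space lborel P))"
    using prm \<sigma>m by (rule measure_distr)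
  also have "pr -` \<sigma> \<inter> space (restrict_space lborel P) = P"
    using prP by (auto simp: space_restrict_space)
  also have "measure (restrict_space lborel P) P = measure lborel P"
    using Pm by (subst measure_restrict_space) auto
  finally have ar: "area \<sigma> = measure lborel P" .
  obtain x where x: "x \<in> rel_interior \<sigma>"
    using assms(2) rel_interior_eq_empty[OF polytope_imp_convex[OF assms(1)]] by blast
  have x\<sigma>: "x \<in> \<sigma>" using x rel_interior_subset by blast
  have hull: "affine hull \<sigma> = {y. n \<bullet> y = n \<bullet> x}"
  proof (rule affine_hull_codim_one[OF dim])
    show "n \<noteq> 0" using n(1) by auto
    show "n \<bullet> y = n \<bullet> x" if "y \<in> \<sigma>" for y using n(2)[OF that x\<sigma>] by (simp add: inner_diff_right)
  qed (rule x\<sigma>)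
  obtain r where r: "r > 0" "ball x r \<inter> affine hull \<sigma> \<subseteq> \<sigma>"
    using x by (auto simp: mem_rel_interior_ball)
  define e where "e = min (1/2) (r / 2)"
  have e: "e > 0" "e \<le> 1/2" "2 * e \<le> r" using r by (auto simp: e_def)
  \<comment> \<open>The ball is centred at half height above a relative interior point.
    \<open>e \<le> 1/2\<close> keeps the height in [0, 1], and \<open>2 * e \<le> r\<close> keeps
    the foot of each point in \<sigma>.\<close>
  have "ball (x + (1/2) *\<^sub>R n) e \<subseteq> P"
  proof
    fix y assume "y \<in> ball (x + (1/2) *\<^sub>R n) e"
    hence y: "norm (y - x - (1/2) *\<^sub>R n) < e" by (simp add: dist_norm norm_minus_commute algebra_simps)
    define t where "t = n \<bullet> (y - x)"
    have "t - 1/2 = n \<bullet> (y - x - (1/2) *\<^sub>R n)" using n1 by (simp add: t_def inner_diff_right)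
    hence t: "\<bar>t - 1/2\<bar> < e" using Cauchy_Schwarz_ineq2[of n "y - x - (1/2) *\<^sub>R n"] n(1) y by simp
    have "y - t *\<^sub>R n - x = (y - x - (1/2) *\<^sub>R n) - (t - 1/2) *\<^sub>R n" by (simp add: algebra_simps)
    hence "norm (y - t *\<^sub>R n - x) \<le> norm (y - x - (1/2) *\<^sub>R n) + norm ((t - 1/2) *\<^sub>R n)"
      by (metis norm_triangle_ineq4)
    also have "\<dots> < e + e" using y t n(1) by simp
    finally have "norm (y - t *\<^sub>R n - x) < r" using e by simp
    moreover have "n \<bullet> (y - t *\<^sub>R n) = n \<bullet> x" using n1 by (simp add: t_def inner_diff_right)
    ultimately have "y - t *\<^sub>R n \<in> \<sigma>"
      using r(2) by (auto simp: hull dist_norm norm_minus_commute subset_iff)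
    moreover have "0 \<le> t" "t \<le> 1" using t e by auto
    ultimately show "y \<in> P" unfolding P_def by (auto intro!: exI[of _ "y - t *\<^sub>R n"] exI[of _ t])
  qed
  hence "measure lborel (ball (x + (1/2) *\<^sub>R n) e) \<le> measure lborel P"
    using Pm \<open>compact P\<close> emeasure_compact_finite by (intro measure_mono_fmeasurable) (auto simp: fmeasurable_def)
  moreover have "0 < measure lborel (ball (x + (1/2) *\<^sub>R n) e)"
    using content_ball_pos[OF e(1)] by simp
  ultimately show ?thesis using ar by linarith
qed

section \<open>Connectedness of the mesh\<close>

lemma hexahedral_polytope:
  fixes K :: "'d::finite region"
  assumes "hexahedral_cell K" shows "polytope K \<and> interior K \<noteq> {}"
proof -
  obtain v :: "bool^'d \<Rightarrow> real^'d" where "K = convex hull (range v)" "interior K \<noteq> {}"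
    using assms unfolding hexahedral_cell_def hexahedral_via_def by blast
  moreover have "polytope (convex hull (range v))" by (intro polytope_convex_hull) simp
  ultimately show ?thesis by simp
qed

lemma simplicial_polytope:
  fixes K :: "'d::finite region"
  assumes "simplicial_cell K" shows "polytope K \<and> interior K \<noteq> {}"
proof -
  have K: "int CARD('d) simplex K" using assms by (simp add: simplicial_cell_def)
  have "aff_dim K = int DIM(real^'d)" using aff_dim_simplex[OF K] by simp
  hence "affine hull K = UNIV" by (rule iffD1[OF aff_dim_eq_full])
  hence "rel_interior K = interior K" "K \<noteq> {}"
    by (auto simp: rel_interior_interior)
  thus ?thesis using simplex_imp_polytope[OF K] rel_interior_eq_empty[of K] polytope_imp_convex by auto
qed

section \<open>Cells, faces and normals of the mesh\<close>

locale staggered =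
  fixes D :: "'d::finite discretization"
  assumes staggered: "staggered_discretization D"
begin

lemma mesh: "mesh D"
  using staggered by (simp add: staggered_discretization_def)

lemma finite_cells: "finite (cells D)"
  using mesh by (simp add: mesh_def)

lemma cell_polytope: "K \<in> cells D \<Longrightarrow> polytope K"
  and cell_interior: "K \<in> cells D \<Longrightarrow> interior K \<noteq> {}"
  using mesh hexahedral_polytope simplicial_polytope by (auto simp: mesh_def)

lemma cell_convex: "K \<in> cells D \<Longrightarrow> convex K"
  and cell_closed: "K \<in> cells D \<Longrightarrow> closed K"
  and cell_compact: "K \<in> cells D \<Longrightarrow> compact K"
  by (simp_all add: cell_polytope polytope_imp_convex polytope_imp_closed polytope_imp_compact)

lemma closure_interior_cell: "K \<in> cells D \<Longrightarrow> closure (interior K) = K"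
  by (simp add: convex_closure_interior cell_convex cell_interior cell_closed)

lemma cell_interiors_disjoint:
  "K \<in> cells D \<Longrightarrow> L \<in> cells D \<Longrightarrow> K \<noteq> L \<Longrightarrow> interior K \<inter> interior L = {}"
  using mesh by (simp add: mesh_def)

text \<open>\<open>L\<close> is the closure of its interior, and an open set missing a set misses
  its closure.\<close>

lemma cell_interior_disjoint:
  assumes "K \<in> cells D" "L \<in> cells D" "K \<noteq> L"
  shows "interior K \<inter> L = {}"
  using cell_interiors_disjoint[OF assms] closure_interior_cell[OF assms(2)]
  by (metis open_Int_closure_eq_empty open_interior)

lemma finite_cell_faces: "K \<in> cells D \<Longrightarrow> finite (cell_faces K)"
  by (simp add: cell_faces_def finite_polytope_facets cell_polytope)

lemma finite_faces: "finite (faces D)"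
  by (simp add: faces_def finite_cells finite_cell_faces)

lemma int_faces_subset: "int_faces D \<subseteq> faces D"
  by (auto simp: int_faces_def faces_def)

lemma finite_int_faces: "finite (int_faces D)"
  using finite_faces int_faces_subset finite_subset by blast

lemma is_normal_cell:
  "K \<in> cells D \<Longrightarrow> \<sigma> \<in> cell_faces K \<Longrightarrow> is_normal K \<sigma> (outward_normal K \<sigma>)"
  by (simp add: cell_faces_def is_normal_outward_normal cell_polytope cell_interior)

lemma norm_outward_normal:
  "K \<in> cells D \<Longrightarrow> \<sigma> \<in> cell_faces K \<Longrightarrow> norm (outward_normal K \<sigma>) = 1"
  using is_normal_cell by (simp add: is_normal_def)

lemma outward_normal_opposite:
  assumes "K \<in> cells D" "L \<in> cells D" "K \<noteq> L" "\<sigma> \<in> cell_faces K" "\<sigma> \<in> cell_faces L"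
  shows "outward_normal L \<sigma> = - outward_normal K \<sigma>"
  using assms
  by (intro facet_normals_opposite[of K L \<sigma>] cell_polytope cell_interior
      cell_interiors_disjoint is_normal_cell) (auto simp: cell_faces_def)

lemma face_area_pos:
  assumes "\<sigma> \<in> faces D" shows "area \<sigma> > 0"
proof -
  obtain K where K: "K \<in> cells D" "\<sigma> facet_of K" using assms by (auto simp: faces_def cell_faces_def)
  have "polytope \<sigma>" using K cell_polytope facet_of_imp_face_of face_of_polytope_polytope by blast
  thus ?thesis using facet_aff_dim[OF cell_interior[OF K(1)] K(2)] by (intro area_pos) auto
qed

text \<open>Three distinct cells at one face would have pairwise opposite outward normals, forcing a
  unit vector to equal its own opposite.\<close>

lemma adjacent_cells_two:
  assumes "K \<in> adjacent_cells D \<sigma>" "L \<in> adjacent_cells D \<sigma>" "K \<noteq> L"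
  shows "adjacent_cells D \<sigma> = {K, L}"
proof -
  have "M = K \<or> M = L" if "M \<in> adjacent_cells D \<sigma>" for M
  proof (rule ccontr)
    assume M: "\<not> (M = K \<or> M = L)"
    have "outward_normal L \<sigma> = - outward_normal K \<sigma>" "outward_normal M \<sigma> = - outward_normal K \<sigma>"
      "outward_normal M \<sigma> = - outward_normal L \<sigma>"
      using outward_normal_opposite assms that M by (auto simp: adjacent_cells_def)
    hence "outward_normal K \<sigma> + outward_normal K \<sigma> = 0" by (simp add: eq_neg_iff_add_eq_0)
    hence "outward_normal K \<sigma> = 0" by (simp add: scaleR_2[symmetric])
    thus False using norm_outward_normal[of K \<sigma>] assms by (simp add: adjacent_cells_def)
  qed
  thus ?thesis using assms by blast
qed

lemma opposite_eq:
  assumes "K \<in> adjacent_cells D \<sigma>" "L \<in> adjacent_cells D \<sigma>" "K \<noteq> L"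
  shows "opposite D K \<sigma> = L"
  unfolding opposite_def using adjacent_cells_two[OF assms] assms(3) by (intro the_equality) auto

text \<open>Everything about \<open>\<sigma> = K|L\<close> that is needed to turn a sum over the
  adjacent cells into an explicit two-term expression.\<close>

lemma int_faceE:
  assumes "\<sigma> \<in> int_faces D"
  obtains K L where "K \<in> cells D" "L \<in> cells D" "K \<noteq> L" "\<sigma> \<in> cell_faces K" "\<sigma> \<in> cell_faces L"
    "adjacent_cells D \<sigma> = {K, L}" "opposite D K \<sigma> = L" "opposite D L \<sigma> = K"
    "outward_normal L \<sigma> = - outward_normal K \<sigma>"
proof -
  obtain K L where KL: "K \<in> cells D" "L \<in> cells D" "K \<noteq> L" "\<sigma> \<in> cell_faces K" "\<sigma> \<in> cell_faces L"
    using assms by (auto simp: int_faces_def)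
  hence a: "K \<in> adjacent_cells D \<sigma>" "L \<in> adjacent_cells D \<sigma>" by (auto simp: adjacent_cells_def)
  show ?thesis
    using that[OF KL adjacent_cells_two[OF a KL(3)] opposite_eq[OF a KL(3)]
        opposite_eq[OF a(2,1) KL(3)[symmetric]] outward_normal_opposite[OF KL]] .
qed

lemma open_domain: "open (domain D)"
  and connected_domain: "connected (domain D)"
  and bounded_domain: "bounded (domain D)"
  using mesh by (auto simp: mesh_def polyhedral_domain_def)

lemma Union_cells: "\<Union>(cells D) = closure (domain D)"
  using mesh by (simp add: mesh_def)

lemma interior_cell_subset: "K \<in> cells D \<Longrightarrow> interior K \<subseteq> domain D"
  using mesh by (simp add: mesh_def)

lemma faces_cases: "\<sigma> \<in> faces D \<Longrightarrow> \<sigma> \<in> ext_faces D \<or> \<sigma> \<in> int_faces D"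
  using mesh by (auto simp: mesh_def)

text \<open>A generic segment joining two cells inside the domain avoids the faces of codimension two, so
  it passes from one cell to another through the relative interior of an internal face.\<close>

lemma cells_connected:
  assumes R: "R \<subseteq> cells D" "R \<noteq> {}"
    and step: "\<And>\<sigma> K L. \<sigma> \<in> int_faces D \<Longrightarrow> K \<in> R \<Longrightarrow> adjacent_cells D \<sigma> = {K, L} \<Longrightarrow> L \<in> R"
  shows "R = cells D"
proof (rule ccontr)
  assume "R \<noteq> cells D"
  let ?G = "\<Union>R" and ?G' = "\<Union>(cells D - R)"
  obtain K L where KL: "K \<in> R" "L \<in> cells D - R" using R \<open>R \<noteq> cells D\<close> by blast
  have closed: "closed ?G" "closed ?G'"
    using R finite_cells finite_subset cell_closed by (auto intro!: closed_Union)
  have cover: "domain D \<subseteq> ?G \<union> ?G'"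
    using Union_cells closure_subset[of "domain D"] R by blast
  have meet: "domain D \<inter> ?G \<noteq> {}" "domain D \<inter> ?G' \<noteq> {}"
    using KL R interior_cell_subset[of K] interior_cell_subset[of L] cell_interior[of K]
      cell_interior[of L] interior_subset[of K] interior_subset[of L] by blast+
  \<comment> \<open>The domain is connected and covered by two closed sets that both meet it. The
    point \<open>x\<close> obtained may be a bad one, on a face of codimension two; it only serves
    to place a small ball inside the domain.\<close>
  have "?G \<inter> ?G' \<inter> domain D \<noteq> {}"
    using connected_closedD[OF connected_domain _ cover closed] meet by blast
  then obtain x where x: "x \<in> domain D" "x \<in> ?G" "x \<in> ?G'" by blast
  obtain K0 L0 where K0: "x \<in> K0" "K0 \<in> R" and L0: "x \<in> L0" "L0 \<in> cells D - R" using x by blast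
  obtain e where e: "e > 0" "ball x e \<subseteq> domain D"
    using x(1) open_domain by (meson open_contains_ball)
  have "ball x e \<inter> interior K0 \<noteq> {}"
  proof -
    have "x \<in> ball x e \<inter> closure (interior K0)"
      using closure_interior_cell[OF subsetD[OF R(1) K0(2)]] e(1) K0(1) by simp
    hence "ball x e \<inter> closure (interior K0) \<noteq> {}" by blast
    thus ?thesis using open_Int_closure_eq_empty[of "ball x e" "interior K0"] by simp
  qed
  then obtain a where a: "a \<in> ball x e" "a \<in> interior K0" by blast
  have L0U: "ball x e \<inter> interior L0 \<noteq> {}"
  proof -
    have "x \<in> ball x e \<inter> closure (interior L0)"
      using closure_interior_cell[of L0] e(1) L0 by simp
    hence "ball x e \<inter> closure (interior L0) \<noteq> {}" by blast
    thus ?thesis using open_Int_closure_eq_empty[of "ball x e" "interior L0"] by simp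
  qed
  \<comment> \<open>Facets of facets, of dimension d-2: the places where more than two cells can
    meet.\<close>
  define ridges where "ridges = (\<Union>K\<in>cells D. \<Union>\<sigma>\<in>cell_faces K. {\<rho>. \<rho> facet_of \<sigma>})"
  have poly_face: "polytope \<sigma>" if "K \<in> cells D" "\<sigma> \<in> cell_faces K" for K \<sigma>
    using that cell_polytope facet_of_imp_face_of face_of_polytope_polytope
    by (metis cell_faces_def mem_Collect_eq)
  have fin: "finite ridges"
    unfolding ridges_def using finite_cells finite_cell_faces poly_face finite_polytope_facets by blast
  \<comment> \<open>Joining one point to a set of dimension d-2 gives dimension at most d-1.
    Finitely many such hulls cannot cover an open set, which leaves a generic endpoint
    \<open>b\<close> in \<open>L0\<close>.\<close>
  have "negligible (affine hull (insert a \<rho>))" if \<rho>: "\<rho> \<in> ridges" for \<rho>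
  proof -
    obtain K \<sigma> where K: "K \<in> cells D" "\<sigma> \<in> cell_faces K" "\<rho> facet_of \<sigma>"
      using \<rho> unfolding ridges_def by blast
    hence "aff_dim \<rho> = int DIM(real^'d) - 2"
      using facet_aff_dim(1)[OF cell_interior[OF K(1)]] by (simp add: facet_of_def cell_faces_def)
    hence "aff_dim (affine hull (insert a \<rho>)) < int DIM(real^'d)"
      by (simp add: aff_dim_insert)
    then obtain c b where "c \<noteq> 0" "affine hull (insert a \<rho>) \<subseteq> {x. c \<bullet> x = b}"
      by (rule aff_lowdim_subset_hyperplane)
    thus ?thesis using negligible_hyperplane negligible_subset by metis
  qed
  hence "negligible (\<Union>\<rho>\<in>ridges. affine hull (insert a \<rho>))" using fin by (intro negligible_Union) auto
  moreover have "\<not> negligible (ball x e \<inter> interior L0)"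
    using L0U by (intro open_not_negligible) auto
  ultimately have "\<not> ball x e \<inter> interior L0 \<subseteq> (\<Union>\<rho>\<in>ridges. affine hull (insert a \<rho>))"
    using negligible_subset by blast
  then obtain b where b: "b \<in> ball x e" "b \<in> interior L0"
    "\<And>\<rho>. \<rho> \<in> ridges \<Longrightarrow> b \<notin> affine hull (insert a \<rho>)" by blast
  have seg: "closed_segment a b \<subseteq> domain D"
    using a b e(2) by (meson closed_segment_subset convex_ball order_trans)
  \<comment> \<open>The connectedness argument again, now on the segment, so that the common point
    \<open>y\<close> lies on a generic line.\<close>
  have "a \<in> ?G" "b \<in> ?G'" using a b K0 L0 interior_subset by blast+
  hence "?G \<inter> ?G' \<inter> closed_segment a b \<noteq> {}"
    using connected_closedD[OF connected_segment(1)[of a b] _ order_trans[OF seg cover] closed]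
      ends_in_segment[of a b] by blast
  then obtain y where y: "y \<in> closed_segment a b" "y \<in> ?G" "y \<in> ?G'" by blast
  obtain K1 K2 where K1: "y \<in> K1" "K1 \<in> R" and K2: "y \<in> K2" "K2 \<in> cells D" "K2 \<notin> R" using y by blast
  have K1c: "K1 \<in> cells D" using K1 R by blast
  have "y \<notin> interior K1" using cell_interior_disjoint[OF K1c K2(2)] K1 K2 by blast
  hence "y \<in> rel_frontier K1"
    using K1 cell_interior[OF K1c] cell_closed[OF K1c]
    by (simp add: rel_frontier_def rel_interior_nonempty_interior)
  then obtain \<sigma> where \<sigma>: "\<sigma> facet_of K1" "y \<in> \<sigma>"
    using rel_frontier_of_polyhedron polytope_imp_polyhedron cell_polytope[OF K1c] by blast
  hence \<sigma>f: "\<sigma> \<in> faces D" using K1c by (auto simp: faces_def cell_faces_def)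
  have yd: "y \<in> domain D" using y seg by blast
  have "\<not> \<sigma> \<subseteq> frontier (domain D)"
    using yd \<sigma> open_domain by (auto simp: frontier_def interior_open)
  hence \<sigma>i: "\<sigma> \<in> int_faces D" using faces_cases[OF \<sigma>f] by (auto simp: ext_faces_def)
  obtain M where M: "adjacent_cells D \<sigma> = {K1, M}" "M \<noteq> K1" "M \<in> cells D" "\<sigma> \<in> cell_faces M"
  proof -
    have "K1 \<in> adjacent_cells D \<sigma>" using K1c \<sigma> by (simp add: adjacent_cells_def cell_faces_def)
    thus ?thesis using \<sigma>i that by (elim int_faceE) (metis doubleton_eq_iff insert_iff singletonD)
  qed
  have MR: "M \<in> R" using step[OF \<sigma>i K1(2) M(1)] .
  have ya: "y \<noteq> a" using cell_interior_disjoint[of K0 K2] K0 K2 a R by blast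
  \<comment> \<open>Were \<open>y\<close> on a ridge, then \<open>b\<close>, on the line from
    \<open>a\<close> through \<open>y\<close>, would lie in the affine hull excluded by its
    choice.\<close>
  have "y \<in> rel_interior \<sigma>"
  proof (rule ccontr)
    assume "y \<notin> rel_interior \<sigma>"
    have p: "polytope \<sigma>" using poly_face[OF K1c] \<sigma> by (simp add: cell_faces_def)
    hence "y \<in> rel_frontier \<sigma>" using \<open>y \<notin> rel_interior \<sigma>\<close> \<sigma> closure_subset by (auto simp: rel_frontier_def)
    then obtain \<rho> where \<rho>: "\<rho> facet_of \<sigma>" "y \<in> \<rho>"
      using rel_frontier_of_polyhedron polytope_imp_polyhedron p by blast
    hence "\<rho> \<in> ridges" using K1c \<sigma> by (auto simp: ridges_def cell_faces_def)
    obtain t where t: "y = (1 - t) *\<^sub>R a + t *\<^sub>R b" using y(1) by (auto simp: closed_segment_def)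
    have t0: "t \<noteq> 0" using ya t by auto
    have "t *\<^sub>R (b - a) = y - a" using t by (simp add: algebra_simps)
    hence "(1/t) *\<^sub>R (t *\<^sub>R (b - a)) = (1/t) *\<^sub>R (y - a)" by simp
    hence "b - a = (1/t) *\<^sub>R (y - a)" using t0 by simp
    hence "b = a + (1/t) *\<^sub>R (y - a)" by (metis add.commute diff_add_cancel)
    hence "b = (1 - 1/t) *\<^sub>R a + (1/t) *\<^sub>R y" by (simp add: algebra_simps)
    moreover have "a \<in> affine hull (insert a \<rho>)" "y \<in> affine hull (insert a \<rho>)"
      using \<rho>(2) by (simp_all add: hull_inc)
    hence "(1 - 1/t) *\<^sub>R a + (1/t) *\<^sub>R y \<in> affine hull (insert a \<rho>)"
      by (rule mem_affine[OF affine_affine_hull]) simp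
    ultimately show False using b(3)[OF \<open>\<rho> \<in> ridges\<close>] by simp
  qed
  hence yi: "y \<in> interior (K1 \<union> M)"
    using M \<sigma> K1c by (intro facet_point_interior_Un[of _ _ \<sigma>] cell_polytope cell_interior
        cell_interiors_disjoint) (auto simp: cell_faces_def)
  \<comment> \<open>Around \<open>y\<close> there is room only for \<open>K1\<close> and
    \<open>M\<close>, both in \<open>R\<close>, yet the interior of \<open>K2\<close>, a cell
    outside \<open>R\<close>, accumulates there.\<close>
  have "y \<in> closure (interior K2)" using closure_interior_cell K2 by simp
  hence "interior (K1 \<union> M) \<inter> interior K2 \<noteq> {}"
    using yi open_Int_closure_eq_empty[of "interior (K1 \<union> M)" "interior K2"] by blast
  then obtain w where w: "w \<in> interior K2" "w \<in> K1 \<union> M"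
    using interior_subset[of "K1 \<union> M"] by auto
  have "K2 \<noteq> K1" "K2 \<noteq> M" using K2(3) K1(2) MR by auto
  hence "interior K2 \<inter> K1 = {}" "interior K2 \<inter> M = {}"
    using cell_interior_disjoint[OF K2(2)] K1c M(3) by auto
  thus False using w by auto
qed


section \<open>Cells, diamonds and initial data\<close>

lemma half_diamonds: "half_diamonds D"
  using staggered by (simp add: staggered_discretization_def)

lemma half_dia_sets: "K \<in> cells D \<Longrightarrow> \<sigma> \<in> cell_faces K \<Longrightarrow> half_dia D K \<sigma> \<in> sets lebesgue"
  and vol_half_dia: "K \<in> cells D \<Longrightarrow> \<sigma> \<in> cell_faces K \<Longrightarrow>
    vol (half_dia D K \<sigma>) = vol K / card (cell_faces K)"
  and half_dia_negligible: "K \<in> cells D \<Longrightarrow> \<sigma> \<in> cell_faces K \<Longrightarrow> \<sigma>' \<in> cell_faces K \<Longrightarrow> \<sigma> \<noteq> \<sigma>' \<Longrightarrow>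
    negligible (half_dia D K \<sigma> \<inter> half_dia D K \<sigma>')"
  and Union_half_dia: "K \<in> cells D \<Longrightarrow> (\<Union>\<sigma>\<in>cell_faces K. half_dia D K \<sigma>) = K"
  using half_diamonds by (simp_all add: half_diamonds_def)

lemma half_dia_subset: "K \<in> cells D \<Longrightarrow> \<sigma> \<in> cell_faces K \<Longrightarrow> half_dia D K \<sigma> \<subseteq> K"
  using Union_half_dia by blast

lemma cell_lmeasurable: "K \<in> cells D \<Longrightarrow> K \<in> lmeasurable"
  by (simp add: cell_compact lmeasurable_compact)

lemma half_dia_lmeasurable:
  "K \<in> cells D \<Longrightarrow> \<sigma> \<in> cell_faces K \<Longrightarrow> half_dia D K \<sigma> \<in> lmeasurable"
  by (rule fmeasurableI2[OF cell_lmeasurable half_dia_subset half_dia_sets])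

lemma vol_cell_pos:
  assumes "K \<in> cells D" shows "vol K > 0"
proof -
  have "\<not> negligible K"
    using open_not_negligible[OF open_interior cell_interior[OF assms]] negligible_subset interior_subset by blast
  thus ?thesis using cell_lmeasurable[OF assms] negligible_iff_measure
    by (metis less_eq_real_def measure_nonneg)
qed

lemma vol_half_dia_pos:
  assumes "K \<in> cells D" "\<sigma> \<in> cell_faces K" shows "vol (half_dia D K \<sigma>) > 0"
proof -
  have "card (cell_faces K) > 0" using assms finite_cell_faces card_gt_0_iff by blast
  thus ?thesis using vol_half_dia[OF assms] vol_cell_pos[OF assms(1)] by simp
qed

text \<open>The intersection avoids the interior of \<open>K\<close>, so it lies in the frontier of
  a convex set.\<close>

lemma negligible_cell_Int:
  assumes "K \<in> cells D" "L \<in> cells D" "K \<noteq> L" shows "negligible (K \<inter> L)"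
proof -
  have "K \<inter> L \<subseteq> frontier K"
    using cell_interior_disjoint[OF assms] closure_subset by (auto simp: frontier_def)
  thus ?thesis using negligible_convex_frontier[OF cell_convex[OF assms(1)]] negligible_subset by blast
qed

lemma negligible_frontier_domain: "negligible (frontier (domain D))"
proof -
  obtain P where P: "finite P" "\<forall>F\<in>P. polytope F \<and> aff_dim F = int CARD('d) - 1"
    "frontier (domain D) = \<Union>P"
    using mesh by (auto simp: mesh_def polyhedral_domain_def)
  have "negligible F" if "F \<in> P" for F
  proof -
    have "aff_dim F < int DIM(real^'d)" using P that by simp
    then obtain c b where "c \<noteq> 0" "F \<subseteq> {x. c \<bullet> x = b}"
      by (rule aff_lowdim_subset_hyperplane)
    thus ?thesis using negligible_hyperplane negligible_subset by metis
  qed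
  thus ?thesis using P by (auto intro: negligible_Union)
qed

lemma negligible_closure_diff: "negligible (closure (domain D) - domain D)"
  using negligible_frontier_domain open_domain by (simp add: frontier_def interior_open)

lemma domain_lmeasurable: "domain D \<in> lmeasurable"
  using bounded_domain open_domain lmeasurable_open by blast

lemma domain_sets [measurable]: "domain D \<in> sets lebesgue"
  using domain_lmeasurable by blast

lemma vol_domain: "vol (domain D) = (\<Sum>K\<in>cells D. vol K)"
proof -
  have "vol (domain D) = vol (\<Union>(cells D))"
  proof (rule measure_negligible_symdiff[symmetric])
    have "domain D \<subseteq> closure (domain D)" by (rule closure_subset)
    thus "negligible (domain D - \<Union> (cells D) \<union> (\<Union> (cells D) - domain D))"
      using negligible_closure_diff by (simp add: Union_cells Diff_eq_empty_iff[THEN iffD2])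
  qed (rule domain_lmeasurable)
  also have "\<dots> = (\<Sum>K\<in>cells D. vol K)"
    using finite_cells cell_lmeasurable negligible_cell_Int
    by (intro measure_negligible_finite_Union) (auto simp: pairwise_def)
  finally show ?thesis .
qed

lemma vol_domain_pos: "vol (domain D) > 0"
proof -
  have "domain D \<noteq> {}" using mesh by (simp add: mesh_def polyhedral_domain_def)
  hence "\<not> negligible (domain D)" using open_domain open_not_negligible by blast
  thus ?thesis using domain_lmeasurable negligible_iff_measure
    by (metis less_eq_real_def measure_nonneg)
qed

lemma finite_adjacent_cells: "finite (adjacent_cells D \<sigma>)"
  using finite_cells by (simp add: adjacent_cells_def)

lemma diamond_lmeasurable: "diamond D \<sigma> \<in> lmeasurable"
  unfolding diamond_def using finite_adjacent_cells
  by (intro fmeasurable.finite_UN half_dia_lmeasurable) (auto simp: adjacent_cells_def)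

lemma diamond_sets [measurable]: "diamond D \<sigma> \<in> sets lebesgue"
  using diamond_lmeasurable by blast

lemma vol_diamond: "vol (diamond D \<sigma>) = (\<Sum>K\<in>adjacent_cells D \<sigma>. vol (half_dia D K \<sigma>))"
  unfolding diamond_def
proof (rule measure_negligible_finite_Union_image)
  show "pairwise (\<lambda>K L. negligible (half_dia D K \<sigma> \<inter> half_dia D L \<sigma>)) (adjacent_cells D \<sigma>)"
  proof (rule pairwiseI)
    fix K L assume "K \<in> adjacent_cells D \<sigma>" "L \<in> adjacent_cells D \<sigma>" "K \<noteq> L"
    hence "negligible (K \<inter> L)" "half_dia D K \<sigma> \<inter> half_dia D L \<sigma> \<subseteq> K \<inter> L"
      using negligible_cell_Int half_dia_subset unfolding adjacent_cells_def by blast+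
    thus "negligible (half_dia D K \<sigma> \<inter> half_dia D L \<sigma>)" using negligible_subset by blast
  qed
qed (use finite_adjacent_cells half_dia_lmeasurable in \<open>auto simp: adjacent_cells_def\<close>)

lemma vol_diamond_pos: "\<sigma> \<in> faces D \<Longrightarrow> vol (diamond D \<sigma>) > 0"
  unfolding vol_diamond using finite_adjacent_cells vol_half_dia_pos
  by (intro sum_pos) (auto simp: adjacent_cells_def faces_def)

lemma diamond_subset: "diamond D \<sigma> \<subseteq> closure (domain D)"
  using half_dia_subset unfolding diamond_def Union_cells[symmetric]
  by (fastforce simp: adjacent_cells_def)

section \<open>Almost everywhere values of piecewise constant functions\<close>

lemma AE_domain_negligible:
  assumes "negligible Z" "\<And>x. x \<in> domain D \<Longrightarrow> x \<notin> Z \<Longrightarrow> P x"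
  shows "AE x in lebesgue_on (domain D). P x"
proof -
  have "AE x in lebesgue. x \<notin> Z"
    using assms(1) AE_not_in by (simp add: negligible_iff_null_sets)
  hence "AE x in lebesgue. x \<in> domain D \<longrightarrow> P x" using assms(2) by (auto elim: eventually_mono)
  thus ?thesis by (subst AE_restrict_space_iff) auto
qed

text \<open>Outside the overlaps of distinct cells and of distinct half-diamonds of one cell, a
  point selects one cell and then one face. A diamond may reach over two cells, but each of its
  halves stays within its own cell, so no other diamond contains the point.\<close>

lemma AE_unique_cell:
  "AE x in lebesgue_on (domain D). \<exists>K\<in>cells D. \<exists>\<sigma>\<in>cell_faces K.
     (\<forall>L\<in>cells D. x \<in> L \<longleftrightarrow> L = K) \<and> (\<forall>\<sigma>'\<in>faces D. x \<in> diamond D \<sigma>' \<longleftrightarrow> \<sigma>' = \<sigma>)"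
proof -
  define Z where "Z = (\<Union>K\<in>cells D. \<Union>L\<in>cells D - {K}. K \<inter> L) \<union>
    (\<Union>K\<in>cells D. \<Union>\<sigma>\<in>cell_faces K. \<Union>\<sigma>'\<in>cell_faces K - {\<sigma>}. half_dia D K \<sigma> \<inter> half_dia D K \<sigma>')"
  have negligible_UN: "negligible (\<Union>i\<in>I. f i)" if "finite I" "\<And>i. i \<in> I \<Longrightarrow> negligible (f i)"
    for I :: "'d region set" and f :: "'d region \<Rightarrow> 'd region"
    using that by (intro negligible_Union) auto
  show ?thesis
  proof (rule AE_domain_negligible[of Z])
    have n1: "negligible (\<Union>L\<in>cells D - {K}. K \<inter> L)" if "K \<in> cells D" for K
    proof (rule negligible_UN)
      fix L assume "L \<in> cells D - {K}"
      hence "L \<in> cells D" "K \<noteq> L" by blast+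
      thus "negligible (K \<inter> L)" by (rule negligible_cell_Int[OF that])
    qed (simp add: finite_cells)
    have n2: "negligible (\<Union>\<sigma>'\<in>cell_faces K - {\<sigma>}. half_dia D K \<sigma> \<inter> half_dia D K \<sigma>')"
      if "K \<in> cells D" "\<sigma> \<in> cell_faces K" for K \<sigma>
    proof (rule negligible_UN)
      fix \<sigma>' assume "\<sigma>' \<in> cell_faces K - {\<sigma>}"
      hence "\<sigma>' \<in> cell_faces K" "\<sigma> \<noteq> \<sigma>'" by blast+
      thus "negligible (half_dia D K \<sigma> \<inter> half_dia D K \<sigma>')"
        by (rule half_dia_negligible[OF that])
    qed (simp add: finite_cell_faces that)
    show "negligible Z" unfolding Z_def
      by (intro negligible_Un negligible_UN[OF finite_cells] negligible_UN[OF finite_cell_faces] n1 n2)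
    fix x assume x: "x \<in> domain D" "x \<notin> Z"
    have z1: "x \<notin> L" if "K \<in> cells D" "L \<in> cells D" "L \<noteq> K" "x \<in> K" for K L
      using x(2) that unfolding Z_def by blast
    have z2: "x \<notin> half_dia D K \<sigma>'"
      if "K \<in> cells D" "\<sigma> \<in> cell_faces K" "\<sigma>' \<in> cell_faces K" "\<sigma>' \<noteq> \<sigma>" "x \<in> half_dia D K \<sigma>" for K \<sigma> \<sigma>'
      using x(2) that unfolding Z_def by blast
    have "x \<in> \<Union>(cells D)" using x(1) Union_cells closure_subset[of "domain D"] by auto
    then obtain K where K: "K \<in> cells D" "x \<in> K" by blast
    then obtain \<sigma> where \<sigma>: "\<sigma> \<in> cell_faces K" "x \<in> half_dia D K \<sigma>"
      using Union_half_dia[OF K(1)] by blast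
    have cell: "x \<in> L \<longleftrightarrow> L = K" if "L \<in> cells D" for L
      using that K z1[OF K(1) that] by auto
    have dia: "x \<in> diamond D \<sigma>' \<longleftrightarrow> \<sigma>' = \<sigma>" for \<sigma>'
    proof
      assume "x \<in> diamond D \<sigma>'"
      then obtain L where L: "L \<in> cells D" "\<sigma>' \<in> cell_faces L" "x \<in> half_dia D L \<sigma>'"
        by (auto simp: diamond_def adjacent_cells_def)
      hence "L = K" using cell[OF L(1)] half_dia_subset[OF L(1,2)] by blast
      thus "\<sigma>' = \<sigma>" using L z2[OF K(1) \<sigma>(1) _ _ \<sigma>(2), of \<sigma>'] by auto
    next
      assume "\<sigma>' = \<sigma>" thus "x \<in> diamond D \<sigma>'" using \<sigma> K by (auto simp: diamond_def adjacent_cells_def)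
    qed
    show "\<exists>K\<in>cells D. \<exists>\<sigma>\<in>cell_faces K.
       (\<forall>L\<in>cells D. x \<in> L \<longleftrightarrow> L = K) \<and> (\<forall>\<sigma>'\<in>faces D. x \<in> diamond D \<sigma>' \<longleftrightarrow> \<sigma>' = \<sigma>)"
      using K(1) \<sigma>(1) cell dia by blast
  qed
qed

lemma AE_cell_function:
  "AE x in lebesgue_on (domain D). \<exists>K\<in>cells D. x \<in> K \<and> cell_function D q x = q K"
  using AE_unique_cell
proof eventually_elim
  case (elim x)
  then obtain K where K: "K \<in> cells D" "\<forall>L\<in>cells D. x \<in> L \<longleftrightarrow> L = K" by blast
  have "cell_function D q x = (\<Sum>L\<in>cells D. if L = K then q L else 0)"
    unfolding cell_function_def by (intro sum.cong refl) (simp add: K(2) indicator_def)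
  also have "\<dots> = q K" using K(1) finite_cells by (simp add: sum.delta)
  finally have "x \<in> K \<and> cell_function D q x = q K" using K by blast
  thus ?case using K(1) by blast
qed

lemma AE_face_function:
  "AE x in lebesgue_on (domain D). \<exists>\<sigma>\<in>faces D.
     (\<forall>\<sigma>'\<in>faces D. x \<in> diamond D \<sigma>' \<longleftrightarrow> \<sigma>' = \<sigma>) \<and> (\<forall>u. face_function D u x = u \<sigma>)"
  using AE_unique_cell
proof eventually_elim
  case (elim x)
  then obtain K \<sigma> where K: "K \<in> cells D" "\<sigma> \<in> cell_faces K"
    "\<forall>\<sigma>'\<in>faces D. x \<in> diamond D \<sigma>' \<longleftrightarrow> \<sigma>' = \<sigma>" by (elim bexE conjE) (rule that)
  have \<sigma>: "\<sigma> \<in> faces D" using K(1,2) by (auto simp: faces_def)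
  have f: "face_function D u x = u \<sigma>" for u
  proof -
    have "face_function D u x = (\<Sum>\<sigma>'\<in>faces D. if \<sigma>' = \<sigma> then u \<sigma>' else 0)"
      unfolding face_function_def by (intro sum.cong refl) (simp add: K(3) indicator_def)
    thus ?thesis using \<sigma> finite_faces by (simp add: sum.delta)
  qed
  show ?case by (rule bexI[OF _ \<sigma>]) (intro conjI allI K(3) f)
qed

lemma Lq_norm_cell_function_le:
  assumes "1 \<le> q" "0 \<le> \<delta>" "\<And>K. K \<in> cells D \<Longrightarrow> \<bar>r K - 1\<bar> \<le> \<delta>"
  shows "Lq_norm (domain D) q (\<lambda>x. cell_function D r x - 1) \<le> \<delta> * vol (domain D) powr (1/q)"
proof -
  let ?M = "lebesgue_on (domain D)" and ?f = "\<lambda>x. norm (cell_function D r x - 1) powr q"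
  interpret finite_measure ?M
    by (rule finite_measure_lebesgue_on[OF domain_lmeasurable])
  have "integral\<^sup>L ?M ?f \<le> \<delta> powr q * vol (domain D)"
  proof (cases "integrable ?M ?f")
    case True
    have "integral\<^sup>L ?M ?f \<le> integral\<^sup>L ?M (\<lambda>x. \<delta> powr q)"
    proof (rule integral_mono_AE[OF True])
      show "AE x in ?M. ?f x \<le> \<delta> powr q"
        using AE_cell_function[of r]
      proof eventually_elim
        case (elim x)
        then obtain K where "K \<in> cells D" "cell_function D r x = r K" by blast
        thus ?case using assms by (auto intro!: powr_mono2)
      qed
    qed simp
    thus ?thesis by (simp add: measure_restrict_space space_restrict_space mult.commute)
  next
    \<comment> \<open>The integral is zero by convention and the bound is trivial, which spares a
      proof of integrability.\<close>
    case False
    thus ?thesis by (simp add: not_integrable_integral_eq)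
  qed
  hence "Lq_norm (domain D) q (\<lambda>x. cell_function D r x - 1) \<le> (\<delta> powr q * vol (domain D)) powr (1/q)"
    unfolding Lq_norm_def using assms(1) by (intro powr_mono2 integral_nonneg_AE) auto
  also have "\<dots> = (\<delta> powr q) powr (1/q) * vol (domain D) powr (1/q)"
    by (rule powr_mult)
  also have "(\<delta> powr q) powr (1/q) = \<delta>"
    using assms(1,2) unfolding powr_powr by simp
  finally show ?thesis .
qed


section \<open>Averages of the initial data\<close>

lemma in_L2_integrable:
  assumes "in_L2 (domain D) f" shows "integrable (lebesgue_on (domain D)) f"
proof (rule Bochner_Integration.integrable_bound)
  interpret finite_measure "lebesgue_on (domain D)"
    by (rule finite_measure_lebesgue_on[OF domain_lmeasurable])
  show "integrable (lebesgue_on (domain D)) (\<lambda>x. 1 + (norm (f x))\<^sup>2)"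
    using assms by (intro Bochner_Integration.integrable_add) (auto simp: in_L2_def)
  show "f \<in> borel_measurable (lebesgue_on (domain D))" using assms by (simp add: in_L2_def)
  have "t \<le> \<bar>1 + t\<^sup>2\<bar>" if "t \<ge> 0" for t :: real
  proof -
    have "0 \<le> (t - 1)\<^sup>2 + t\<^sup>2 + 1" by simp
    hence "t \<le> 1 + t\<^sup>2" by (simp add: power2_diff)
    thus ?thesis by linarith
  qed
  thus "AE x in lebesgue_on (domain D). norm (f x) \<le> norm (1 + (norm (f x))\<^sup>2)" by simp
qed

text \<open>Averages are taken over closed cells and diamonds, which may leave the open domain by a
  negligible set, whereas the data are controlled on the domain only.\<close>

lemma set_lint_domain:
  fixes f :: "real^'d \<Rightarrow> 'b::euclidean_space"
  assumes f: "integrable (lebesgue_on (domain D)) f" and S: "S \<in> sets lebesgue" "S \<subseteq> closure (domain D)"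
  shows "(LINT x:S|lebesgue. f x) = (\<integral>x. indicator S x *\<^sub>R f x \<partial>lebesgue_on (domain D))"
    and "integrable (lebesgue_on (domain D)) (\<lambda>x. indicator S x *\<^sub>R f x)"
proof -
  have "f absolutely_integrable_on domain D"
    using f by (simp add: integrable_restrict_space set_integrable_def)
  hence 1: "f absolutely_integrable_on (S \<inter> domain D)"
    using S by (rule_tac set_integrable_subset) auto
  have "negligible (S - domain D)"
    using S(2) negligible_closure_diff by (auto intro: negligible_subset)
  hence neg1: "negligible {x \<in> S - S \<inter> domain D. f x \<noteq> 0}" "negligible {x \<in> S \<inter> domain D - S. f x \<noteq> 0}"
    by (auto intro: negligible_subset)
  hence 2: "f absolutely_integrable_on S"
    using absolutely_integrable_spike_set_eq[of S "S \<inter> domain D" f] 1 by blast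
  have ind: "indicator (S \<inter> domain D) x *\<^sub>R f x = indicator (domain D) x *\<^sub>R (indicator S x *\<^sub>R f x)" for x
    by (auto simp: indicator_def)
  show "integrable (lebesgue_on (domain D)) (\<lambda>x. indicator S x *\<^sub>R f x)"
    using 1 by (simp add: integrable_restrict_space set_integrable_def ind)
  have "(LINT x:S|lebesgue. f x) = integral S f"
    by (rule set_lebesgue_integral_eq_integral(2)[OF 2])
  also have "\<dots> = integral (S \<inter> domain D) f"
    by (rule integral_spike_set[OF neg1])
  also have "\<dots> = (LINT x:(S \<inter> domain D)|lebesgue. f x)"
    by (rule set_lebesgue_integral_eq_integral(2)[OF 1, symmetric])
  also have "\<dots> = (\<integral>x. indicator S x *\<^sub>R f x \<partial>lebesgue_on (domain D))"
    by (simp add: integral_restrict_space set_lebesgue_integral_def ind)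
  finally show "(LINT x:S|lebesgue. f x) = (\<integral>x. indicator S x *\<^sub>R f x \<partial>lebesgue_on (domain D))" .
qed

lemma initial_velocity_eq:
  assumes "integrable (lebesgue_on (domain D)) f" "\<sigma> \<in> int_faces D"
  shows "initial_velocity D f \<sigma> = (1 / vol (diamond D \<sigma>)) *\<^sub>R
    (\<integral>x. indicator (diamond D \<sigma>) x *\<^sub>R f x \<partial>lebesgue_on (domain D))"
  using assms set_lint_domain(1)[OF assms(1) diamond_sets diamond_subset] by (simp add: initial_velocity_def)

lemma initial_velocity_H0: "initial_velocity D f \<in> H0 D"
  by (simp add: initial_velocity_def H0_def)

text \<open>The inequality t \<le> 1 + t^2 replaces Cauchy-Schwarz; any bound in terms of the L2
  norm is sufficient here.\<close>

lemma norm_initial_velocity_le: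
  assumes f: "in_L2 (domain D) f" and \<sigma>: "\<sigma> \<in> int_faces D"
  shows "norm (initial_velocity D f \<sigma>) \<le> (1 / vol (diamond D \<sigma>)) *
     (vol (domain D) + (\<integral>x. (norm (f x))\<^sup>2 \<partial>lebesgue_on (domain D)))"
proof -
  let ?M = "lebesgue_on (domain D)"
  interpret finite_measure ?M by (rule finite_measure_lebesgue_on[OF domain_lmeasurable])
  have int: "integrable ?M f" by (rule in_L2_integrable[OF f])
  have int2: "integrable ?M (\<lambda>x. 1 + (norm (f x))\<^sup>2)"
    using f by (intro Bochner_Integration.integrable_add) (auto simp: in_L2_def)
  have "norm (\<integral>x. indicator (diamond D \<sigma>) x *\<^sub>R f x \<partial>?M) \<le> (\<integral>x. 1 + (norm (f x))\<^sup>2 \<partial>?M)"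
  proof (rule order_trans[OF integral_norm_bound integral_mono[OF _ int2]])
    show "integrable ?M (\<lambda>x. norm (indicator (diamond D \<sigma>) x *\<^sub>R f x))"
      by (intro integrable_norm set_lint_domain(2)[OF int diamond_sets diamond_subset])
    fix x
    have "0 \<le> (norm (f x) - 1)\<^sup>2 + (norm (f x))\<^sup>2 + 1" by simp
    hence "norm (f x) \<le> 1 + (norm (f x))\<^sup>2" by (simp add: power2_diff)
    moreover have "norm (indicator (diamond D \<sigma>) x *\<^sub>R f x) \<le> norm (f x)" by (simp add: indicator_def)
    ultimately show "norm (indicator (diamond D \<sigma>) x *\<^sub>R f x) \<le> 1 + (norm (f x))\<^sup>2" by linarith
  qed
  also have "\<dots> = vol (domain D) + (\<integral>x. (norm (f x))\<^sup>2 \<partial>?M)"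
    using f by (subst Bochner_Integration.integral_add)
      (auto simp: in_L2_def measure_restrict_space space_restrict_space)
  finally show ?thesis
    using vol_diamond_pos int_faces_subset \<sigma>
    by (simp add: initial_velocity_eq[OF int \<sigma>] divide_right_mono)
qed

text \<open>Each component of a diamond average is the pairing with a fixed L2 test function, a
  multiple of the indicator of the diamond times a basis vector, so weak convergence applies to
  it.\<close>

lemma initial_velocity_tendsto:
  assumes w: "weakly_tends_L2 (domain D) f g" and f: "\<And>m. in_L2 (domain D) (f m)"
  shows "(\<lambda>m. initial_velocity D (f m) \<sigma>) \<longlonglongrightarrow> initial_velocity D g \<sigma>"
proof (cases "\<sigma> \<in> int_faces D")
  case \<sigma>: True
  let ?M = "lebesgue_on (domain D)"
  interpret finite_measure ?M by (rule finite_measure_lebesgue_on[OF domain_lmeasurable])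
  show ?thesis
  proof (rule vec_tendstoI)
    fix i :: 'd
    define \<phi> where "\<phi> = (\<lambda>x. indicator (diamond D \<sigma>) x *\<^sub>R (axis i 1 :: real^'d))"
    have m: "\<phi> \<in> borel_measurable ?M" unfolding \<phi>_def
      by (intro borel_measurable_scaleR borel_measurable_indicator measurable_restrict_space1) auto
    have "in_L2 (domain D) \<phi>"
      unfolding in_L2_def
    proof (intro conjI m integrable_const_bound[of _ 1])
      show "(\<lambda>x. (norm (\<phi> x))\<^sup>2) \<in> borel_measurable ?M" using m by measurable
      show "AE x in ?M. norm ((norm (\<phi> x))\<^sup>2) \<le> 1" by (simp add: \<phi>_def indicator_def)
    qed
    moreover have comp: "initial_velocity D h \<sigma> $ i = (1 / vol (diamond D \<sigma>)) * (\<integral>x. h x \<bullet> \<phi> x \<partial>?M)"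
      if "integrable ?M h" for h
    proof -
      have "(\<integral>x. indicator (diamond D \<sigma>) x *\<^sub>R h x \<partial>?M) \<bullet> axis i 1 =
        (\<integral>x. (indicator (diamond D \<sigma>) x *\<^sub>R h x) \<bullet> axis i 1 \<partial>?M)"
        using set_lint_domain(2)[OF that diamond_sets diamond_subset] by (intro integral_inner_left[symmetric])
      also have "\<dots> = (\<integral>x. h x \<bullet> \<phi> x \<partial>?M)"
        by (intro Bochner_Integration.integral_cong) (auto simp: \<phi>_def indicator_def)
      finally show ?thesis
        by (simp add: initial_velocity_eq[OF that \<sigma>] cart_eq_inner_axis)
    qed
    ultimately have "(\<lambda>m. (1 / vol (diamond D \<sigma>)) * (\<integral>x. f m x \<bullet> \<phi> x \<partial>?M)) \<longlonglongrightarrow>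
        (1 / vol (diamond D \<sigma>)) * (\<integral>x. g x \<bullet> \<phi> x \<partial>?M)"
      using w unfolding weakly_tends_L2_def by (intro tendsto_mult tendsto_const) blast
    thus "(\<lambda>m. initial_velocity D (f m) \<sigma> $ i) \<longlonglongrightarrow> initial_velocity D g \<sigma> $ i"
      using comp in_L2_integrable[OF f] in_L2_integrable[of g] w by (simp add: weakly_tends_L2_def)
  qed
qed (simp add: initial_velocity_def)

text \<open>The deviation bound is the average of the pointwise one. For positivity, a zero integral
  of an almost everywhere positive function would force the cell to be null.\<close>

lemma initial_density_bounds:
  assumes \<rho>: "in_Linf (domain D) \<rho>" "AE x in lebesgue_on (domain D). 0 < \<rho> x"
    and e: "Linf_norm (domain D) (\<lambda>x. \<rho> x - 1) \<le> ereal e" and K: "K \<in> cells D"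
  shows "0 < (LINT x:K|lebesgue. \<rho> x) / vol K" "\<bar>(LINT x:K|lebesgue. \<rho> x) / vol K - 1\<bar> \<le> e"
proof -
  let ?M = "lebesgue_on (domain D)"
  interpret finite_measure ?M by (rule finite_measure_lebesgue_on[OF domain_lmeasurable])
  have m: "\<rho> \<in> borel_measurable ?M" using \<rho>(1) by (simp add: in_Linf_def)
  have "AE x in ?M. ereal \<bar>\<rho> x - 1\<bar> \<le> Linf_norm (domain D) (\<lambda>x. \<rho> x - 1)"
    unfolding Linf_norm_def using m by (intro esssup_AE) measurable
  hence ae: "AE x in ?M. \<bar>\<rho> x - 1\<bar> \<le> e"
  proof eventually_elim
    case (elim x)
    hence "ereal \<bar>\<rho> x - 1\<bar> \<le> ereal e" using e order_trans by blast
    thus ?case by simp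
  qed
  have int: "integrable ?M \<rho>"
  proof (rule integrable_const_bound[OF _ m])
    show "AE x in ?M. norm (\<rho> x) \<le> 1 + e" using ae by eventually_elim auto
  qed
  have Ks: "K \<in> sets lebesgue" "K \<subseteq> closure (domain D)"
    using K cell_lmeasurable[OF K] Union_cells by blast+
  note KM = set_lint_domain[OF _ Ks]
  have volK: "vol K = (\<integral>x. indicator K x *\<^sub>R (1::real) \<partial>?M)"
    using KM(1)[of "\<lambda>x. 1::real"] Ks cell_lmeasurable[OF K] by (simp add: set_lebesgue_integral_def)
  have int1: "integrable ?M (\<lambda>x. indicator K x *\<^sub>R (1::real))" by (rule KM(2)) simp
  have pos: "vol K > 0" by (rule vol_cell_pos[OF K])
  have "(LINT x:K|lebesgue. \<rho> x) - vol K = (\<integral>x. indicator K x *\<^sub>R \<rho> x - indicator K x *\<^sub>R 1 \<partial>?M)"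
    using KM[OF int] int1 by (simp add: volK)
  hence "\<bar>(LINT x:K|lebesgue. \<rho> x) - vol K\<bar> = norm (\<integral>x. indicator K x *\<^sub>R \<rho> x - indicator K x *\<^sub>R 1 \<partial>?M)"
    by simp
  also have "\<dots> \<le> (\<integral>x. e * (indicator K x *\<^sub>R 1) \<partial>?M)"
  proof (rule order_trans[OF integral_norm_bound])
    show "(\<integral>x. norm (indicator K x *\<^sub>R \<rho> x - indicator K x *\<^sub>R 1) \<partial>?M) \<le> (\<integral>x. e * (indicator K x *\<^sub>R 1) \<partial>?M)"
    proof (rule integral_mono_AE)
      show "AE x in ?M. norm (indicator K x *\<^sub>R \<rho> x - indicator K x *\<^sub>R 1) \<le> e * (indicator K x *\<^sub>R 1)"
        using ae by eventually_elim (auto simp: indicator_def)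
    qed (use KM(2)[OF int] int1 in auto)
  qed
  also have "\<dots> = e * vol K" by (simp add: volK)
  finally have "\<bar>(LINT x:K|lebesgue. \<rho> x) - vol K\<bar> \<le> e * vol K" .
  moreover have "(LINT x:K|lebesgue. \<rho> x) / vol K - 1 = ((LINT x:K|lebesgue. \<rho> x) - vol K) / vol K"
    using pos by (simp add: diff_divide_distrib)
  ultimately show "\<bar>(LINT x:K|lebesgue. \<rho> x) / vol K - 1\<bar> \<le> e"
    using pos by (simp add: divide_le_eq)
  have nn: "AE x in ?M. 0 \<le> indicator K x *\<^sub>R \<rho> x"
    using \<rho>(2) by eventually_elim (auto simp: indicator_def)
  have "(\<integral>x. indicator K x *\<^sub>R \<rho> x \<partial>?M) \<noteq> 0"
  proof
    assume "(\<integral>x. indicator K x *\<^sub>R \<rho> x \<partial>?M) = 0"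
    hence "AE x in ?M. indicator K x *\<^sub>R \<rho> x = 0"
      using integral_nonneg_eq_0_iff_AE[OF KM(2)[OF int] nn] by simp
    hence "AE x in ?M. indicator K x *\<^sub>R (1::real) = 0"
      using \<rho>(2) by eventually_elim (auto simp: indicator_def)
    hence "(\<integral>x. indicator K x *\<^sub>R (1::real) \<partial>?M) = 0" by (rule integral_eq_zero_AE)
    thus False using volK pos by simp
  qed
  moreover have "0 \<le> (\<integral>x. indicator K x *\<^sub>R \<rho> x \<partial>?M)" using nn by (rule integral_nonneg_AE)
  ultimately show "0 < (LINT x:K|lebesgue. \<rho> x) / vol K"
    using pos KM(1)[OF int] by simp
qed

text \<open>A negative essential bound on an absolute value could hold only on a null set. The sign
  is needed to separate the two summands in the extended-real bound of
  \<open>ill_prepared\<close>.\<close>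

lemma Linf_norm_nonneg: "0 \<le> Linf_norm (domain D) f"
proof (rule ccontr)
  let ?M = "lebesgue_on (domain D)"
  assume "\<not> ?thesis"
  hence neg: "Linf_norm (domain D) f < 0" by simp
  have "AE x in ?M. ereal \<bar>f x\<bar> \<le> Linf_norm (domain D) f"
    unfolding Linf_norm_def by (rule esssup_AE)
  hence "AE x in ?M. False"
  proof eventually_elim
    case (elim x)
    hence "ereal \<bar>f x\<bar> < 0" using neg by (rule le_less_trans)
    thus ?case by simp
  qed
  hence "emeasure ?M (space ?M) = 0" using AE_iff_measurable[of "space ?M" ?M "\<lambda>_. False"] by simp
  hence "emeasure lebesgue (domain D) = 0"
    by (simp add: emeasure_restrict_space space_restrict_space)
  thus False using vol_domain_pos by (simp add: measure_def)
qed

lemma ill_prepared_bounds: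
  assumes ip: "ill_prepared (domain D) \<epsilon> \<rho>0 u0 u0lim" and \<epsilon>: "\<And>m. \<epsilon> m > 0"
  shows "\<exists>C\<ge>0. \<forall>m. (\<forall>K\<in>cells D. 0 < (LINT x:K|lebesgue. \<rho>0 m x) / vol K \<and>
      \<bar>(LINT x:K|lebesgue. \<rho>0 m x) / vol K - 1\<bar> \<le> C * \<epsilon> m) \<and>
    (\<forall>\<sigma>. norm (initial_velocity D (u0 m) \<sigma>) \<le> C)"
proof -
  let ?M = "lebesgue_on (domain D)"
  obtain C where C: "\<And>m. ereal (Lq_norm (domain D) 2 (u0 m)) +
      ereal (1 / \<epsilon> m) * Linf_norm (domain D) (\<lambda>x. \<rho>0 m x - 1) \<le> ereal C"
    using ip by (auto simp: ill_prepared_def)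
  have data: "in_Linf (domain D) (\<rho>0 m)" "AE x in ?M. 0 < \<rho>0 m x" "in_L2 (domain D) (u0 m)" for m
    using ip by (auto simp: ill_prepared_def)
  have L2: "0 \<le> Lq_norm (domain D) 2 (u0 m)" for m by (simp add: Lq_norm_def)
  have Li: "0 \<le> ereal (1 / \<epsilon> m) * Linf_norm (domain D) (\<lambda>x. \<rho>0 m x - 1)" for m
    using Linf_norm_nonneg \<epsilon>[of m] by (simp add: ereal_zero_le_0_iff)
  have C1: "Lq_norm (domain D) 2 (u0 m) \<le> C" for m
  proof -
    have "ereal (Lq_norm (domain D) 2 (u0 m)) \<le> ereal (Lq_norm (domain D) 2 (u0 m)) +
      ereal (1 / \<epsilon> m) * Linf_norm (domain D) (\<lambda>x. \<rho>0 m x - 1)" using add_left_mono[OF Li[of m], of "ereal (Lq_norm (domain D) 2 (u0 m))"] by simp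
    also note C[of m]
    finally show ?thesis by simp
  qed
  have C2: "Linf_norm (domain D) (\<lambda>x. \<rho>0 m x - 1) \<le> ereal (C * \<epsilon> m)" for m
  proof -
    have "ereal (1 / \<epsilon> m) * Linf_norm (domain D) (\<lambda>x. \<rho>0 m x - 1) \<le> ereal (Lq_norm (domain D) 2 (u0 m)) +
      ereal (1 / \<epsilon> m) * Linf_norm (domain D) (\<lambda>x. \<rho>0 m x - 1)" using L2[of m] add_right_mono[of 0 "ereal (Lq_norm (domain D) 2 (u0 m))"] by simp
    also note C[of m]
    finally have h: "ereal (1 / \<epsilon> m) * Linf_norm (domain D) (\<lambda>x. \<rho>0 m x - 1) \<le> ereal C" .
    show ?thesis
    proof (cases "Linf_norm (domain D) (\<lambda>x. \<rho>0 m x - 1)")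
      case (real r)
      hence "r / \<epsilon> m \<le> C" using h by simp
      thus ?thesis using real \<epsilon>[of m] by (simp add: divide_le_eq)
    next
      case PInf
      thus ?thesis using h \<epsilon>[of m] by simp
    qed simp
  qed
  have C0: "C \<ge> 0" using L2[of 0] C1[of 0] by linarith
  have sq: "(\<integral>x. (norm (u0 m x))\<^sup>2 \<partial>?M) \<le> C\<^sup>2" for m
  proof -
    let ?I = "\<integral>x. (norm (u0 m x))\<^sup>2 \<partial>?M"
    have I0: "?I \<ge> 0" by simp
    have "Lq_norm (domain D) 2 (u0 m) = sqrt ?I"
      using I0 by (simp add: Lq_norm_def powr_half_sqrt)
    hence "sqrt ?I \<le> C" using C1[of m] by simp
    hence "(sqrt ?I)\<^sup>2 \<le> C\<^sup>2" using I0 by (intro power_mono) auto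
    thus ?thesis using I0 by simp
  qed
  define B where "B \<sigma> = (1 / vol (diamond D \<sigma>)) * (vol (domain D) + C\<^sup>2)" for \<sigma>
  have B0: "0 \<le> B \<sigma>" for \<sigma> by (simp add: B_def)
  have uB: "norm (initial_velocity D (u0 m) \<sigma>) \<le> B \<sigma>" if "\<sigma> \<in> int_faces D" for m \<sigma>
  proof (rule order_trans[OF norm_initial_velocity_le[OF data(3) that]])
    show "1 / vol (diamond D \<sigma>) * (vol (domain D) + (\<integral>x. (norm (u0 m x))\<^sup>2 \<partial>?M)) \<le> B \<sigma>"
      unfolding B_def using sq[of m] by (intro mult_left_mono add_left_mono) auto
  qed
  have SB: "norm (initial_velocity D (u0 m) \<sigma>) \<le> (\<Sum>\<sigma>\<in>int_faces D. B \<sigma>)" for m \<sigma>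
  proof (cases "\<sigma> \<in> int_faces D")
    case True
    thus ?thesis using uB[OF True, of m] member_le_sum[of \<sigma> "int_faces D" B] B0 finite_int_faces by force
  qed (simp add: initial_velocity_def sum_nonneg B0)
  \<comment> \<open>One constant for both estimates: enlarging \<open>C\<close> only weakens the
    density bound, as the Mach numbers are positive.\<close>
  let ?C = "C + (\<Sum>\<sigma>\<in>int_faces D. B \<sigma>)"
  have S0: "0 \<le> (\<Sum>\<sigma>\<in>int_faces D. B \<sigma>)" by (simp add: sum_nonneg B0)
  have "C * \<epsilon> m \<le> ?C * \<epsilon> m" for m using S0 \<epsilon>[of m] by (intro mult_right_mono) auto
  hence "\<bar>(LINT x:K|lebesgue. \<rho>0 m x) / vol K - 1\<bar> \<le> ?C * \<epsilon> m" if "K \<in> cells D" for m K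
    using initial_density_bounds(2)[OF data(1,2) C2 that] order_trans by blast
  moreover have "norm (initial_velocity D (u0 m) \<sigma>) \<le> ?C" for m \<sigma>
    using SB[of m \<sigma>] C0 by linarith
  ultimately show ?thesis
    using C0 S0 initial_density_bounds(1)[OF data(1,2) C2] by (intro exI[of _ ?C]) auto
qed

lemma face_function_measurable: "face_function D u \<in> borel_measurable (lebesgue_on (domain D))"
  unfolding face_function_def
  by (intro borel_measurable_sum borel_measurable_scaleR borel_measurable_indicator
      measurable_restrict_space1) auto

text \<open>A discrete field is constant on diamonds, so only the diamond averages of
  \<open>f\<close> enter. The L2 orthogonality in \<open>L2_projection\<close> thereby becomes
  orthogonality for a finite sum weighted by diamond volumes.\<close>

lemma integral_face_function:
  assumes f: "in_L2 (domain D) f" and v: "v \<in> H0 D"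
  shows "(\<integral>x. (f x - face_function D P x) \<bullet> face_function D v x \<partial>lebesgue_on (domain D)) =
    (\<Sum>\<sigma>\<in>int_faces D. vol (diamond D \<sigma>) * ((initial_velocity D f \<sigma> - P \<sigma>) \<bullet> v \<sigma>))"
proof -
  let ?M = "lebesgue_on (domain D)"
  interpret finite_measure ?M by (rule finite_measure_lebesgue_on[OF domain_lmeasurable])
  have int: "integrable ?M f" by (rule in_L2_integrable[OF f])
  note dm = set_lint_domain[OF _ diamond_sets diamond_subset]
  have intP: "integrable ?M (\<lambda>x. indicator (diamond D \<sigma>) x *\<^sub>R f x - indicator (diamond D \<sigma>) x *\<^sub>R P \<sigma>)" for \<sigma>
    by (intro Bochner_Integration.integrable_diff dm(2) int) simp
  have fm: "f \<in> borel_measurable ?M" using f by (simp add: in_L2_def)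
  have "(\<integral>x. (f x - face_function D P x) \<bullet> face_function D v x \<partial>?M) =
    (\<integral>x. (\<Sum>\<sigma>\<in>int_faces D. (indicator (diamond D \<sigma>) x *\<^sub>R f x - indicator (diamond D \<sigma>) x *\<^sub>R P \<sigma>) \<bullet> v \<sigma>) \<partial>?M)"
  proof (rule integral_cong_AE)
    show "(\<lambda>x. (f x - face_function D P x) \<bullet> face_function D v x) \<in> borel_measurable ?M"
      using fm face_function_measurable by (intro borel_measurable_inner borel_measurable_diff)
    show "(\<lambda>x. \<Sum>\<sigma>\<in>int_faces D. (indicator (diamond D \<sigma>) x *\<^sub>R f x - indicator (diamond D \<sigma>) x *\<^sub>R P \<sigma>) \<bullet> v \<sigma>) \<in> borel_measurable ?M"
      by (intro borel_measurable_sum borel_measurable_inner borel_measurable_const borel_measurable_integrable intP)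
    show "AE x in ?M. (f x - face_function D P x) \<bullet> face_function D v x =
      (\<Sum>\<sigma>\<in>int_faces D. (indicator (diamond D \<sigma>) x *\<^sub>R f x - indicator (diamond D \<sigma>) x *\<^sub>R P \<sigma>) \<bullet> v \<sigma>)"
      using AE_face_function
    proof eventually_elim
      case (elim x)
      then obtain \<sigma> where \<sigma>: "\<sigma> \<in> faces D" and d: "\<forall>\<sigma>'\<in>faces D. x \<in> diamond D \<sigma>' \<longleftrightarrow> \<sigma>' = \<sigma>"
        and ff: "\<forall>u. face_function D u x = u \<sigma>" by (elim bexE conjE) (rule that)
      have "(\<Sum>\<sigma>'\<in>int_faces D. (indicator (diamond D \<sigma>') x *\<^sub>R f x - indicator (diamond D \<sigma>') x *\<^sub>R P \<sigma>') \<bullet> v \<sigma>')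
        = (\<Sum>\<sigma>'\<in>int_faces D. if \<sigma>' = \<sigma> then (f x - P \<sigma>') \<bullet> v \<sigma>' else 0)"
      proof (rule sum.cong[OF refl])
        fix \<sigma>' assume "\<sigma>' \<in> int_faces D"
        hence "x \<in> diamond D \<sigma>' \<longleftrightarrow> \<sigma>' = \<sigma>" using d int_faces_subset by blast
        thus "(indicator (diamond D \<sigma>') x *\<^sub>R f x - indicator (diamond D \<sigma>') x *\<^sub>R P \<sigma>') \<bullet> v \<sigma>' =
          (if \<sigma>' = \<sigma> then (f x - P \<sigma>') \<bullet> v \<sigma>' else 0)" by (simp add: indicator_def)
      qed
      also have "\<dots> = (if \<sigma> \<in> int_faces D then (f x - P \<sigma>) \<bullet> v \<sigma> else 0)"
        using finite_int_faces by (simp add: sum.delta)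
      also have "\<dots> = (f x - P \<sigma>) \<bullet> v \<sigma>" using v by (simp add: H0_def)
      finally show ?case by (simp only: ff)
    qed
  qed
  also have "\<dots> = (\<Sum>\<sigma>\<in>int_faces D. (\<integral>x. (indicator (diamond D \<sigma>) x *\<^sub>R f x - indicator (diamond D \<sigma>) x *\<^sub>R P \<sigma>) \<bullet> v \<sigma> \<partial>?M))"
    using intP by (intro Bochner_Integration.integral_sum) simp
  also have "\<dots> = (\<Sum>\<sigma>\<in>int_faces D. vol (diamond D \<sigma>) * ((initial_velocity D f \<sigma> - P \<sigma>) \<bullet> v \<sigma>))"
  proof (rule sum.cong[OF refl])
    fix \<sigma> assume \<sigma>: "\<sigma> \<in> int_faces D"
    hence pos: "vol (diamond D \<sigma>) > 0" using vol_diamond_pos int_faces_subset by blast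
    have "(\<integral>x. indicator (diamond D \<sigma>) x *\<^sub>R P \<sigma> \<partial>?M) = (LINT x:diamond D \<sigma>|lebesgue. P \<sigma>)"
      by (rule dm(1)[symmetric]) simp
    also have "\<dots> = vol (diamond D \<sigma>) *\<^sub>R P \<sigma>"
      using diamond_lmeasurable[of \<sigma>] by (simp add: set_lebesgue_integral_def fmeasurable_def)
    finally have Pi: "(\<integral>x. indicator (diamond D \<sigma>) x *\<^sub>R P \<sigma> \<partial>?M) = vol (diamond D \<sigma>) *\<^sub>R P \<sigma>" .
    have fi: "(\<integral>x. indicator (diamond D \<sigma>) x *\<^sub>R f x \<partial>?M) = vol (diamond D \<sigma>) *\<^sub>R initial_velocity D f \<sigma>"
      using pos by (simp add: initial_velocity_eq[OF int \<sigma>])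
    have "(\<integral>x. (indicator (diamond D \<sigma>) x *\<^sub>R f x - indicator (diamond D \<sigma>) x *\<^sub>R P \<sigma>) \<bullet> v \<sigma> \<partial>?M)
      = (\<integral>x. indicator (diamond D \<sigma>) x *\<^sub>R f x - indicator (diamond D \<sigma>) x *\<^sub>R P \<sigma> \<partial>?M) \<bullet> v \<sigma>"
      using intP by (intro integral_inner_left)
    also have "(\<integral>x. indicator (diamond D \<sigma>) x *\<^sub>R f x - indicator (diamond D \<sigma>) x *\<^sub>R P \<sigma> \<partial>?M) =
      vol (diamond D \<sigma>) *\<^sub>R initial_velocity D f \<sigma> - vol (diamond D \<sigma>) *\<^sub>R P \<sigma>"
      by (subst Bochner_Integration.integral_diff) (auto simp: fi Pi intro!: dm(2) int)
    finally show "(\<integral>x. (indicator (diamond D \<sigma>) x *\<^sub>R f x - indicator (diamond D \<sigma>) x *\<^sub>R P \<sigma>) \<bullet> v \<sigma> \<partial>?M) =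
      vol (diamond D \<sigma>) * ((initial_velocity D f \<sigma> - P \<sigma>) \<bullet> v \<sigma>)"
      by (simp add: algebra_simps inner_diff_left)
  qed
  finally show ?thesis .
qed

end

section \<open>Gradients of the shape functions\<close>

lemma GDERIV_unique: "GDERIV f x :> g \<Longrightarrow> GDERIV f x :> g' \<Longrightarrow> g = g'"
proof -
  assume "GDERIV f x :> g" "GDERIV f x :> g'"
  hence "(\<lambda>h. h \<bullet> g) = (\<lambda>h. h \<bullet> g')"
    unfolding gderiv_def by (rule has_derivative_unique)
  hence "h \<bullet> g = h \<bullet> g'" for h by (rule fun_cong)
  thus "g = g'" by (metis inner_commute vector_eq_ldot)
qed

lemma grad_eq: "GDERIV f x :> g \<Longrightarrow> grad f x = g"
  unfolding grad_def by (rule the_equality) (auto dest: GDERIV_unique)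

lemma GDERIV_local:
  assumes "GDERIV f x :> g" "open W" "x \<in> W" "\<And>y. y \<in> W \<Longrightarrow> f y = f' y"
  shows "GDERIV f' x :> g"
  using assms unfolding gderiv_def by (rule has_derivative_transform_within_open)

lemma linear_functional_inner:
  fixes L :: "'a::euclidean_space \<Rightarrow> real"
  assumes "linear L" shows "\<exists>G. L = (\<lambda>h. h \<bullet> G)"
proof (intro exI ext)
  fix h show "L h = h \<bullet> adjoint L 1"
    using adjoint_works[OF assms, of h 1] by simp
qed

text \<open>The product rule applied to each vertex weight of \<open>Q1_map\<close>; the sign is
  that of \<open>x $ i\<close> or \<open>1 - x $ i\<close>.\<close>

definition Q1_deriv :: "(bool^'d \<Rightarrow> real^'d) \<Rightarrow> real^'d \<Rightarrow> real^'d \<Rightarrow> real^'d::finite" where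
  "Q1_deriv v x h = (\<Sum>b\<in>UNIV. (\<Sum>i\<in>UNIV. (if b $ i then h $ i else - (h $ i)) *
     (\<Prod>j\<in>UNIV - {i}. if b $ j then x $ j else 1 - x $ j)) *\<^sub>R v b)"

lemma Q1_map_has_derivative: "(Q1_map v has_derivative Q1_deriv v x) (at x)"
proof -
  have c: "((\<lambda>x. if b $ i then x $ i else 1 - x $ i) has_derivative
      (\<lambda>h. if b $ i then h $ i else - (h $ i))) (at x)" for b :: "bool^'a" and i
    by (cases "b $ i") (auto intro!: derivative_eq_intros bounded_linear.has_derivative[OF bounded_linear_vec_nth])
  show ?thesis
    unfolding Q1_map_def[abs_def] Q1_deriv_def[abs_def]
    by (intro has_derivative_sum has_derivative_scaleR_left has_derivative_prod c)
qed

lemma continuous_on_Q1_deriv: "continuous_on S (\<lambda>p. Q1_deriv v (fst p) (snd p))"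
proof -
  have "continuous_on S (\<lambda>p. if b $ i then snd p $ i else - (snd p $ i))" for b :: "bool^'a" and i
    by (cases "b $ i") (auto intro!: continuous_intros)
  moreover have "continuous_on S (\<lambda>p. if b $ i then fst p $ i else 1 - fst p $ i)" for b :: "bool^'a" and i
    by (cases "b $ i") (auto intro!: continuous_intros)
  ultimately show ?thesis
    unfolding Q1_deriv_def by (intro continuous_intros)
qed

text \<open>Joint continuity in the point and the direction is stated because compactness will be
  used on the cube times the unit sphere.\<close>

lemma RT_has_derivative:
  assumes "g \<in> RT_reference_space"
  obtains g' where "\<And>x. (g has_derivative g' x) (at x)" "\<And>S. continuous_on S (\<lambda>p. g' (fst p) (snd p))"
proof -
  obtain a b c where g: "\<And>x. g x = a + (\<Sum>i\<in>UNIV. b i * x $ i) +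
      (\<Sum>i\<in>UNIV. \<Sum>j\<in>UNIV. c i j * ((x $ i)\<^sup>2 - (x $ j)\<^sup>2))"
    using assms unfolding RT_reference_space_def by blast
  define g' where "g' x h = (\<Sum>i\<in>UNIV. b i * h $ i) +
      (\<Sum>i\<in>UNIV. \<Sum>j\<in>UNIV. c i j * (2 * (h $ i * x $ i) - 2 * (h $ j * x $ j)))" for x h :: "real^'a"
  have n: "((\<lambda>x. x $ i) has_derivative (\<lambda>h. h $ i)) (at x)" for i and x :: "real^'a"
    by (rule bounded_linear.has_derivative[OF bounded_linear_vec_nth has_derivative_ident])
  have ge: "g = (\<lambda>x. a + (\<Sum>i\<in>UNIV. b i * x $ i) +
      (\<Sum>i\<in>UNIV. \<Sum>j\<in>UNIV. c i j * ((x $ i)\<^sup>2 - (x $ j)\<^sup>2)))" using g by blast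
  have "(g has_derivative g' x) (at x)" for x
    unfolding ge g'_def[abs_def]
    by (auto intro!: derivative_eq_intros n simp: algebra_simps)
  moreover have "continuous_on S (\<lambda>p. g' (fst p) (snd p))" for S
    unfolding g'_def by (intro continuous_intros)
  ultimately show ?thesis using that by blast
qed

text \<open>The norm attains its extrema on the compact set \<open>A \<times> sphere 0 1\<close>,
  and homogeneity extends the bounds to all directions. The lower bound controls the inverses of an
  injective family uniformly.\<close>

lemma homogeneous_bounds:
  fixes F :: "real^'d \<Rightarrow> real^'d \<Rightarrow> 'b::real_normed_vector"
  assumes cont: "continuous_on (A \<times> sphere 0 1) (\<lambda>p. F (fst p) (snd p))" and A: "compact A"
    and lin: "\<And>x. linear (F x)"
  shows "\<exists>M. M \<ge> 0 \<and> (\<forall>x\<in>A. \<forall>h. norm (F x h) \<le> M * norm h)"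
    and "(\<And>x h. x \<in> A \<Longrightarrow> F x h = 0 \<Longrightarrow> h = 0) \<Longrightarrow> \<exists>c>0. \<forall>x\<in>A. \<forall>h. c * norm h \<le> norm (F x h)"
proof -
  have comp: "compact (A \<times> sphere (0::real^'d) 1)" by (intro compact_Times A compact_sphere)
  have c: "continuous_on (A \<times> sphere (0::real^'d) 1) (\<lambda>p. norm (F (fst p) (snd p)))"
    by (intro continuous_intros cont)
  have hom: "norm (F x h) = norm h * norm (F x ((1 / norm h) *\<^sub>R h))" if "h \<noteq> 0" for x h
    using that linear_scale[OF lin, of x "1 / norm h" h] by simp
  have F0: "F x 0 = 0" for x using linear_0[OF lin] .
  show "\<exists>M. M \<ge> 0 \<and> (\<forall>x\<in>A. \<forall>h. norm (F x h) \<le> M * norm h)"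
  proof (cases "A = {}")
    case False
    hence ne: "A \<times> sphere (0::real^'d) 1 \<noteq> {}" by simp
    obtain p where p: "\<And>q. q \<in> A \<times> sphere 0 1 \<Longrightarrow> norm (F (fst q) (snd q)) \<le> norm (F (fst p) (snd p))"
      using continuous_attains_sup[OF comp ne c] by blast
    have "norm (F x h) \<le> norm (F (fst p) (snd p)) * norm h" if "x \<in> A" for x h
    proof (cases "h = 0")
      case False
      hence "norm (F x ((1 / norm h) *\<^sub>R h)) \<le> norm (F (fst p) (snd p))"
        using p[of "(x, (1 / norm h) *\<^sub>R h)"] that by simp
      thus ?thesis unfolding hom[OF False, of x] by (simp add: mult.commute mult_left_mono)
    qed (simp add: F0)
    thus ?thesis using norm_ge_zero by blast
  next
    case True
    thus ?thesis by blast
  qed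
  show "\<exists>c>0. \<forall>x\<in>A. \<forall>h. c * norm h \<le> norm (F x h)"
    if inj: "\<And>x h. x \<in> A \<Longrightarrow> F x h = 0 \<Longrightarrow> h = 0"
  proof (cases "A = {}")
    case False
    hence ne: "A \<times> sphere (0::real^'d) 1 \<noteq> {}" by simp
    obtain p where p0: "p \<in> A \<times> sphere 0 1"
      and p: "\<And>q. q \<in> A \<times> sphere 0 1 \<Longrightarrow> norm (F (fst p) (snd p)) \<le> norm (F (fst q) (snd q))"
      using continuous_attains_inf[OF comp ne c] by blast
    have "snd p \<noteq> 0" using p0 by auto
    hence pos: "norm (F (fst p) (snd p)) > 0" using inj[of "fst p" "snd p"] p0 by auto
    have "norm (F (fst p) (snd p)) * norm h \<le> norm (F x h)" if "x \<in> A" for x h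
    proof (cases "h = 0")
      case False
      hence "norm (F (fst p) (snd p)) \<le> norm (F x ((1 / norm h) *\<^sub>R h))"
        using p[of "(x, (1 / norm h) *\<^sub>R h)"] that by simp
      thus ?thesis unfolding hom[OF False, of x] by (simp add: mult.commute mult_left_mono)
    qed (simp add: F0)
    thus ?thesis using pos by blast
  next
    case True
    thus ?thesis using zero_less_one by blast
  qed
qed

text \<open>\<open>W\<close> is the image of the open cube: open by invariance of domain, and
  missing from the interior of \<open>K\<close> at most the image of the frontier of the cube, which
  is negligible because the mapping is differentiable. On \<open>W\<close>, \<open>f\<close> is
  \<open>g\<close> composed with the inverse mapping, whose derivative is bounded by
  \<open>1 / c\<close>.\<close>

lemma RT_element_gradient:
  fixes K :: "'d::finite region"
  assumes v: "hexahedral_via v K" and g: "g \<in> RT_reference_space"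
    and f: "\<And>x. x \<in> ref_cube \<Longrightarrow> f (Q1_map v x) = g x"
  shows "\<exists>W B. open W \<and> W \<subseteq> interior K \<and> negligible (interior K - W) \<and>
    (\<forall>x\<in>W. \<exists>G. GDERIV f x :> G \<and> norm G \<le> B)"
proof -
  let ?Q = "Q1_map v" and ?C = "ref_cube :: 'd region"
  have bij: "bij_betw ?Q ?C K" and det: "\<And>x. x \<in> ?C \<Longrightarrow> det (jacobian ?Q (at x)) \<noteq> 0"
    using v unfolding hexahedral_via_def by blast+
  note Qd = Q1_map_has_derivative[of v]
  have lin: "linear (Q1_deriv v x)" for x by (rule has_derivative_linear[OF Qd])
  have contQ: "continuous_on S ?Q" for S
    by (intro continuous_at_imp_continuous_on ballI has_derivative_continuous[OF Qd])
  have injd: "inj (Q1_deriv v x)" if "x \<in> ?C" for x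
  proof -
    have "frechet_derivative ?Q (at x) = Q1_deriv v x" by (rule frechet_derivative_at[OF Qd, symmetric])
    hence "det (matrix (Q1_deriv v x)) \<noteq> 0" using det[OF that] by (simp add: jacobian_def)
    thus ?thesis using det_nz_iff_inj[OF lin] by blast
  qed
  have ker: "h = 0" if "x \<in> ?C" "Q1_deriv v x h = 0" for x h
    using injd[OF that(1)] that(2) unfolding linear_injective_0[OF lin[of x]] by simp
  have "\<exists>c>0. \<forall>x\<in>?C. \<forall>h. c * norm h \<le> norm (Q1_deriv v x h)"
    by (rule homogeneous_bounds(2)[OF continuous_on_Q1_deriv compact_cbox lin ker])
  then obtain c where c: "c > 0" "\<And>x h. x \<in> ?C \<Longrightarrow> c * norm h \<le> norm (Q1_deriv v x h)" by blast
  obtain g' where g': "\<And>x. (g has_derivative g' x) (at x)"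
      "\<And>S. continuous_on S (\<lambda>p. g' (fst p) (snd p))"
    by (rule RT_has_derivative[OF g]) (rule that)
  have ling: "linear (g' x)" for x by (rule has_derivative_linear[OF g'(1)])
  have "\<exists>M. M \<ge> 0 \<and> (\<forall>x\<in>?C. \<forall>h. norm (g' x h) \<le> M * norm h)"
    by (rule homogeneous_bounds(1)[OF g'(2) compact_cbox ling])
  then obtain M where M: "M \<ge> 0" "\<And>x h. x \<in> ?C \<Longrightarrow> norm (g' x h) \<le> M * norm h" by blast
  let ?I = "interior ?C" and ?W = "?Q ` interior ?C"
  have IC: "?I \<subseteq> ?C" by (rule interior_subset)
  have injC: "inj_on ?Q ?C" and img: "?Q ` ?C = K" using bij by (auto simp: bij_betw_def)
  have openW: "open ?W"
    by (rule invariance_of_domain[OF contQ open_interior inj_on_subset[OF injC IC]])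
  have "?W \<subseteq> K" using img IC by blast
  hence WK: "?W \<subseteq> interior K" using openW by (rule interior_maximal)
  have "interior K - ?W \<subseteq> ?Q ` frontier ?C"
    using img interior_subset[of K] closed_cbox by (auto simp: frontier_def closure_closed)
  moreover have "negligible (?Q ` frontier ?C)"
  proof (rule negligible_differentiable_image_negligible[OF order_refl])
    show "negligible (frontier ?C)" by (rule negligible_convex_frontier[OF convex_box(1)])
    show "?Q differentiable_on frontier ?C"
      unfolding differentiable_on_def differentiable_def using has_derivative_at_withinI[OF Qd] by blast
  qed
  ultimately have neg: "negligible (interior K - ?W)" by (rule negligible_subset[rotated])
  have "\<exists>G. GDERIV f x :> G \<and> norm G \<le> M / c" if x: "x \<in> ?W" for x
  proof -
    obtain y where y: "y \<in> ?I" "x = ?Q y" using x by blast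
    have yC: "y \<in> ?C" using y IC by blast
    define R where "R = inv (Q1_deriv v y)"
    have surj: "surj (Q1_deriv v y)" by (rule linear_inj_imp_surj[OF lin injd[OF yC]])
    have QR: "Q1_deriv v y \<circ> R = id" unfolding R_def using surj by (simp add: surj_iff)
    define P where "P = inv_into ?C ?Q"
    have PQ: "P (?Q z) = z" if "z \<in> ?I" for z
      unfolding P_def by (rule inv_into_f_f[OF injC]) (use that IC in blast)
    have "(P has_derivative R) (at (?Q y))"
      by (rule has_derivative_inverse_strong[OF open_interior y(1) contQ PQ Qd QR])
    hence "(P has_derivative R) (at x)" using y by simp
    moreover have "(g has_derivative g' y) (at (P x))" using g'(1) PQ[OF y(1)] y by simp
    ultimately have "((g \<circ> P) has_derivative (g' y \<circ> R)) (at x)"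
      by (rule diff_chain_at)
    moreover have "(g \<circ> P) w = f w" if "w \<in> ?W" for w
    proof -
      obtain z where "z \<in> ?I" "w = ?Q z" using \<open>w \<in> ?W\<close> by blast
      thus ?thesis using PQ f[of z] IC by auto
    qed
    ultimately have fd: "(f has_derivative (g' y \<circ> R)) (at x)"
      by (rule has_derivative_transform_within_open[OF _ openW x])
    obtain G where G: "(g' y \<circ> R) = (\<lambda>h. h \<bullet> G)"
      using linear_functional_inner[OF has_derivative_linear[OF fd]] by blast
    \<comment> \<open>Testing the derivative with its own gradient bounds the norm of
      \<open>G\<close>, through the bound \<open>M\<close> for \<open>g'\<close> and
      \<open>1 / c\<close> for \<open>R\<close>.\<close>
    have "norm G * norm G = (g' y \<circ> R) G" by (simp add: G dot_square_norm power2_eq_square)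
    also have "\<dots> \<le> M * norm (R G)" using M(2)[OF yC, of "R G"] by simp
    also have "\<dots> \<le> M * (norm G / c)"
    proof (rule mult_left_mono[OF _ M(1)])
      have "c * norm (R G) \<le> norm G" using c(2)[OF yC, of "R G"] QR by (metis comp_apply id_apply)
      thus "norm (R G) \<le> norm G / c" using c(1) by (simp add: le_divide_eq mult.commute)
    qed
    finally have "norm G * norm G \<le> (M / c) * norm G" by simp
    hence "norm G \<le> M / c"
      using M(1) c(1) mult_right_le_imp_le[of "norm G" "norm G" "M / c"] by (cases "G = 0") auto
    moreover have "GDERIV f x :> G" using fd unfolding gderiv_def G .
    ultimately show ?thesis by blast
  qed
  thus ?thesis using openW WK neg by blast
qed

lemma local_space_gradient:
  fixes K :: "'d::finite region"
  assumes "f \<in> local_space K"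
  shows "\<exists>W B. open W \<and> W \<subseteq> interior K \<and> negligible (interior K - W) \<and>
    (\<forall>x\<in>W. \<exists>G. GDERIV f x :> G \<and> norm G \<le> B)"
proof -
  consider (simplex) a b where "\<forall>x\<in>K. f x = a + b \<bullet> x" |
    (RT) v g where "hexahedral_via v K" "g \<in> RT_reference_space" "\<forall>x\<in>ref_cube. f (Q1_map v x) = g x"
    using assms unfolding local_space_def by blast
  thus ?thesis
  proof cases
    case simplex
    have d: "GDERIV (\<lambda>x. a + b \<bullet> x) x :> b" for x
      unfolding gderiv_def by (auto intro!: derivative_eq_intros simp: inner_commute)
    have "GDERIV f x :> b" if "x \<in> interior K" for x
    proof (rule GDERIV_local[OF d open_interior that])
      fix y assume "y \<in> interior K"
      hence "y \<in> K" using interior_subset by (rule subsetD[rotated])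
      thus "a + b \<bullet> y = f y" using simplex by simp
    qed
    thus ?thesis by (intro exI[of _ "interior K"] exI[of _ "norm b"]) auto
  next
    case RT
    thus ?thesis using RT_element_gradient[of v K g f] by blast
  qed
qed

text \<open>Every component is the pointwise limit of difference quotients with steps
  \<open>1 / real (Suc n)\<close>, and these are measurable.\<close>

lemma gradient_measurable:
  fixes f :: "real^'d::finite \<Rightarrow> real"
  assumes W: "open W" and f: "\<And>x. x \<in> W \<Longrightarrow> GDERIV f x :> G x"
  shows "(\<lambda>x. indicator W x *\<^sub>R G x) \<in> borel_measurable borel"
  unfolding borel_measurable_euclidean_space[of "\<lambda>x. indicator W x *\<^sub>R G x"]
proof
  fix i :: "real^'d" assume "i \<in> Basis"
  \<comment> \<open>Nothing is known about \<open>f\<close> outside \<open>W\<close>, and the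
    shifted argument may leave \<open>W\<close>; cutting off makes the quotients measurable, and
    they agree with those of \<open>f\<close> once the step is small.\<close>
  define F where "F x = indicator W x *\<^sub>R f x" for x
  have "continuous_on W f"
    by (intro continuous_at_imp_continuous_on ballI has_derivative_continuous[OF f[unfolded gderiv_def]])
  hence Fm: "F \<in> borel_measurable borel"
    unfolding F_def using W by (intro borel_measurable_continuous_on_indicator) auto
  define s where "s n x = indicator W x * ((F (x + (1 / real (Suc n)) *\<^sub>R i) - F x) / (1 / real (Suc n)))" for n x
  have Fc: "(\<lambda>x. F (x + c)) \<in> borel_measurable borel" for c
    by (rule measurable_compose[OF _ Fm]) simp
  have sm: "s n \<in> borel_measurable borel" for n
    unfolding s_def using W by (intro borel_measurable_times borel_measurable_divide borel_measurable_diff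
      Fm Fc borel_measurable_const borel_measurable_indicator) auto
  have lim: "(\<lambda>n. s n x) \<longlonglongrightarrow> (indicator W x *\<^sub>R G x) \<bullet> i" for x
  proof (cases "x \<in> W")
    case True
    have c: "((\<lambda>t. x + t *\<^sub>R i) has_derivative (\<lambda>t. t *\<^sub>R i)) (at (0::real))"
      by (auto intro!: derivative_eq_intros)
    have "((\<lambda>t. f (x + t *\<^sub>R i)) has_derivative (\<lambda>t. (t *\<^sub>R i) \<bullet> G x)) (at 0)"
      using diff_chain_at[OF c, of f "\<lambda>h. h \<bullet> G x"] f[OF True] by (simp add: gderiv_def o_def)
    hence "((\<lambda>t. f (x + t *\<^sub>R i)) has_real_derivative (i \<bullet> G x)) (at 0)"
      by (simp add: has_field_derivative_def mult_commute_abs)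
    hence l: "((\<lambda>t. (f (x + t *\<^sub>R i) - f x) / t) \<longlongrightarrow> i \<bullet> G x) (at 0)"
      by (simp add: DERIV_def)
    have z: "(\<lambda>n. 1 / real (Suc n)) \<longlonglongrightarrow> 0"
      using LIMSEQ_inverse_real_of_nat by (simp add: inverse_eq_divide)
    have "filterlim (\<lambda>n. 1 / real (Suc n)) (at 0) sequentially"
      unfolding filterlim_at using z by auto
    hence "(\<lambda>n. (f (x + (1 / real (Suc n)) *\<^sub>R i) - f x) / (1 / real (Suc n))) \<longlonglongrightarrow> i \<bullet> G x"
      by (rule filterlim_compose[OF l])
    moreover have "(\<lambda>n. x + (1 / real (Suc n)) *\<^sub>R i) \<longlonglongrightarrow> x + 0 *\<^sub>R i"
      by (intro tendsto_intros z)
    hence "\<forall>\<^sub>F n in sequentially. x + (1 / real (Suc n)) *\<^sub>R i \<in> W"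
      using W True topological_tendstoD by fastforce
    hence "\<forall>\<^sub>F n in sequentially. (f (x + (1 / real (Suc n)) *\<^sub>R i) - f x) / (1 / real (Suc n)) = s n x"
      by eventually_elim (use True in \<open>simp add: s_def F_def\<close>)
    ultimately have "(\<lambda>n. s n x) \<longlonglongrightarrow> i \<bullet> G x" by (rule Lim_transform_eventually)
    thus ?thesis using True by (simp add: inner_commute)
  qed (simp add: s_def)
  show "(\<lambda>x. (indicator W x *\<^sub>R G x) \<bullet> i) \<in> borel_measurable borel"
    by (rule borel_measurable_LIMSEQ_real[OF lim sm])
qed

text \<open>On an open set of full measure in the bounded cell both gradients exist and are bounded.
  The general bilinear \<open>prd\<close> covers the gradient term and the divergence term of the
  diffusion at once.\<close>

lemma gradient_product_integrable:
  fixes f f' :: "real^'d::finite \<Rightarrow> real" and prd :: "real^'d \<Rightarrow> real^'d \<Rightarrow> 'b::euclidean_space"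
  assumes f: "f \<in> local_space K" and f': "f' \<in> local_space K" and K: "bounded K"
    and h: "bounded_bilinear prd"
  shows "(\<lambda>x. prd (grad f x) (grad f' x)) absolutely_integrable_on interior K"
proof -
  obtain W1 B1 where W1: "open W1" "W1 \<subseteq> interior K" "negligible (interior K - W1)"
    "\<And>x. x \<in> W1 \<Longrightarrow> \<exists>G. GDERIV f x :> G \<and> norm G \<le> B1"
    using local_space_gradient[OF f] by blast
  obtain W2 B2 where W2: "open W2" "W2 \<subseteq> interior K" "negligible (interior K - W2)"
    "\<And>x. x \<in> W2 \<Longrightarrow> \<exists>G. GDERIV f' x :> G \<and> norm G \<le> B2"
    using local_space_gradient[OF f'] by blast
  define W where "W = W1 \<inter> W2"
  have W: "open W" using W1 W2 by (simp add: W_def open_Int)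
  have G1: "GDERIV f x :> grad f x" "norm (grad f x) \<le> B1" if "x \<in> W" for x
    using W1(4)[of x] that grad_eq by (fastforce simp: W_def)+
  have G2: "GDERIV f' x :> grad f' x" "norm (grad f' x) \<le> B2" if "x \<in> W" for x
    using W2(4)[of x] that grad_eq by (fastforce simp: W_def)+
  obtain C where C: "C > 0" "\<And>a b. norm (prd a b) \<le> norm a * norm b * C"
    using bounded_bilinear.pos_bounded[OF h] by (auto simp: mult_ac)
  have "bounded W" using K W1(2) interior_subset[of K] by (intro bounded_subset[OF K]) (auto simp: W_def)
  hence Wm: "W \<in> lmeasurable" using W lmeasurable_open by blast
  have ind: "indicator W x *\<^sub>R prd (grad f x) (grad f' x) =
     prd (indicator W x *\<^sub>R grad f x) (indicator W x *\<^sub>R grad f' x)" for x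
    using bounded_bilinear.zero_left[OF h] by (simp add: indicator_def)
  have "continuous_on UNIV (\<lambda>p. prd (fst p) (snd p))"
    by (intro bounded_bilinear.continuous_on[OF h] continuous_on_fst continuous_on_snd continuous_on_id)
  hence "(\<lambda>x. prd (indicator W x *\<^sub>R grad f x) (indicator W x *\<^sub>R grad f' x)) \<in> borel_measurable borel"
    using borel_measurable_continuous_Pair[OF gradient_measurable[OF W G1(1)] gradient_measurable[OF W G2(1)],
        of prd] by blast
  hence m: "(\<lambda>x. indicator W x *\<^sub>R prd (grad f x) (grad f' x)) \<in> borel_measurable lebesgue"
    unfolding ind by (intro measurable_completion) simp
  have "integrable lebesgue (\<lambda>x. indicator W x *\<^sub>R prd (grad f x) (grad f' x))"
  proof (rule Bochner_Integration.integrable_bound[OF _ m])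
    show "integrable lebesgue (\<lambda>x. (B1 * B2 * C) * indicator W x)"
      using Wm by (intro integrable_mult_right) (auto simp: fmeasurable_def)
    have "norm (indicator W x *\<^sub>R prd (grad f x) (grad f' x)) \<le> norm (B1 * B2 * C * indicator W x)" for x
    proof (cases "x \<in> W")
      case True
      have "norm (prd (grad f x) (grad f' x)) \<le> norm (grad f x) * norm (grad f' x) * C" by (rule C(2))
      also have "\<dots> \<le> B1 * B2 * C"
        using G1(2)[OF True] G2(2)[OF True] C(1) order_trans[OF norm_ge_zero G1(2)[OF True]]
        by (intro mult_right_mono mult_mono) auto
      also have "\<dots> \<le> \<bar>B1 * B2 * C\<bar>" by simp
      finally show ?thesis using True by simp
    qed simp
    thus "AE x in lebesgue. norm (indicator W x *\<^sub>R prd (grad f x) (grad f' x)) \<le> norm (B1 * B2 * C * indicator W x)"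
      by simp
  qed
  hence "(\<lambda>x. prd (grad f x) (grad f' x)) absolutely_integrable_on W" by (simp add: set_integrable_def)
  moreover have "negligible (interior K - W)"
    using negligible_Un[OF W1(3) W2(3)] by (rule negligible_subset) (auto simp: W_def)
  hence "negligible {x \<in> interior K - W. prd (grad f x) (grad f' x) \<noteq> 0}" by (rule negligible_subset) auto
  moreover have "{x \<in> W - interior K. prd (grad f x) (grad f' x) \<noteq> 0} = {}" using W1(2) by (auto simp: W_def)
  ultimately show ?thesis
    using absolutely_integrable_spike_set_eq[of "interior K" W "\<lambda>x. prd (grad f x) (grad f' x)"]
    by (metis negligible_empty)
qed

section \<open>Diffusion operator\<close>

lemma set_lint_spike:
  fixes f :: "'a::euclidean_space \<Rightarrow> 'b::euclidean_space"
  assumes f: "f absolutely_integrable_on S" and N: "negligible N" "\<And>x. x \<in> S - N \<Longrightarrow> g x = f x"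
  shows "(LINT x:S|lebesgue. g x) = (LINT x:S|lebesgue. f x)"
proof -
  have g: "g absolutely_integrable_on S" by (rule absolutely_integrable_spike[OF f N])
  have "integral S f = integral S g" by (rule integral_spike[OF N])
  thus ?thesis
    using set_lebesgue_integral_eq_integral(2)[OF f] set_lebesgue_integral_eq_integral(2)[OF g] by simp
qed

lemma set_lint_sum:
  fixes f :: "'i \<Rightarrow> 'a \<Rightarrow> 'b::{banach, second_countable_topology}"
  assumes "\<And>i. i \<in> I \<Longrightarrow> set_integrable M S (f i)"
  shows "(LINT x:S|M. (\<Sum>i\<in>I. f i x)) = (\<Sum>i\<in>I. LINT x:S|M. f i x)"
    and "set_integrable M S (\<lambda>x. \<Sum>i\<in>I. f i x)"
  using assms unfolding set_lebesgue_integral_def set_integrable_def scaleR_sum_right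
  by (auto intro!: Bochner_Integration.integral_sum Bochner_Integration.integrable_sum)

lemma set_lint_scaleR_left:
  fixes f :: "'a \<Rightarrow> real" and c :: "'b::{banach, second_countable_topology}"
  assumes "set_integrable M S f"
  shows "(LINT x:S|M. f x *\<^sub>R c) = (LINT x:S|M. f x) *\<^sub>R c"
  using integral_scaleR_left[of c M "\<lambda>x. indicator S x *\<^sub>R f x"] assms
  by (simp add: set_integrable_def set_lebesgue_integral_def)

text \<open>Expanding the first inner product in coordinates exhibits the sum as a sum over
  \<open>i\<close> of squared norms of the vectors with weights \<open>a t $ i\<close>. With shape
  gradients and face velocities it is the squared norm of the gradient of the reconstructed
  velocity.\<close>

lemma gram_products_nonneg:
  fixes a :: "'i \<Rightarrow> real^'d::finite" and b :: "'i \<Rightarrow> 'b::real_inner"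
  shows "0 \<le> (\<Sum>s\<in>I. \<Sum>t\<in>I. (a t \<bullet> a s) * (b t \<bullet> b s))"
proof -
  have "(\<Sum>s\<in>I. \<Sum>t\<in>I. (a t \<bullet> a s) * (b t \<bullet> b s)) =
    (\<Sum>s\<in>I. \<Sum>t\<in>I. \<Sum>i\<in>UNIV. (a t $ i * a s $ i) * (b t \<bullet> b s))"
    by (simp add: inner_vec_def sum_distrib_right)
  also have "\<dots> = (\<Sum>s\<in>I. \<Sum>i\<in>UNIV. \<Sum>t\<in>I. (a t $ i * a s $ i) * (b t \<bullet> b s))"
    by (intro sum.cong refl sum.swap)
  also have "\<dots> = (\<Sum>i\<in>UNIV. \<Sum>s\<in>I. \<Sum>t\<in>I. (a t $ i * a s $ i) * (b t \<bullet> b s))"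
    by (rule sum.swap)
  also have "\<dots> = (\<Sum>i\<in>UNIV. (\<Sum>t\<in>I. a t $ i *\<^sub>R b t) \<bullet> (\<Sum>s\<in>I. a s $ i *\<^sub>R b s))"
    by (simp add: inner_sum_left inner_sum_right sum_distrib_left mult_ac)
  also have "\<dots> \<ge> 0" by (intro sum_nonneg) simp
  finally show ?thesis .
qed

context staggered begin

lemma shape_local: "\<sigma> \<in> faces D \<Longrightarrow> K \<in> cells D \<Longrightarrow> shape D \<sigma> K \<in> local_space K"
  using staggered by (simp add: staggered_discretization_def shape_functions_def)

text \<open>One exceptional set for all faces, so that the jacobian of \<open>hat\<close> can be
  expanded there.\<close>

lemma ae_shape_gradients:
  assumes K: "K \<in> cells D"
  shows "\<exists>N. negligible N \<and>
    (\<forall>x\<in>interior K - N. \<forall>\<sigma>\<in>faces D. GDERIV (shape D \<sigma> K) x :> grad (shape D \<sigma> K) x)"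
proof -
  have "\<exists>W. negligible (interior K - W) \<and> (\<forall>x\<in>W. GDERIV (shape D \<sigma> K) x :> grad (shape D \<sigma> K) x)"
    if \<sigma>: "\<sigma> \<in> faces D" for \<sigma>
  proof -
    obtain W B where W: "negligible (interior K - W)"
      "\<forall>x\<in>W. \<exists>G. GDERIV (shape D \<sigma> K) x :> G \<and> norm G \<le> (B::real)"
      using local_space_gradient[OF shape_local[OF \<sigma> K]] by (elim exE conjE) (rule that)
    have "GDERIV (shape D \<sigma> K) x :> grad (shape D \<sigma> K) x" if x: "x \<in> W" for x
    proof -
      obtain G where G: "GDERIV (shape D \<sigma> K) x :> G" using bspec[OF W(2) x] by (elim exE conjE)
      thus ?thesis using grad_eq[OF G] by simp
    qed
    thus ?thesis using W(1) by blast
  qed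
  then obtain W where W: "\<And>\<sigma>. \<sigma> \<in> faces D \<Longrightarrow> negligible (interior K - W \<sigma>)"
    "\<And>\<sigma> x. \<sigma> \<in> faces D \<Longrightarrow> x \<in> W \<sigma> \<Longrightarrow> GDERIV (shape D \<sigma> K) x :> grad (shape D \<sigma> K) x" by metis
  show ?thesis
  proof (intro exI conjI ballI)
    show "negligible (\<Union>\<sigma>\<in>faces D. interior K - W \<sigma>)"
    proof (rule negligible_Union)
      show "finite ((\<lambda>\<sigma>. interior K - W \<sigma>) ` faces D)" using finite_faces by (rule finite_imageI)
    qed (use W(1) in blast)
    fix x \<sigma> assume "x \<in> interior K - (\<Union>\<sigma>\<in>faces D. interior K - W \<sigma>)" and \<sigma>: "\<sigma> \<in> faces D"
    hence "x \<in> W \<sigma>" by blast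
    thus "GDERIV (shape D \<sigma> K) x :> grad (shape D \<sigma> K) x" by (rule W(2)[OF \<sigma>])
  qed
qed

lemma hat_jacobian:
  assumes g: "\<And>\<sigma>. \<sigma> \<in> faces D \<Longrightarrow> GDERIV (shape D \<sigma> K) x :> g \<sigma>"
  shows "jacobian (hat D u K) (at x) *v w = (\<Sum>\<sigma>\<in>faces D. (g \<sigma> \<bullet> w) *\<^sub>R u \<sigma>)"
    and "trace (jacobian (hat D u K) (at x)) = (\<Sum>\<sigma>\<in>faces D. g \<sigma> \<bullet> u \<sigma>)"
proof -
  let ?h = "\<lambda>h. \<Sum>\<sigma>\<in>faces D. (h \<bullet> g \<sigma>) *\<^sub>R u \<sigma>"
  have d: "(hat D u K has_derivative ?h) (at x)"
    unfolding hat_def[abs_def]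
    by (intro has_derivative_sum has_derivative_scaleR_left g[unfolded gderiv_def])
  have j: "jacobian (hat D u K) (at x) = matrix ?h"
    unfolding jacobian_def using frechet_derivative_at[OF d] by simp
  show "jacobian (hat D u K) (at x) *v w = (\<Sum>\<sigma>\<in>faces D. (g \<sigma> \<bullet> w) *\<^sub>R u \<sigma>)"
    unfolding j using matrix_works[of ?h w] has_derivative_linear[OF d]
    by (simp add: inner_commute linear_matrix_vector_mul_eq)
  have "trace (matrix ?h) = (\<Sum>i\<in>UNIV. \<Sum>\<sigma>\<in>faces D. g \<sigma> $ i * u \<sigma> $ i)"
    by (simp add: trace_def matrix_def inner_axis')
  also have "\<dots> = (\<Sum>\<sigma>\<in>faces D. g \<sigma> \<bullet> u \<sigma>)"
    by (subst sum.swap) (simp add: inner_vec_def)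
  finally show "trace (jacobian (hat D u K) (at x)) = (\<Sum>\<sigma>\<in>faces D. g \<sigma> \<bullet> u \<sigma>)" unfolding j .
qed

text \<open>The local stiffness matrix of the scalar Laplacian for the nonconforming
  element.\<close>

definition stiffness where
  "stiffness K \<sigma> \<sigma>' = (LINT x:interior K|lebesgue. grad (shape D \<sigma>' K) x \<bullet> grad (shape D \<sigma> K) x)"

text \<open>The part of the divergence term due to the value \<open>w\<close> at the face \<sigma>'.
  It is kept as a map of \<open>w\<close> because it mixes components.\<close>

definition div_coupling where
  "div_coupling K \<sigma> \<sigma>' w =
     (LINT x:interior K|lebesgue. (grad (shape D \<sigma>' K) x \<bullet> w) *\<^sub>R grad (shape D \<sigma> K) x)"

lemma shape_product_integrable:
  fixes prd :: "real^'d \<Rightarrow> real^'d \<Rightarrow> 'b::euclidean_space"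
  assumes "K \<in> cells D" "\<sigma> \<in> faces D" "\<sigma>' \<in> faces D" "bounded_bilinear prd"
  shows "(\<lambda>x. prd (grad (shape D \<sigma> K) x) (grad (shape D \<sigma>' K) x)) absolutely_integrable_on interior K"
  using assms
  by (intro gradient_product_integrable shape_local compact_imp_bounded cell_compact)

lemma stiffness_integrable:
  assumes "K \<in> cells D" "\<sigma> \<in> faces D" "\<sigma>' \<in> faces D"
  shows "(\<lambda>x. grad (shape D \<sigma> K) x \<bullet> grad (shape D \<sigma>' K) x) absolutely_integrable_on interior K"
  by (rule shape_product_integrable[OF assms bounded_bilinear_inner])

lemma div_coupling_integrable:
  assumes "K \<in> cells D" "\<sigma> \<in> faces D" "\<sigma>' \<in> faces D"
  shows "(\<lambda>x. (grad (shape D \<sigma> K) x \<bullet> w) *\<^sub>R grad (shape D \<sigma>' K) x) absolutely_integrable_on interior K"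
  by (rule shape_product_integrable[OF assms])
     (rule bounded_bilinear.comp1[OF bounded_bilinear_scaleR bounded_linear_inner_left])

lemma linear_div_coupling:
  assumes "K \<in> cells D" "\<sigma> \<in> faces D" "\<sigma>' \<in> faces D"
  shows "linear (div_coupling K \<sigma> \<sigma>')"
proof (rule linearI)
  note i = div_coupling_integrable[OF assms(1,3,2)]
  show "div_coupling K \<sigma> \<sigma>' (v + w) = div_coupling K \<sigma> \<sigma>' v + div_coupling K \<sigma> \<sigma>' w" for v w
    unfolding div_coupling_def using set_integral_add(2)[OF i i, of v w]
    by (simp add: inner_add_right scaleR_add_left)
  show "div_coupling K \<sigma> \<sigma>' (r *\<^sub>R w) = r *\<^sub>R div_coupling K \<sigma> \<sigma>' w" for r w
    unfolding div_coupling_def by (simp flip: set_integral_scaleR_right)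
qed

text \<open>The integrals become constants of the mesh and the operator an explicit finite sum over
  face values; its continuity, boundedness and dissipation are all read off from this form.\<close>

lemma div_tau_eq:
  assumes \<sigma>: "\<sigma> \<in> faces D"
  shows "div_tau D \<mu> lam u \<sigma> =
    - (\<mu> / vol (diamond D \<sigma>)) *\<^sub>R (\<Sum>K\<in>cells D. \<Sum>\<sigma>'\<in>faces D. stiffness K \<sigma> \<sigma>' *\<^sub>R u \<sigma>')
    - ((\<mu> + lam) / vol (diamond D \<sigma>)) *\<^sub>R
        (\<Sum>K\<in>cells D. \<Sum>\<sigma>'\<in>faces D. div_coupling K \<sigma> \<sigma>' (u \<sigma>'))"
proof -
  have *: "(LINT x:interior K|lebesgue. jacobian (hat D u K) (at x) *v grad (shape D \<sigma> K) x) =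
      (\<Sum>\<sigma>'\<in>faces D. stiffness K \<sigma> \<sigma>' *\<^sub>R u \<sigma>')"
    "(LINT x:interior K|lebesgue. trace (jacobian (hat D u K) (at x)) *\<^sub>R grad (shape D \<sigma> K) x) =
      (\<Sum>\<sigma>'\<in>faces D. div_coupling K \<sigma> \<sigma>' (u \<sigma>'))" if K: "K \<in> cells D" for K
  proof -
    let ?g = "\<lambda>\<sigma> x. grad (shape D \<sigma> K) x"
    obtain N where N: "negligible N"
      "\<And>x \<sigma>. x \<in> interior K - N \<Longrightarrow> \<sigma> \<in> faces D \<Longrightarrow> GDERIV (shape D \<sigma> K) x :> ?g \<sigma> x"
      using ae_shape_gradients[OF K] by blast
    have i1: "(\<lambda>x. (?g \<sigma>' x \<bullet> ?g \<sigma> x) *\<^sub>R u \<sigma>') absolutely_integrable_on interior K"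
      if "\<sigma>' \<in> faces D" for \<sigma>'
      by (intro set_integrable_scaleR_left stiffness_integrable K \<sigma> that)
    have i2: "(\<lambda>x. (?g \<sigma>' x \<bullet> u \<sigma>') *\<^sub>R ?g \<sigma> x) absolutely_integrable_on interior K"
      if "\<sigma>' \<in> faces D" for \<sigma>' by (intro div_coupling_integrable K \<sigma> that)
    have "(LINT x:interior K|lebesgue. jacobian (hat D u K) (at x) *v ?g \<sigma> x) =
      (LINT x:interior K|lebesgue. (\<Sum>\<sigma>'\<in>faces D. (?g \<sigma>' x \<bullet> ?g \<sigma> x) *\<^sub>R u \<sigma>'))"
    proof (rule set_lint_spike[OF _ N(1)])
      show "(\<lambda>x. \<Sum>\<sigma>'\<in>faces D. (?g \<sigma>' x \<bullet> ?g \<sigma> x) *\<^sub>R u \<sigma>') absolutely_integrable_on interior K"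
        by (intro set_lint_sum(2) i1)
      fix x assume x: "x \<in> interior K - N"
      show "jacobian (hat D u K) (at x) *v ?g \<sigma> x = (\<Sum>\<sigma>'\<in>faces D. (?g \<sigma>' x \<bullet> ?g \<sigma> x) *\<^sub>R u \<sigma>')"
        by (rule hat_jacobian(1)) (rule N(2)[OF x])
    qed
    also have "\<dots> = (\<Sum>\<sigma>'\<in>faces D. (LINT x:interior K|lebesgue. (?g \<sigma>' x \<bullet> ?g \<sigma> x) *\<^sub>R u \<sigma>'))"
      by (intro set_lint_sum(1) i1)
    also have "\<dots> = (\<Sum>\<sigma>'\<in>faces D. stiffness K \<sigma> \<sigma>' *\<^sub>R u \<sigma>')"
      unfolding stiffness_def
      by (intro sum.cong refl set_lint_scaleR_left stiffness_integrable K \<sigma>)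
    finally show "(LINT x:interior K|lebesgue. jacobian (hat D u K) (at x) *v ?g \<sigma> x) =
      (\<Sum>\<sigma>'\<in>faces D. stiffness K \<sigma> \<sigma>' *\<^sub>R u \<sigma>')" .
    have "(LINT x:interior K|lebesgue. trace (jacobian (hat D u K) (at x)) *\<^sub>R ?g \<sigma> x) =
      (LINT x:interior K|lebesgue. (\<Sum>\<sigma>'\<in>faces D. (?g \<sigma>' x \<bullet> u \<sigma>') *\<^sub>R ?g \<sigma> x))"
    proof (rule set_lint_spike[OF _ N(1)])
      show "(\<lambda>x. \<Sum>\<sigma>'\<in>faces D. (?g \<sigma>' x \<bullet> u \<sigma>') *\<^sub>R ?g \<sigma> x) absolutely_integrable_on interior K"
        by (intro set_lint_sum(2) i2)
      fix x assume x: "x \<in> interior K - N"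
      show "trace (jacobian (hat D u K) (at x)) *\<^sub>R ?g \<sigma> x = (\<Sum>\<sigma>'\<in>faces D. (?g \<sigma>' x \<bullet> u \<sigma>') *\<^sub>R ?g \<sigma> x)"
        by (subst hat_jacobian(2)[OF N(2)[OF x]]) (auto intro: scaleR_sum_left)
    qed
    also have "\<dots> = (\<Sum>\<sigma>'\<in>faces D. div_coupling K \<sigma> \<sigma>' (u \<sigma>'))"
      unfolding div_coupling_def by (intro set_lint_sum(1) i2)
    finally show "(LINT x:interior K|lebesgue. trace (jacobian (hat D u K) (at x)) *\<^sub>R ?g \<sigma> x) =
      (\<Sum>\<sigma>'\<in>faces D. div_coupling K \<sigma> \<sigma>' (u \<sigma>'))" .
  qed
  show ?thesis unfolding div_tau_def by (simp only: * cong: sum.cong)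
qed

lemma div_tau_linear:
  assumes \<sigma>: "\<sigma> \<in> faces D"
  shows "\<exists>L. (\<forall>\<sigma>'\<in>faces D. bounded_linear (L \<sigma>')) \<and>
     (\<forall>u. div_tau D \<mu> lam u \<sigma> = (\<Sum>\<sigma>'\<in>faces D. L \<sigma>' (u \<sigma>')))"
proof (intro exI conjI ballI allI)
  let ?L = "\<lambda>\<sigma>' w. - (\<mu> / vol (diamond D \<sigma>)) *\<^sub>R (\<Sum>K\<in>cells D. stiffness K \<sigma> \<sigma>' *\<^sub>R w)
    - ((\<mu> + lam) / vol (diamond D \<sigma>)) *\<^sub>R (\<Sum>K\<in>cells D. div_coupling K \<sigma> \<sigma>' w)"
  show "bounded_linear (?L \<sigma>')" if "\<sigma>' \<in> faces D" for \<sigma>'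
    using linear_div_coupling[OF _ \<sigma> that]
    by (intro bounded_linear_sub bounded_linear_const_scaleR bounded_linear_sum
        bounded_linear_scaleR_right bounded_linear_ident)
       (auto simp: linear_conv_bounded_linear)
  show "div_tau D \<mu> lam u \<sigma> = (\<Sum>\<sigma>'\<in>faces D. ?L \<sigma>' (u \<sigma>'))" for u
    unfolding div_tau_eq[OF \<sigma>] sum_subtractf
    by (subst (1 2) sum.swap) (simp add: scaleR_sum_right)
qed

lemma div_tau_tendsto:
  assumes \<sigma>: "\<sigma> \<in> faces D" and u: "\<And>\<sigma>. ((\<lambda>k. U k \<sigma>) \<longlongrightarrow> u \<sigma>) F"
  shows "((\<lambda>k. div_tau D \<mu> lam (U k) \<sigma>) \<longlongrightarrow> div_tau D \<mu> lam u \<sigma>) F"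
proof -
  obtain L where L: "\<forall>\<sigma>'\<in>faces D. bounded_linear (L \<sigma>')"
    "\<forall>u. div_tau D \<mu> lam u \<sigma> = (\<Sum>\<sigma>'\<in>faces D. L \<sigma>' (u \<sigma>'))"
    using div_tau_linear[OF \<sigma>] by blast
  show ?thesis
    unfolding L(2)[rule_format] using L(1) by (intro tendsto_sum bounded_linear.tendsto[OF _ u]) blast
qed

lemma div_tau_bounded:
  assumes \<sigma>: "\<sigma> \<in> faces D"
  shows "\<exists>C. \<forall>u. (\<forall>\<sigma>. norm (u \<sigma>) \<le> B) \<longrightarrow> norm (div_tau D \<mu> lam u \<sigma>) \<le> C"
proof -
  obtain L where L: "\<forall>\<sigma>'\<in>faces D. bounded_linear (L \<sigma>')"
    "\<forall>u. div_tau D \<mu> lam u \<sigma> = (\<Sum>\<sigma>'\<in>faces D. L \<sigma>' (u \<sigma>'))"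
    using div_tau_linear[OF \<sigma>] by blast
  have "norm (div_tau D \<mu> lam u \<sigma>) \<le> (\<Sum>\<sigma>'\<in>faces D. onorm (L \<sigma>') * B)" if u: "\<forall>\<sigma>. norm (u \<sigma>) \<le> B" for u
  proof -
    have "norm (div_tau D \<mu> lam u \<sigma>) \<le> (\<Sum>\<sigma>'\<in>faces D. norm (L \<sigma>' (u \<sigma>')))"
      unfolding L(2)[rule_format] by (rule norm_sum)
    also have "\<dots> \<le> (\<Sum>\<sigma>'\<in>faces D. onorm (L \<sigma>') * B)"
    proof (rule sum_mono)
      fix \<sigma>' assume "\<sigma>' \<in> faces D"
      hence bl: "bounded_linear (L \<sigma>')" using L(1) by blast
      have "norm (L \<sigma>' (u \<sigma>')) \<le> onorm (L \<sigma>') * norm (u \<sigma>')" by (rule onorm[OF bl])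
      also have "\<dots> \<le> onorm (L \<sigma>') * B" using u onorm_pos_le[OF bl] by (intro mult_left_mono) auto
      finally show "norm (L \<sigma>' (u \<sigma>')) \<le> onorm (L \<sigma>') * B" .
    qed
    finally show ?thesis .
  qed
  thus ?thesis by blast
qed

text \<open>The sum equals minus \<mu> times the integral of the squared gradient of the
  reconstruction, minus \<open>\<mu> + lam\<close> times that of its squared divergence, cell by
  cell.\<close>

lemma diffusion_dissipates:
  assumes u: "u \<in> H0 D" and \<mu>: "\<mu> \<ge> 0" "\<mu> + lam \<ge> 0"
  shows "(\<Sum>\<sigma>\<in>int_faces D. vol (diamond D \<sigma>) * (div_tau D \<mu> lam u \<sigma> \<bullet> u \<sigma>)) \<le> 0"
proof -
  let ?a = "\<lambda>K \<sigma>. \<Sum>\<sigma>'\<in>faces D. stiffness K \<sigma> \<sigma>' * (u \<sigma>' \<bullet> u \<sigma>)"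
  let ?b = "\<lambda>K \<sigma>. \<Sum>\<sigma>'\<in>faces D. div_coupling K \<sigma> \<sigma>' (u \<sigma>') \<bullet> u \<sigma>"
  have "(\<Sum>\<sigma>\<in>int_faces D. vol (diamond D \<sigma>) * (div_tau D \<mu> lam u \<sigma> \<bullet> u \<sigma>)) =
    (\<Sum>\<sigma>\<in>faces D. vol (diamond D \<sigma>) * (div_tau D \<mu> lam u \<sigma> \<bullet> u \<sigma>))"
  proof (rule sum.mono_neutral_left[OF finite_faces int_faces_subset], rule ballI)
    fix \<sigma> assume "\<sigma> \<in> faces D - int_faces D"
    hence "u \<sigma> = 0" using u by (simp add: H0_def)
    thus "vol (diamond D \<sigma>) * (div_tau D \<mu> lam u \<sigma> \<bullet> u \<sigma>) = 0" by simp
  qed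
  also have "\<dots> = (\<Sum>\<sigma>\<in>faces D. - \<mu> * (\<Sum>K\<in>cells D. ?a K \<sigma>) - (\<mu> + lam) * (\<Sum>K\<in>cells D. ?b K \<sigma>))"
  proof (rule sum.cong[OF refl])
    fix \<sigma> assume \<sigma>: "\<sigma> \<in> faces D"
    let ?V = "vol (diamond D \<sigma>)"
    have "?V \<noteq> 0" using vol_diamond_pos[OF \<sigma>] by simp
    hence *: "?V * (- (\<mu> / ?V) * s - ((\<mu> + lam) / ?V) * t) = - \<mu> * s - (\<mu> + lam) * t" for s t
      by (simp add: right_diff_distrib)
    show "vol (diamond D \<sigma>) * (div_tau D \<mu> lam u \<sigma> \<bullet> u \<sigma>) =
       - \<mu> * (\<Sum>K\<in>cells D. ?a K \<sigma>) - (\<mu> + lam) * (\<Sum>K\<in>cells D. ?b K \<sigma>)"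
      unfolding div_tau_eq[OF \<sigma>] inner_diff_left inner_scaleR_left inner_sum_left
      by (rule *)
  qed
  also have "\<dots> = - \<mu> * (\<Sum>K\<in>cells D. \<Sum>\<sigma>\<in>faces D. ?a K \<sigma>) - (\<mu> + lam) * (\<Sum>K\<in>cells D. \<Sum>\<sigma>\<in>faces D. ?b K \<sigma>)"
    unfolding sum_subtractf sum_distrib_left[symmetric] by (simp only: sum.swap[of _ "cells D" "faces D"])
  also have "\<dots> \<le> 0"
  proof -
    have a: "0 \<le> (\<Sum>\<sigma>\<in>faces D. ?a K \<sigma>)" if K: "K \<in> cells D" for K
    proof -
      let ?g = "\<lambda>\<sigma> x. grad (shape D \<sigma> K) x"
      have i: "(\<lambda>x. (?g \<sigma>' x \<bullet> ?g \<sigma> x) * (u \<sigma>' \<bullet> u \<sigma>)) absolutely_integrable_on interior K"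
        if "\<sigma>' \<in> faces D" "\<sigma> \<in> faces D" for \<sigma>' \<sigma>
        by (intro set_integrable_mult_left stiffness_integrable K that)
      have "(\<Sum>\<sigma>\<in>faces D. ?a K \<sigma>) =
        (\<Sum>\<sigma>\<in>faces D. \<Sum>\<sigma>'\<in>faces D. LINT x:interior K|lebesgue. (?g \<sigma>' x \<bullet> ?g \<sigma> x) * (u \<sigma>' \<bullet> u \<sigma>))"
        by (simp add: stiffness_def)
      also have "\<dots> = (\<Sum>\<sigma>\<in>faces D. LINT x:interior K|lebesgue. (\<Sum>\<sigma>'\<in>faces D. (?g \<sigma>' x \<bullet> ?g \<sigma> x) * (u \<sigma>' \<bullet> u \<sigma>)))"
        by (intro sum.cong refl set_lint_sum(1)[symmetric] i)
      also have "\<dots> = (LINT x:interior K|lebesgue. (\<Sum>\<sigma>\<in>faces D. \<Sum>\<sigma>'\<in>faces D. (?g \<sigma>' x \<bullet> ?g \<sigma> x) * (u \<sigma>' \<bullet> u \<sigma>)))"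
        by (intro set_lint_sum(1)[symmetric] set_lint_sum(2) i)
      also have "\<dots> \<ge> 0"
        unfolding set_lebesgue_integral_def
        by (intro integral_nonneg_AE AE_I2 scaleR_nonneg_nonneg gram_products_nonneg) simp
      finally show ?thesis .
    qed
    have b: "0 \<le> (\<Sum>\<sigma>\<in>faces D. ?b K \<sigma>)" if K: "K \<in> cells D" for K
    proof -
      let ?g = "\<lambda>\<sigma> x. grad (shape D \<sigma> K) x"
      have i: "(\<lambda>x. ((?g \<sigma>' x \<bullet> u \<sigma>') *\<^sub>R ?g \<sigma> x) \<bullet> u \<sigma>) absolutely_integrable_on interior K"
        if "\<sigma>' \<in> faces D" "\<sigma> \<in> faces D" for \<sigma>' \<sigma>
      proof -
        have "integrable lebesgue (\<lambda>x. (indicator (interior K) x *\<^sub>R ((?g \<sigma>' x \<bullet> u \<sigma>') *\<^sub>R ?g \<sigma> x)) \<bullet> u \<sigma>)"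
          using div_coupling_integrable[OF K that, of "u \<sigma>'"]
          by (intro integrable_inner_left) (simp only: set_integrable_def)
        thus ?thesis by (simp only: set_integrable_def inner_scaleR_left real_scaleR_def)
      qed
      have e: "div_coupling K \<sigma> \<sigma>' (u \<sigma>') \<bullet> u \<sigma> = (LINT x:interior K|lebesgue. ((?g \<sigma>' x \<bullet> u \<sigma>') *\<^sub>R ?g \<sigma> x) \<bullet> u \<sigma>)"
        if "\<sigma>' \<in> faces D" "\<sigma> \<in> faces D" for \<sigma>' \<sigma>
        unfolding div_coupling_def set_lebesgue_integral_def
        by (subst integral_inner_left[symmetric])
           (use div_coupling_integrable[OF K that] in \<open>auto simp: set_integrable_def mult.assoc\<close>)
      have "(\<Sum>\<sigma>\<in>faces D. ?b K \<sigma>) =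
        (\<Sum>\<sigma>\<in>faces D. \<Sum>\<sigma>'\<in>faces D. LINT x:interior K|lebesgue. ((?g \<sigma>' x \<bullet> u \<sigma>') *\<^sub>R ?g \<sigma> x) \<bullet> u \<sigma>)"
        by (intro sum.cong refl e)
      also have "\<dots> = (\<Sum>\<sigma>\<in>faces D. LINT x:interior K|lebesgue. (\<Sum>\<sigma>'\<in>faces D. ((?g \<sigma>' x \<bullet> u \<sigma>') *\<^sub>R ?g \<sigma> x) \<bullet> u \<sigma>))"
        by (intro sum.cong refl set_lint_sum(1)[symmetric] i)
      also have "\<dots> = (LINT x:interior K|lebesgue. (\<Sum>\<sigma>\<in>faces D. \<Sum>\<sigma>'\<in>faces D. ((?g \<sigma>' x \<bullet> u \<sigma>') *\<^sub>R ?g \<sigma> x) \<bullet> u \<sigma>))"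
        by (intro set_lint_sum(1)[symmetric] set_lint_sum(2) i)
      also have "\<dots> = (LINT x:interior K|lebesgue. (\<Sum>\<sigma>\<in>faces D. ?g \<sigma> x \<bullet> u \<sigma>)\<^sup>2)"
        by (simp add: power2_eq_square sum_product mult.commute)
      also have "\<dots> \<ge> 0"
        unfolding set_lebesgue_integral_def by (intro integral_nonneg_AE AE_I2) simp
      finally show ?thesis .
    qed
    have "0 \<le> \<mu> * (\<Sum>K\<in>cells D. \<Sum>\<sigma>\<in>faces D. ?a K \<sigma>)"
      by (rule mult_nonneg_nonneg[OF \<mu>(1) sum_nonneg[OF a]])
    moreover have "0 \<le> (\<mu> + lam) * (\<Sum>K\<in>cells D. \<Sum>\<sigma>\<in>faces D. ?b K \<sigma>)"
      by (rule mult_nonneg_nonneg[OF \<mu>(2) sum_nonneg[OF b]])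
    ultimately have "- \<mu> * (\<Sum>K\<in>cells D. \<Sum>\<sigma>\<in>faces D. ?a K \<sigma>) -
      (\<mu> + lam) * (\<Sum>K\<in>cells D. \<Sum>\<sigma>\<in>faces D. ?b K \<sigma>) \<le> 0" by simp
    thus ?thesis .
  qed
  finally show ?thesis .
qed

end

section \<open>Relative elastic potential\<close>

text \<open>The relative elastic potential is normalised so that it and its derivative vanish at density 1,
  and satisfies \<open>r \<Pi>'(r) - \<Pi>(r) = r\<^sup>\<gamma> - 1\<close>; for \<open>\<gamma> = 1\<close> it is \<open>r ln r - r + 1\<close>.\<close>

definition potential_deriv :: "real \<Rightarrow> real \<Rightarrow> real" where
  "potential_deriv \<gamma> r = (if \<gamma> = 1 then ln r else \<gamma> / (\<gamma> - 1) * (r powr (\<gamma> - 1) - 1))"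

definition potential :: "real \<Rightarrow> real \<Rightarrow> real" where
  "potential \<gamma> r = r * potential_deriv \<gamma> r - (r powr \<gamma> - 1)"

lemma potential_one: "potential \<gamma> 1 = 0" "potential_deriv \<gamma> 1 = 0"
  by (simp_all add: potential_def potential_deriv_def)

lemma potential_deriv_DERIV:
  assumes "r > 0" shows "(potential_deriv \<gamma> has_real_derivative \<gamma> * r powr (\<gamma> - 2)) (at r)"
proof (cases "\<gamma> = 1")
  case True
  have "(ln has_real_derivative 1 / r) (at r)" by (rule DERIV_ln_divide[OF assms])
  moreover have "r powr (- 1) = 1 / r" using assms by (simp add: powr_minus inverse_eq_divide)
  moreover have "potential_deriv \<gamma> = ln" using True by (auto simp: potential_deriv_def)
  ultimately show ?thesis using True by simp
next
  case False
  have e: "potential_deriv \<gamma> = (\<lambda>r. \<gamma> / (\<gamma> - 1) * (r powr (\<gamma> - 1) - 1))"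
    using False by (auto simp: potential_deriv_def)
  have "((\<lambda>r. \<gamma> / (\<gamma> - 1) * (r powr (\<gamma> - 1) - 1)) has_real_derivative
      \<gamma> / (\<gamma> - 1) * ((\<gamma> - 1) * r powr (\<gamma> - 1 - 1) - 0)) (at r)"
    by (intro DERIV_cmult DERIV_diff has_real_derivative_powr DERIV_const assms)
  thus ?thesis unfolding e using False by simp
qed

lemma potential_DERIV:
  assumes "r > 0" shows "(potential \<gamma> has_real_derivative potential_deriv \<gamma> r) (at r)"
proof -
  have "(potential \<gamma> has_real_derivative
     (1 * potential_deriv \<gamma> r + (\<gamma> * r powr (\<gamma> - 2)) * r) - (\<gamma> * r powr (\<gamma> - 1) - 0)) (at r)"
    unfolding potential_def[abs_def]
    by (intro DERIV_diff DERIV_mult DERIV_ident potential_deriv_DERIV has_real_derivative_powr DERIV_const assms)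
  moreover have "r powr (\<gamma> - 2) * r = r powr (\<gamma> - 1)"
    using powr_mult_base[of r "\<gamma> - 2"] assms by (simp add: mult.commute)
  ultimately show ?thesis by (simp add: mult.assoc)
qed

text \<open>Convexity, as the second derivative is nonnegative. This is the only form in which
  convexity enters the energy estimates.\<close>

lemma potential_above_tangent:
  assumes "\<gamma> \<ge> 1" "a > 0" "b > 0"
  shows "potential \<gamma> a \<ge> potential \<gamma> b + potential_deriv \<gamma> b * (a - b)"
proof -
  have "convex_on {0<..} (potential \<gamma>)"
  proof (rule f''_ge0_imp_convex)
    show "convex {0::real<..}" by simp
    fix x :: real assume "x \<in> {0<..}"
    hence x: "x > 0" by simp
    show "DERIV (potential \<gamma>) x :> potential_deriv \<gamma> x" by (rule potential_DERIV[OF x])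
    show "DERIV (potential_deriv \<gamma>) x :> \<gamma> * x powr (\<gamma> - 2)" by (rule potential_deriv_DERIV[OF x])
    show "0 \<le> \<gamma> * x powr (\<gamma> - 2)" using assms by simp
  qed
  moreover have "(potential \<gamma> has_real_derivative potential_deriv \<gamma> b) (at b within {0<..})"
    using potential_DERIV[OF assms(3)] has_field_derivative_at_within by blast
  ultimately have "potential \<gamma> a - potential \<gamma> b \<ge> potential_deriv \<gamma> b * (a - b)"
    using assms by (intro convex_on_imp_above_tangent[of "{0<..}"]) (auto simp: interior_open)
  thus ?thesis by simp
qed

text \<open>The mean value theorem between 1 and \<open>r\<close>; the intermediate point stays in
  [1/2, 2], where the logarithm is at most \<open>ln 2\<close> in absolute value.\<close>

lemma potential_deriv_bounds:
  assumes "\<gamma> \<ge> 1" "1/2 \<le> r" "r \<le> 2"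
  shows "\<gamma> * 2 powr (- \<bar>\<gamma> - 2\<bar>) * (r - 1)\<^sup>2 \<le> potential_deriv \<gamma> r * (r - 1)"
    and "potential_deriv \<gamma> r * (r - 1) \<le> \<gamma> * 2 powr \<bar>\<gamma> - 2\<bar> * (r - 1)\<^sup>2"
proof -
  have "\<exists>x. 1/2 \<le> x \<and> x \<le> 2 \<and> potential_deriv \<gamma> r = (r - 1) * (\<gamma> * x powr (\<gamma> - 2))"
  proof (cases r "1::real" rule: linorder_cases)
    case less
    have "\<exists>z. r < z \<and> z < 1 \<and>
      potential_deriv \<gamma> 1 - potential_deriv \<gamma> r = (1 - r) * (\<gamma> * z powr (\<gamma> - 2))"
      by (rule MVT2[OF less]) (use assms in \<open>auto intro!: potential_deriv_DERIV\<close>)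
    then obtain z where "z > r" "z < 1"
      "potential_deriv \<gamma> 1 - potential_deriv \<gamma> r = (1 - r) * (\<gamma> * z powr (\<gamma> - 2))" by blast
    thus ?thesis using assms by (intro exI[of _ z]) (auto simp: potential_one algebra_simps)
  next
    case greater
    have "\<exists>z. 1 < z \<and> z < r \<and>
      potential_deriv \<gamma> r - potential_deriv \<gamma> 1 = (r - 1) * (\<gamma> * z powr (\<gamma> - 2))"
      by (rule MVT2[OF greater]) (auto intro!: potential_deriv_DERIV)
    then obtain z where "z > 1" "z < r"
      "potential_deriv \<gamma> r - potential_deriv \<gamma> 1 = (r - 1) * (\<gamma> * z powr (\<gamma> - 2))" by blast
    thus ?thesis using assms by (intro exI[of _ z]) (auto simp: potential_one)
  qed (auto simp: potential_one intro: exI[of _ 1])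
  then obtain x where x: "1/2 \<le> x" "x \<le> 2" "potential_deriv \<gamma> r = (r - 1) * (\<gamma> * x powr (\<gamma> - 2))" by blast
  have eq: "potential_deriv \<gamma> r * (r - 1) = \<gamma> * x powr (\<gamma> - 2) * (r - 1)\<^sup>2"
    by (simp add: x(3) power2_eq_square)
  have "ln (1/2) \<le> ln x" "ln x \<le> ln 2" using x by (auto intro!: ln_mono)
  hence "\<bar>ln x\<bar> \<le> ln 2" by (simp add: ln_div abs_le_iff)
  hence "\<bar>(\<gamma> - 2) * ln x\<bar> \<le> \<bar>\<gamma> - 2\<bar> * ln 2" by (simp add: abs_mult mult_left_mono)
  hence "- \<bar>\<gamma> - 2\<bar> * ln 2 \<le> (\<gamma> - 2) * ln x" "(\<gamma> - 2) * ln x \<le> \<bar>\<gamma> - 2\<bar> * ln 2" by linarith+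
  hence "2 powr (- \<bar>\<gamma> - 2\<bar>) \<le> x powr (\<gamma> - 2)" "x powr (\<gamma> - 2) \<le> 2 powr \<bar>\<gamma> - 2\<bar>"
    using x by (auto simp: powr_def)
  thus "\<gamma> * 2 powr (- \<bar>\<gamma> - 2\<bar>) * (r - 1)\<^sup>2 \<le> potential_deriv \<gamma> r * (r - 1)"
    "potential_deriv \<gamma> r * (r - 1) \<le> \<gamma> * 2 powr \<bar>\<gamma> - 2\<bar> * (r - 1)\<^sup>2"
    unfolding eq using assms(1) by (auto intro!: mult_right_mono mult_left_mono)
qed

lemma potential_nonneg: "\<gamma> \<ge> 1 \<Longrightarrow> r > 0 \<Longrightarrow> potential \<gamma> r \<ge> 0"
  using potential_above_tangent[of \<gamma> r 1] by (simp add: potential_one)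

text \<open>The tangent at \<open>r\<close>, evaluated at 1 where the potential vanishes, bounds
  \<open>potential \<gamma> r\<close> by
  \<open>potential_deriv \<gamma> r * (r - 1)\<close>.\<close>

lemma potential_upper:
  assumes "\<gamma> \<ge> 1" "\<bar>r - 1\<bar> \<le> 1/2"
  shows "potential \<gamma> r \<le> \<gamma> * 2 powr \<bar>\<gamma> - 2\<bar> * (r - 1)\<^sup>2"
proof -
  have r: "1/2 \<le> r" "r \<le> 2" using assms(2) by linarith+
  have "potential \<gamma> 1 \<ge> potential \<gamma> r + potential_deriv \<gamma> r * (1 - r)"
    using r assms(1) by (intro potential_above_tangent) auto
  hence "potential \<gamma> r \<le> potential_deriv \<gamma> r * (r - 1)" by (simp add: potential_one algebra_simps)
  thus ?thesis using potential_deriv_bounds(2)[OF assms(1) r] by linarith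
qed

text \<open>The tangent at the midpoint of \<open>1\<close> and \<open>r\<close> gives the lower bound.\<close>

lemma potential_lower:
  assumes g: "\<gamma> \<ge> 1" and r: "r > 0" and small: "potential \<gamma> r < \<gamma> * 2 powr (- \<bar>\<gamma> - 2\<bar>) / 4"
  shows "\<gamma> * 2 powr (- \<bar>\<gamma> - 2\<bar>) * (r - 1)\<^sup>2 \<le> 2 * (2 * potential \<gamma> r)"
proof -
  let ?c = "\<gamma> * 2 powr (- \<bar>\<gamma> - 2\<bar>)"
  \<comment> \<open>The factor 4 comes from the midpoint: its squared distance to 1 is a quarter of
    that of \<open>s\<close>.\<close>
  have quad: "?c * (s - 1)\<^sup>2 \<le> 4 * potential \<gamma> s" if s: "0 < s" "s \<le> 2" for s
  proof -
    define m where "m = (1 + s) / 2"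
    have m: "1/2 \<le> m" "m \<le> 2" using s by (auto simp: m_def)
    have "0 \<le> potential \<gamma> m" using m g by (intro potential_nonneg) auto
    moreover have "potential \<gamma> s \<ge> potential \<gamma> m + potential_deriv \<gamma> m * (s - m)"
      using s m g by (intro potential_above_tangent) auto
    moreover have "s - m = m - 1" by (simp add: m_def field_simps)
    ultimately have "?c * (m - 1)\<^sup>2 \<le> potential \<gamma> s"
      using potential_deriv_bounds(1)[OF g m] by simp
    moreover have "(m - 1)\<^sup>2 = (s - 1)\<^sup>2 / 4" by (simp add: m_def power2_eq_square field_simps)
    ultimately show ?thesis by simp
  qed
  show ?thesis
  proof (cases "r \<le> 2")
    case True
    thus ?thesis using quad[OF r] by simp
  next
    \<comment> \<open>Beyond 2 the potential is at least its value at 2, itself at least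
      \<open>?c / 4\<close>, which the smallness hypothesis excludes.\<close>
    case False
    have "?c * 1 \<le> potential_deriv \<gamma> 2 * 1"
      using potential_deriv_bounds(1)[OF g, of 2] by simp
    moreover have "0 \<le> ?c" using g by simp
    ultimately have "0 \<le> potential_deriv \<gamma> 2 * (r - 2)" using False by simp
    moreover have "potential \<gamma> r \<ge> potential \<gamma> 2 + potential_deriv \<gamma> 2 * (r - 2)"
      using r g by (intro potential_above_tangent) auto
    moreover have "?c * (2 - 1)\<^sup>2 \<le> 4 * potential \<gamma> 2" by (rule quad) auto
    ultimately show ?thesis using small by simp
  qed
qed

section \<open>Subsequences, discrete norms and orthogonal decomposition\<close>

lemma common_convergent_subsequence:
  fixes f :: "'i \<Rightarrow> nat \<Rightarrow> 'a::heine_borel"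
  assumes "finite I" "\<And>i. i \<in> I \<Longrightarrow> bounded (range (f i))"
  shows "\<exists>s. strict_mono (s :: nat \<Rightarrow> nat) \<and> (\<forall>i\<in>I. \<exists>l. (\<lambda>k. f i (s k)) \<longlonglongrightarrow> l)"
  using assms
proof (induction I rule: finite_induct)
  case empty
  show ?case by (rule exI[of _ id]) (simp add: strict_mono_def)
next
  case (insert j I)
  obtain s where s: "strict_mono (s :: nat \<Rightarrow> nat)" "\<forall>i\<in>I. \<exists>l. (\<lambda>k. f i (s k)) \<longlonglongrightarrow> l"
    using insert by blast
  have "bounded (range (f j \<circ> s))"
    using insert.prems[of j] by (rule_tac bounded_subset) auto
  then obtain l t where t: "strict_mono (t :: nat \<Rightarrow> nat)" "((f j \<circ> s) \<circ> t) \<longlonglongrightarrow> l"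
    using bounded_imp_convergent_subsequence by blast
  have "\<exists>l. (\<lambda>k. f i ((s \<circ> t) k)) \<longlonglongrightarrow> l" if "i \<in> insert j I" for i
  proof (cases "i = j")
    case True thus ?thesis using t(2) by (intro exI[of _ l]) (simp add: o_def)
  next
    case False
    hence "i \<in> I" using \<open>i \<in> insert j I\<close> by simp
    then obtain m where "(\<lambda>k. f i (s k)) \<longlonglongrightarrow> m" using s(2) by blast
    from LIMSEQ_subseq_LIMSEQ[OF this t(1)] show ?thesis
      by (intro exI[of _ m]) (simp add: o_def)
  qed
  thus ?case using strict_mono_o[OF s(1) t(1)] by blast
qed

text \<open>A discrete norm is only specified on \<open>X\<close>, so every partial sum has to stay in \<open>X\<close>.\<close>

lemma discrete_norm_sum_le:
  fixes nrm :: "(nat \<Rightarrow> 's \<Rightarrow> 'v::real_vector) \<Rightarrow> real"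
  assumes nrm: "discrete_norm X nrm" and J: "finite J"
    and zero: "(\<lambda>n s. 0) \<in> X" and b: "\<And>j. j \<in> J \<Longrightarrow> b j \<in> X"
    and X_add: "\<And>v w. v \<in> X \<Longrightarrow> w \<in> X \<Longrightarrow> (\<lambda>n s. v n s + w n s) \<in> X"
    and X_scale: "\<And>v c. v \<in> X \<Longrightarrow> (\<lambda>n s. c *\<^sub>R v n s) \<in> X"
  shows "(\<lambda>n s. \<Sum>j\<in>J. c j *\<^sub>R b j n s) \<in> X \<and>
    nrm (\<lambda>n s. \<Sum>j\<in>J. c j *\<^sub>R b j n s) \<le> (\<Sum>j\<in>J. \<bar>c j\<bar> * nrm (b j))"
  using J b
proof (induction J rule: finite_induct)
  case empty
  have "nrm (\<lambda>n s. 0) = 0" using nrm zero by (simp add: discrete_norm_def)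
  thus ?case using zero by simp
next
  case (insert j J)
  let ?r = "\<lambda>n s. \<Sum>j\<in>J. c j *\<^sub>R b j n s"
  have r: "?r \<in> X" "nrm ?r \<le> (\<Sum>j\<in>J. \<bar>c j\<bar> * nrm (b j))" using insert by auto
  have bj: "b j \<in> X" using insert by auto
  have s: "(\<lambda>n s. c j *\<^sub>R b j n s) \<in> X" by (rule X_scale[OF bj])
  have e: "(\<lambda>n s. \<Sum>j\<in>insert j J. c j *\<^sub>R b j n s) = (\<lambda>n s. c j *\<^sub>R b j n s + ?r n s)"
    using insert by simp
  have tri: "nrm (\<lambda>n s. v n s + w n s) \<le> nrm v + nrm w" if "v \<in> X" "w \<in> X" for v w
    using nrm that by (simp add: discrete_norm_def)
  have hom: "nrm (\<lambda>n s. c *\<^sub>R v n s) = \<bar>c\<bar> * nrm v" if "v \<in> X" for v c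
    using nrm that by (simp add: discrete_norm_def)
  note tri[OF s r(1)]
  also note hom[OF bj]
  finally show ?case unfolding e using X_add[OF s r(1)] r(2) insert by simp
qed

text \<open>Gram-Schmidt, one vector at a time. The family may be linearly dependent, as gradients
  of cell indicators are, so a vector of the span may have to be skipped. The induction is for
  arbitrary \<open>x\<close> because the hypothesis is also applied to \<open>g j\<close>.\<close>

lemma orthogonal_decomposition:
  fixes g :: "'i \<Rightarrow> 's \<Rightarrow> 'a::real_inner" and w :: "'s \<Rightarrow> real"
  assumes I: "finite I" and S: "finite S" and w: "\<And>s. s \<in> S \<Longrightarrow> w s > 0"
  shows "\<exists>c. \<forall>i\<in>I. (\<Sum>s\<in>S. w s * ((x s - (\<Sum>i\<in>I. c i *\<^sub>R g i s)) \<bullet> g i s)) = 0"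
proof -
  define B where "B u v = (\<Sum>s\<in>S. w s * (u s \<bullet> v s))" for u v :: "'s \<Rightarrow> 'a"
  have diff_left: "B (\<lambda>s. u s - r *\<^sub>R v s) z = B u z - r * B v z" for u v z r
    by (simp add: B_def inner_diff_left right_diff_distrib sum_subtractf sum_distrib_left mult.left_commute)
  have diff_right: "B z (\<lambda>s. u s - v s) = B z u - B z v" for u v z
    by (simp add: B_def inner_diff_right right_diff_distrib sum_subtractf)
  have sum_right: "B u (\<lambda>s. \<Sum>i\<in>J. c i *\<^sub>R g i s) = (\<Sum>i\<in>J. c i * B u (g i))" for u J c
    unfolding B_def by (simp add: inner_sum_right sum_distrib_left mult.left_commute) (rule sum.swap)
  have definite: "B u v = 0" if "B v v = 0" for u v
  proof -
    have "w s * (v s \<bullet> v s) = 0" if "s \<in> S" for s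
      using \<open>B v v = 0\<close> that w S sum_nonneg_eq_0_iff[OF S, of "\<lambda>s. w s * (v s \<bullet> v s)"]
      by (auto simp: B_def less_imp_le)
    hence "v s = 0" if "s \<in> S" for s using w[OF that] that by (metis inner_eq_zero_iff less_irrefl mult_eq_0_iff)
    thus ?thesis by (simp add: B_def)
  qed
  have "\<exists>c. \<forall>i\<in>I. B (\<lambda>s. x s - (\<Sum>i\<in>I. c i *\<^sub>R g i s)) (g i) = 0" for x
    using I
  proof (induction I arbitrary: x rule: finite_induct)
    case (insert j I)
    obtain a where a: "\<And>i. i \<in> I \<Longrightarrow> B (\<lambda>s. x s - (\<Sum>i\<in>I. a i *\<^sub>R g i s)) (g i) = 0"
      using insert.IH[of x] by blast
    obtain b where b: "\<And>i. i \<in> I \<Longrightarrow> B (\<lambda>s. g j s - (\<Sum>i\<in>I. b i *\<^sub>R g i s)) (g i) = 0"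
      using insert.IH[of "g j"] by blast
    define y where "y s = x s - (\<Sum>i\<in>I. a i *\<^sub>R g i s)" for s
    define h where "h s = g j s - (\<Sum>i\<in>I. b i *\<^sub>R g i s)" for s
    define t where "t = (if B h h = 0 then 0 else B y h / B h h)"
    let ?z = "\<lambda>s. y s - t *\<^sub>R h s"
    have orth_I: "B ?z (g i) = 0" if "i \<in> I" for i
      using a[OF that] b[OF that] unfolding diff_left y_def h_def by simp
    have "B y h = t * B h h" using definite[of h y] by (auto simp: t_def)
    hence "B ?z h = 0" by (simp add: diff_left)
    moreover have "B ?z (\<lambda>s. \<Sum>i\<in>I. b i *\<^sub>R g i s) = 0"
      unfolding sum_right using orth_I by (intro sum.neutral) auto
    ultimately have orth_j: "B ?z (g j) = 0"
      using diff_right[of ?z "g j" "\<lambda>s. \<Sum>i\<in>I. b i *\<^sub>R g i s"] by (simp add: h_def[abs_def])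
    define c where "c = (\<lambda>i. a i - t * b i)(j := t)"
    have "?z s = x s - (\<Sum>i\<in>insert j I. c i *\<^sub>R g i s)" for s
    proof -
      have "(\<Sum>i\<in>insert j I. c i *\<^sub>R g i s) = t *\<^sub>R g j s + (\<Sum>i\<in>I. c i *\<^sub>R g i s)"
        using insert by (simp add: c_def)
      also have "(\<Sum>i\<in>I. c i *\<^sub>R g i s) = (\<Sum>i\<in>I. a i *\<^sub>R g i s - t *\<^sub>R (b i *\<^sub>R g i s))"
        using insert(2) by (intro sum.cong refl) (auto simp: c_def scaleR_diff_left)
      finally show ?thesis
        by (simp add: y_def h_def sum_subtractf scaleR_diff_right scaleR_sum_right)
    qed
    hence "B (\<lambda>s. x s - (\<Sum>i\<in>insert j I. c i *\<^sub>R g i s)) (g i) = 0" if "i \<in> insert j I" for i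
      using orth_I orth_j that by auto
    thus ?case by blast
  qed simp
  thus ?thesis by (simp add: B_def)
qed

context staggered begin

section \<open>Discrete energy balance\<close>

text \<open>The regrouping behind discrete integration by parts: balances live on cells,
  cancellations on faces.\<close>

lemma sum_cells_faces:
  fixes f :: "'d region \<Rightarrow> 'd region \<Rightarrow> 'b::comm_monoid_add"
  shows "(\<Sum>K\<in>cells D. \<Sum>\<sigma>\<in>cell_faces K. f K \<sigma>) = (\<Sum>\<sigma>\<in>faces D. \<Sum>K\<in>adjacent_cells D \<sigma>. f K \<sigma>)"
proof -
  have "(\<Sum>K\<in>cells D. \<Sum>\<sigma>\<in>cell_faces K. f K \<sigma>) =
    (\<Sum>K\<in>cells D. \<Sum>\<sigma>\<in>{\<sigma>\<in>faces D. \<sigma> \<in> cell_faces K}. f K \<sigma>)"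
    by (intro sum.cong refl) (auto simp: faces_def)
  also have "\<dots> = (\<Sum>\<sigma>\<in>faces D. \<Sum>K\<in>{K\<in>cells D. \<sigma> \<in> cell_faces K}. f K \<sigma>)"
    by (rule sum.swap_restrict[OF finite_cells finite_faces])
  finally show ?thesis by (simp add: adjacent_cells_def)
qed

lemma sum_cells_int_faces:
  fixes f :: "'d region \<Rightarrow> 'd region \<Rightarrow> 'b::comm_monoid_add"
  assumes "\<And>K \<sigma>. \<sigma> \<notin> int_faces D \<Longrightarrow> f K \<sigma> = 0"
  shows "(\<Sum>K\<in>cells D. \<Sum>\<sigma>\<in>cell_faces K. f K \<sigma>) = (\<Sum>\<sigma>\<in>int_faces D. \<Sum>K\<in>adjacent_cells D \<sigma>. f K \<sigma>)"
  unfolding sum_cells_faces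
  by (rule sum.mono_neutral_right[OF finite_faces int_faces_subset]) (simp add: assms)

lemma primal_flux_ext: "\<sigma> \<notin> int_faces D \<Longrightarrow> primal_flux D \<rho> u K \<sigma> = 0"
  by (simp add: primal_flux_def)

lemma primal_flux_eq:
  assumes "\<sigma> \<in> int_faces D" "opposite D K \<sigma> = L"
  shows "primal_flux D \<rho> u K \<sigma> =
    area \<sigma> * (if u \<sigma> \<bullet> outward_normal K \<sigma> \<ge> 0 then \<rho> K else \<rho> L) * (u \<sigma> \<bullet> outward_normal K \<sigma>)"
  using assms by (simp add: primal_flux_def Let_def)

lemma primal_flux_opposite:
  assumes "\<sigma> \<in> int_faces D" "opposite D K \<sigma> = L" "opposite D L \<sigma> = K"
    "outward_normal L \<sigma> = - outward_normal K \<sigma>"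
  shows "primal_flux D \<rho> u L \<sigma> = - primal_flux D \<rho> u K \<sigma>"
  unfolding primal_flux_eq[OF assms(1,2)] primal_flux_eq[OF assms(1,3)] assms(4) by simp

lemma sum_adjacent_primal_flux:
  assumes "\<sigma> \<in> int_faces D" shows "(\<Sum>K\<in>adjacent_cells D \<sigma>. primal_flux D \<rho> u K \<sigma>) = 0"
  using assms
proof (rule int_faceE)
  fix K L assume h: "K \<noteq> L" "adjacent_cells D \<sigma> = {K, L}" "opposite D K \<sigma> = L" "opposite D L \<sigma> = K"
    "outward_normal L \<sigma> = - outward_normal K \<sigma>"
  show ?thesis using h(1) primal_flux_opposite[OF assms h(3-5)] unfolding h(2) by simp
qed

text \<open>Removes the arbitrary choice of a side: exchanging \<open>K\<close> and \<open>L\<close>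
  reverses both the jump and the normal.\<close>

lemma grad_disc_eq:
  assumes "adjacent_cells D \<sigma> = {K, L}" "opposite D K \<sigma> = L" "opposite D L \<sigma> = K"
    "outward_normal L \<sigma> = - outward_normal K \<sigma>"
  shows "grad_disc D q \<sigma> = (area \<sigma> / vol (diamond D \<sigma>) * (q L - q K)) *\<^sub>R outward_normal K \<sigma>"
proof -
  have "(SOME K. K \<in> adjacent_cells D \<sigma>) \<in> adjacent_cells D \<sigma>"
    unfolding some_in_eq using assms(1) by simp
  hence "(SOME K. K \<in> adjacent_cells D \<sigma>) = K \<or> (SOME K. K \<in> adjacent_cells D \<sigma>) = L"
    using assms(1) by simp
  thus ?thesis
  proof
    assume s: "(SOME K. K \<in> adjacent_cells D \<sigma>) = K"
    show ?thesis unfolding grad_disc_def s Let_def assms(2) ..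
  next
    assume s: "(SOME K. K \<in> adjacent_cells D \<sigma>) = L"
    have "area \<sigma> / vol (diamond D \<sigma>) * (q K - q L) = - (area \<sigma> / vol (diamond D \<sigma>) * (q L - q K))"
      by (simp add: right_diff_distrib)
    thus ?thesis unfolding grad_disc_def s Let_def assms(3,4)
      by (simp only: scaleR_minus_left scaleR_minus_right minus_minus)
  qed
qed

lemma div_mass_eq:
  assumes "K \<in> cells D" shows "vol K * div_mass D \<rho> u K = (\<Sum>\<sigma>\<in>cell_faces K. primal_flux D \<rho> u K \<sigma>)"
  using vol_cell_pos[OF assms] by (simp add: div_mass_def)

section \<open>Mass balances and positivity of the density\<close>

definition mass_balance where
  "mass_balance dt \<rho>' \<rho> u \<longleftrightarrow> (\<forall>K\<in>cells D. (\<rho> K - \<rho>' K) / dt + div_mass D \<rho> u K = 0)"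

lemma mass_balance_flux:
  assumes "mass_balance dt \<rho>' \<rho> u" "dt > 0" "K \<in> cells D"
  shows "vol K * (\<rho> K - \<rho>' K) = - dt * (\<Sum>\<sigma>\<in>cell_faces K. primal_flux D \<rho> u K \<sigma>)"
proof -
  have "(\<rho> K - \<rho>' K) / dt + div_mass D \<rho> u K = 0" using assms by (simp add: mass_balance_def)
  hence "(\<rho> K - \<rho>' K) / dt = - div_mass D \<rho> u K" by simp
  hence "\<rho> K - \<rho>' K = - dt * div_mass D \<rho> u K" using assms(2) by (simp add: field_simps)
  thus ?thesis unfolding div_mass_eq[OF assms(3), symmetric] by simp
qed

text \<open>The total mass of the cells where the density is not positive cannot decrease, because the
  upwind flux through the boundary of this set is directed inwards.\<close>

lemma density_pos:
  assumes mb: "mass_balance dt \<rho>' \<rho> u" and dt: "dt > 0" and \<rho>': "\<And>K. K \<in> cells D \<Longrightarrow> \<rho>' K > 0"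
    and K0: "K0 \<in> cells D"
  shows "\<rho> K0 > 0"
proof (rule ccontr)
  assume neg: "\<not> \<rho> K0 > 0"
  \<comment> \<open>The weight selecting the cells of nonpositive density. Their mass has strictly
    decreased, since the previous densities are positive, while the balance makes its variation
    nonnegative.\<close>
  define c where "c K = (if \<rho> K \<le> 0 then 1 else 0::real)" for K
  have "(\<Sum>K\<in>cells D. c K * (vol K * (\<rho> K - \<rho>' K))) < 0"
  proof -
    have le: "c K * (vol K * (\<rho> K - \<rho>' K)) \<le> 0" if "K \<in> cells D" for K
      using vol_cell_pos[OF that] \<rho>'[OF that] by (auto simp: c_def intro!: mult_nonneg_nonpos)
    have "c K0 * (vol K0 * (\<rho> K0 - \<rho>' K0)) < 0"
      using vol_cell_pos[OF K0] \<rho>'[OF K0] neg by (auto simp: c_def intro!: mult_pos_neg)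
    hence "(\<Sum>K\<in>cells D. c K * (vol K * (\<rho> K - \<rho>' K))) < (\<Sum>K\<in>cells D. 0)"
      using le K0 by (intro sum_strict_mono_ex1[OF finite_cells]) auto
    thus ?thesis by simp
  qed
  moreover have "(\<Sum>K\<in>cells D. c K * (vol K * (\<rho> K - \<rho>' K))) =
      - dt * (\<Sum>K\<in>cells D. \<Sum>\<sigma>\<in>cell_faces K. c K * primal_flux D \<rho> u K \<sigma>)"
    unfolding sum_distrib_left[symmetric]
    by (simp add: mass_balance_flux[OF mb dt] sum_distrib_left mult_ac cong: sum.cong)
  moreover have "(\<Sum>K\<in>cells D. \<Sum>\<sigma>\<in>cell_faces K. c K * primal_flux D \<rho> u K \<sigma>) \<le> 0"
  proof -
    have le: "(\<Sum>K\<in>adjacent_cells D \<sigma>. c K * primal_flux D \<rho> u K \<sigma>) \<le> 0" if \<sigma>: "\<sigma> \<in> int_faces D" for \<sigma>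
      using \<sigma>
    proof (rule int_faceE)
      fix K L assume h: "K \<noteq> L" "adjacent_cells D \<sigma> = {K, L}" "opposite D K \<sigma> = L" "opposite D L \<sigma> = K"
        "outward_normal L \<sigma> = - outward_normal K \<sigma>"
      have a: "area \<sigma> > 0" using face_area_pos \<sigma> int_faces_subset by blast
      have s: "(\<Sum>K\<in>adjacent_cells D \<sigma>. c K * primal_flux D \<rho> u K \<sigma>) = (c K - c L) * primal_flux D \<rho> u K \<sigma>"
        using h(1) primal_flux_opposite[OF \<sigma> h(3-5)] unfolding h(2) by (simp add: algebra_simps)
      let ?un = "u \<sigma> \<bullet> outward_normal K \<sigma>"
      \<comment> \<open>Only faces between the two kinds of cells matter: there the flux leaving the
        selected side carries a nonpositive density and the flux entering it a positive one.\<close>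
      have "(c K - c L) * ((if ?un \<ge> 0 then \<rho> K else \<rho> L) * ?un) \<le> 0"
        by (auto simp: c_def mult_nonpos_nonneg mult_nonneg_nonpos mult_nonneg_nonneg mult_nonpos_nonpos)
      hence "area \<sigma> * ((c K - c L) * ((if ?un \<ge> 0 then \<rho> K else \<rho> L) * ?un)) \<le> 0"
        by (rule mult_nonneg_nonpos[OF less_imp_le[OF a]])
      thus ?thesis unfolding s primal_flux_eq[OF \<sigma> h(3)] by (simp only: mult_ac)
    qed
    have "(\<Sum>K\<in>cells D. \<Sum>\<sigma>\<in>cell_faces K. c K * primal_flux D \<rho> u K \<sigma>) =
      (\<Sum>\<sigma>\<in>int_faces D. \<Sum>K\<in>adjacent_cells D \<sigma>. c K * primal_flux D \<rho> u K \<sigma>)"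
      by (rule sum_cells_int_faces) (simp add: primal_flux_ext)
    also have "\<dots> \<le> 0" by (rule sum_nonpos) (rule le)
    finally show ?thesis .
  qed
  ultimately show False using dt by (simp add: zero_less_mult_iff)
qed

text \<open>The first condition on the dual fluxes distributes each cell balance over its
  half-diamonds; summed over both sides of \<sigma>, the primal fluxes cancel. The result is a mass
  balance on diamonds, where the velocity lives.\<close>

lemma dual_mass_balance:
  assumes mb: "mass_balance dt \<rho>' \<rho> u" and dt: "dt > 0" and u: "u \<in> H0 D" and \<sigma>: "\<sigma> \<in> int_faces D"
  shows "(\<Sum>K\<in>adjacent_cells D \<sigma>. \<Sum>\<sigma>'\<in>dual_neighbours K \<sigma>. dual_flux D \<rho> u K \<sigma> \<sigma>') =
    - (vol (diamond D \<sigma>) / dt) * (dual_density D \<rho> \<sigma> - dual_density D \<rho>' \<sigma>)"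
proof -
  have pos: "vol (diamond D \<sigma>) > 0" using vol_diamond_pos \<sigma> int_faces_subset by blast
  have "(\<Sum>\<sigma>'\<in>dual_neighbours K \<sigma>. dual_flux D \<rho> u K \<sigma> \<sigma>') =
     - (1 / dt) * (vol (half_dia D K \<sigma>) * \<rho> K - vol (half_dia D K \<sigma>) * \<rho>' K) - primal_flux D \<rho> u K \<sigma>"
    if "K \<in> adjacent_cells D \<sigma>" for K
  proof -
    have K: "K \<in> cells D" "\<sigma> \<in> cell_faces K" using that by (auto simp: adjacent_cells_def)
    have vK: "vol K > 0" by (rule vol_cell_pos[OF K(1)])
    have "primal_flux D \<rho> u K \<sigma> + (\<Sum>\<sigma>'\<in>dual_neighbours K \<sigma>. dual_flux D \<rho> u K \<sigma> \<sigma>') =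
          vol (half_dia D K \<sigma>) / vol K * (\<Sum>\<sigma>'\<in>cell_faces K. primal_flux D \<rho> u K \<sigma>')"
      using staggered K u unfolding staggered_discretization_def dual_flux_conditions_def by blast
    moreover have "(\<Sum>\<sigma>'\<in>cell_faces K. primal_flux D \<rho> u K \<sigma>') = - (1 / dt) * (vol K * (\<rho> K - \<rho>' K))"
      unfolding mass_balance_flux[OF mb dt K(1)] using dt by simp
    ultimately have "primal_flux D \<rho> u K \<sigma> + (\<Sum>\<sigma>'\<in>dual_neighbours K \<sigma>. dual_flux D \<rho> u K \<sigma> \<sigma>') =
          - (1 / dt) * (vol (half_dia D K \<sigma>) * (\<rho> K - \<rho>' K))"
      using vK by simp
    thus ?thesis by (simp add: right_diff_distrib)
  qed
  hence "(\<Sum>K\<in>adjacent_cells D \<sigma>. \<Sum>\<sigma>'\<in>dual_neighbours K \<sigma>. dual_flux D \<rho> u K \<sigma> \<sigma>') =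
    - (1 / dt) * ((\<Sum>K\<in>adjacent_cells D \<sigma>. vol (half_dia D K \<sigma>) * \<rho> K) -
        (\<Sum>K\<in>adjacent_cells D \<sigma>. vol (half_dia D K \<sigma>) * \<rho>' K)) - (\<Sum>K\<in>adjacent_cells D \<sigma>. primal_flux D \<rho> u K \<sigma>)"
    by (simp only: sum_subtractf sum_distrib_left[symmetric] cong: sum.cong)
  thus ?thesis
    unfolding sum_adjacent_primal_flux[OF \<sigma>] using pos
    by (simp add: dual_density_def diff_divide_distrib[symmetric])
qed

text \<open>The mixed terms of the convection operator cancel by antisymmetry of the dual fluxes.\<close>

lemma dual_flux_mixed_terms:
  assumes u: "u \<in> H0 D"
  shows "(\<Sum>\<sigma>\<in>int_faces D. \<Sum>K\<in>adjacent_cells D \<sigma>. \<Sum>\<sigma>'\<in>dual_neighbours K \<sigma>.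
    dual_flux D \<rho> u K \<sigma> \<sigma>' * (u \<sigma> \<bullet> u \<sigma>')) = 0"
proof -
  let ?a = "\<lambda>K \<sigma> \<sigma>'. dual_flux D \<rho> u K \<sigma> \<sigma>' * (u \<sigma> \<bullet> u \<sigma>')"
  have "(\<Sum>\<sigma>\<in>cell_faces K. \<Sum>\<sigma>'\<in>dual_neighbours K \<sigma>. ?a K \<sigma> \<sigma>') = 0" if K: "K \<in> cells D" for K
  proof -
    let ?R = "\<lambda>\<sigma> \<sigma>'. \<sigma>' \<noteq> \<sigma> \<and> aff_dim (\<sigma> \<inter> \<sigma>') = int CARD('d) - 2"
    let ?S = "\<Sum>\<sigma>\<in>cell_faces K. \<Sum>\<sigma>'\<in>dual_neighbours K \<sigma>. ?a K \<sigma> \<sigma>'"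
    have fin: "finite (cell_faces K)" by (rule finite_cell_faces[OF K])
    have n: "dual_neighbours K \<sigma> = {\<sigma>' \<in> cell_faces K. ?R \<sigma> \<sigma>'}" for \<sigma> by (simp add: dual_neighbours_def)
    have n': "dual_neighbours K \<sigma> = {\<sigma>' \<in> cell_faces K. ?R \<sigma>' \<sigma>}" for \<sigma>
      by (auto simp: dual_neighbours_def Int_commute)
    \<comment> \<open>Being neighbours is a symmetric relation, so the indices may be exchanged;
      antisymmetry then gives \<open>?S = - ?S\<close>.\<close>
    have "?S = (\<Sum>\<sigma>'\<in>cell_faces K. \<Sum>\<sigma>\<in>dual_neighbours K \<sigma>'. ?a K \<sigma> \<sigma>')"
      unfolding n by (subst sum.swap_restrict[OF fin fin]) (simp only: n[symmetric] n'[symmetric])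
    also have "\<dots> = (\<Sum>\<sigma>'\<in>cell_faces K. \<Sum>\<sigma>\<in>dual_neighbours K \<sigma>'. - ?a K \<sigma>' \<sigma>)"
    proof (intro sum.cong refl)
      fix \<sigma> \<sigma>' assume s: "\<sigma>' \<in> cell_faces K" "\<sigma> \<in> dual_neighbours K \<sigma>'"
      have "dual_flux D \<rho> u K \<sigma>' \<sigma> = - dual_flux D \<rho> u K \<sigma> \<sigma>'"
        using staggered K u s unfolding staggered_discretization_def dual_flux_conditions_def by blast
      thus "?a K \<sigma> \<sigma>' = - ?a K \<sigma>' \<sigma>" by (simp add: inner_commute)
    qed
    also have "\<dots> = - ?S" by (simp add: sum_negf)
    finally show ?thesis by simp
  qed
  hence "(\<Sum>K\<in>cells D. \<Sum>\<sigma>\<in>cell_faces K. \<Sum>\<sigma>'\<in>dual_neighbours K \<sigma>. ?a K \<sigma> \<sigma>') = 0"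
    by (intro sum.neutral) blast
  moreover have "?a K \<sigma> \<sigma>' = 0" if "\<sigma> \<notin> int_faces D" for K \<sigma> \<sigma>' using u that by (simp add: H0_def)
  ultimately show ?thesis by (subst (asm) sum_cells_int_faces) (auto intro!: sum.neutral)
qed

section \<open>Elastic and kinetic energy balances\<close>

definition pressure_work where
  "pressure_work p u = (\<Sum>\<sigma>\<in>int_faces D. vol (diamond D \<sigma>) * (grad_disc D p \<sigma> \<bullet> u \<sigma>))"

text \<open>The convexity of the potential is used in time and then across each face, where the upwind choice
  gives the remainder its sign.\<close>

lemma potential_decrease:
  assumes mb: "mass_balance dt \<rho>' \<rho> u" and dt: "dt > 0" and \<gamma>: "\<gamma> \<ge> 1"
    and \<rho>': "\<And>K. K \<in> cells D \<Longrightarrow> \<rho>' K > 0"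
  shows "(\<Sum>K\<in>cells D. vol K * potential \<gamma> (\<rho> K)) - (\<Sum>K\<in>cells D. vol K * potential \<gamma> (\<rho>' K))
    \<le> dt * pressure_work (\<lambda>K. \<rho> K powr \<gamma>) u"
proof -
  have \<rho>: "\<rho> K > 0" if "K \<in> cells D" for K using density_pos[OF mb dt \<rho>' that] .
  let ?d = "\<lambda>K. potential_deriv \<gamma> (\<rho> K)" and ?P = "\<lambda>K. potential \<gamma> (\<rho> K)" and ?F = "primal_flux D \<rho> u"
  have "(\<Sum>K\<in>cells D. vol K * ?P K) - (\<Sum>K\<in>cells D. vol K * potential \<gamma> (\<rho>' K)) =
    (\<Sum>K\<in>cells D. vol K * (?P K - potential \<gamma> (\<rho>' K)))"
    by (simp add: sum_subtractf right_diff_distrib)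
  also have "\<dots> \<le> (\<Sum>K\<in>cells D. ?d K * (vol K * (\<rho> K - \<rho>' K)))"
  proof (rule sum_mono)
    fix K assume K: "K \<in> cells D"
    have "potential \<gamma> (\<rho>' K) \<ge> ?P K + ?d K * (\<rho>' K - \<rho> K)"
      by (rule potential_above_tangent[OF \<gamma> \<rho>'[OF K] \<rho>[OF K]])
    hence "?P K - potential \<gamma> (\<rho>' K) \<le> ?d K * (\<rho> K - \<rho>' K)" by (simp add: algebra_simps)
    hence "vol K * (?P K - potential \<gamma> (\<rho>' K)) \<le> vol K * (?d K * (\<rho> K - \<rho>' K))"
      using vol_cell_pos[OF K] by (intro mult_left_mono) auto
    thus "vol K * (?P K - potential \<gamma> (\<rho>' K)) \<le> ?d K * (vol K * (\<rho> K - \<rho>' K))" by (simp only: mult_ac)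
  qed
  also have "\<dots> = - dt * (\<Sum>K\<in>cells D. \<Sum>\<sigma>\<in>cell_faces K. ?d K * ?F K \<sigma>)"
    by (simp add: mass_balance_flux[OF mb dt] sum_distrib_left mult_ac cong: sum.cong)
  also have "(\<Sum>K\<in>cells D. \<Sum>\<sigma>\<in>cell_faces K. ?d K * ?F K \<sigma>) =
     (\<Sum>\<sigma>\<in>int_faces D. \<Sum>K\<in>adjacent_cells D \<sigma>. ?d K * ?F K \<sigma>)"
    by (rule sum_cells_int_faces) (simp add: primal_flux_ext)
  finally have 1: "(\<Sum>K\<in>cells D. vol K * ?P K) - (\<Sum>K\<in>cells D. vol K * potential \<gamma> (\<rho>' K))
     \<le> - dt * (\<Sum>\<sigma>\<in>int_faces D. \<Sum>K\<in>adjacent_cells D \<sigma>. ?d K * ?F K \<sigma>)" .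
  have "- pressure_work (\<lambda>K. \<rho> K powr \<gamma>) u \<le> (\<Sum>\<sigma>\<in>int_faces D. \<Sum>K\<in>adjacent_cells D \<sigma>. ?d K * ?F K \<sigma>)"
    unfolding pressure_work_def sum_negf[symmetric]
  proof (rule sum_mono)
    fix \<sigma> assume \<sigma>: "\<sigma> \<in> int_faces D"
    show "- (vol (diamond D \<sigma>) * (grad_disc D (\<lambda>K. \<rho> K powr \<gamma>) \<sigma> \<bullet> u \<sigma>)) \<le>
      (\<Sum>K\<in>adjacent_cells D \<sigma>. ?d K * ?F K \<sigma>)"
      using \<sigma>
    proof (rule int_faceE)
      fix K L assume KL: "K \<in> cells D" "L \<in> cells D" and
        h: "K \<noteq> L" "adjacent_cells D \<sigma> = {K, L}" "opposite D K \<sigma> = L" "opposite D L \<sigma> = K"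
        "outward_normal L \<sigma> = - outward_normal K \<sigma>"
      have a: "area \<sigma> > 0" using face_area_pos \<sigma> int_faces_subset by blast
      have pos: "vol (diamond D \<sigma>) > 0" using vol_diamond_pos \<sigma> int_faces_subset by blast
      let ?un = "u \<sigma> \<bullet> outward_normal K \<sigma>"
      have s: "(\<Sum>K\<in>adjacent_cells D \<sigma>. ?d K * ?F K \<sigma>) = (?d K - ?d L) * ?F K \<sigma>"
        using h(1) primal_flux_opposite[OF \<sigma> h(3-5)] unfolding h(2) by (simp add: algebra_simps)
      have g: "- (vol (diamond D \<sigma>) * (grad_disc D (\<lambda>K. \<rho> K powr \<gamma>) \<sigma> \<bullet> u \<sigma>)) =
        area \<sigma> * ((\<rho> K powr \<gamma> - \<rho> L powr \<gamma>) * ?un)"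
      proof -
        have *: "- (vol (diamond D \<sigma>) * (area \<sigma> / vol (diamond D \<sigma>) * x * y)) = area \<sigma> * (- x * y)" for x y
          using pos by simp
        show ?thesis unfolding grad_disc_eq[OF h(2-5)] inner_scaleR_left * by (simp add: inner_commute)
      qed
      \<comment> \<open>The tangent inequality rewritten with
        \<open>r * \<Pi>'(r) - \<Pi>(r) = r powr \<gamma> - 1\<close>: the pressure jump is compared
        with the jump of \<Pi>' weighted by the density of \<open>A\<close>, which the proof takes
        to be the upwind cell.\<close>
      have up: "(\<rho> A powr \<gamma> - \<rho> B powr \<gamma>) \<le> (?d A - ?d B) * \<rho> A" if "A \<in> cells D" "B \<in> cells D" for A B
        using potential_above_tangent[OF \<gamma> \<rho>[OF that(1)] \<rho>[OF that(2)]]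
        by (simp add: potential_def algebra_simps)
      have "(\<rho> K powr \<gamma> - \<rho> L powr \<gamma>) * ?un \<le> (?d K - ?d L) * ((if ?un \<ge> 0 then \<rho> K else \<rho> L) * ?un)"
      proof (cases "?un \<ge> 0")
        case True
        thus ?thesis using mult_right_mono[OF up[OF KL] True] by (simp add: mult.assoc)
      next
        \<comment> \<open>Here \<open>L\<close> is the upwind cell, so the inequality is used with
          the two cells exchanged.\<close>
        case False
        hence "?un \<le> 0" by simp
        have "(\<rho> L powr \<gamma> - \<rho> K powr \<gamma>) * (- ?un) \<le> ((?d L - ?d K) * \<rho> L) * (- ?un)"
          using False by (intro mult_right_mono up KL) auto
        thus ?thesis using False by (simp add: algebra_simps)
      qed
      hence "area \<sigma> * ((\<rho> K powr \<gamma> - \<rho> L powr \<gamma>) * ?un) \<le>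
        area \<sigma> * ((?d K - ?d L) * ((if ?un \<ge> 0 then \<rho> K else \<rho> L) * ?un))"
        using a by (intro mult_left_mono) auto
      thus ?thesis unfolding g s primal_flux_eq[OF \<sigma> h(3)] by (simp only: mult_ac)
    qed
  qed
  hence "dt * (- pressure_work (\<lambda>K. \<rho> K powr \<gamma>) u) \<le>
    dt * (\<Sum>\<sigma>\<in>int_faces D. \<Sum>K\<in>adjacent_cells D \<sigma>. ?d K * ?F K \<sigma>)"
    using dt by (intro mult_left_mono) auto
  thus ?thesis using 1 by simp
qed

definition kinetic_energy :: "('d region \<Rightarrow> real) \<Rightarrow> ('d region \<Rightarrow> real^'d) \<Rightarrow> real" where
  "kinetic_energy \<rho> u = (\<Sum>\<sigma>\<in>int_faces D. vol (diamond D \<sigma>) * (dual_density D \<rho> \<sigma> * (u \<sigma> \<bullet> u \<sigma>)) / 2)"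

definition momentum_balance where
  "momentum_balance \<mu> lam dt c p \<rho>' u' \<rho> u \<longleftrightarrow> (\<forall>\<sigma>\<in>int_faces D.
     (1 / dt) *\<^sub>R (dual_density D \<rho> \<sigma> *\<^sub>R u \<sigma> - dual_density D \<rho>' \<sigma> *\<^sub>R u' \<sigma>)
     + div_conv D \<rho> u u \<sigma> - div_tau D \<mu> lam u \<sigma> + c *\<^sub>R grad_disc D p \<sigma> = 0)"

lemma dual_density_nonneg:
  assumes "\<And>K. K \<in> cells D \<Longrightarrow> \<rho> K \<ge> 0" shows "dual_density D \<rho> \<sigma> \<ge> 0"
  unfolding dual_density_def using assms
  by (intro divide_nonneg_nonneg sum_nonneg mult_nonneg_nonneg) (auto simp: adjacent_cells_def)

text \<open>The momentum balance is tested with the velocity itself. The dual mass balance makes the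
  convection compatible with the time derivative, so that the kinetic energy difference appears up
  to a square of the velocity increment with favourable sign.\<close>

lemma kinetic_energy_decrease:
  assumes mb: "mass_balance dt \<rho>' \<rho> u" and dt: "dt > 0" and u: "u \<in> H0 D"
    and \<rho>': "\<And>K. K \<in> cells D \<Longrightarrow> \<rho>' K \<ge> 0" and \<mu>: "\<mu> \<ge> 0" "\<mu> + lam \<ge> 0"
    and mom: "momentum_balance \<mu> lam dt c p \<rho>' u' \<rho> u"
  shows "kinetic_energy \<rho> u - kinetic_energy \<rho>' u' + dt * (c * pressure_work p u) \<le> 0"
proof -
  let ?V = "\<lambda>\<sigma>. vol (diamond D \<sigma>)" and ?r = "dual_density D \<rho>" and ?r' = "dual_density D \<rho>'"
  let ?X = "\<lambda>\<sigma>. \<Sum>K\<in>adjacent_cells D \<sigma>. \<Sum>\<sigma>'\<in>dual_neighbours K \<sigma>. dual_flux D \<rho> u K \<sigma> \<sigma>' * (u \<sigma> \<bullet> u \<sigma>')"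
  have face: "?V \<sigma> * (?r \<sigma> * (u \<sigma> \<bullet> u \<sigma>)) / 2 - ?V \<sigma> * (?r' \<sigma> * (u' \<sigma> \<bullet> u' \<sigma>)) / 2 + dt / 2 * ?X \<sigma>
     - dt * (?V \<sigma> * (div_tau D \<mu> lam u \<sigma> \<bullet> u \<sigma>)) + dt * (c * (?V \<sigma> * (grad_disc D p \<sigma> \<bullet> u \<sigma>))) \<le> 0"
    if \<sigma>: "\<sigma> \<in> int_faces D" for \<sigma>
  proof -
    have pos: "?V \<sigma> > 0" using vol_diamond_pos \<sigma> int_faces_subset by blast
    let ?U = "u \<sigma> \<bullet> u \<sigma>" and ?W = "u' \<sigma> \<bullet> u \<sigma>" and ?t = "div_tau D \<mu> lam u \<sigma> \<bullet> u \<sigma>" and ?g = "grad_disc D p \<sigma> \<bullet> u \<sigma>"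
    have "((1 / dt) *\<^sub>R (?r \<sigma> *\<^sub>R u \<sigma> - ?r' \<sigma> *\<^sub>R u' \<sigma>)
     + div_conv D \<rho> u u \<sigma> - div_tau D \<mu> lam u \<sigma> + c *\<^sub>R grad_disc D p \<sigma>) \<bullet> u \<sigma> = 0"
      using mom \<sigma> by (simp add: momentum_balance_def)
    hence e: "(1 / dt) * (?r \<sigma> * ?U - ?r' \<sigma> * ?W) + div_conv D \<rho> u u \<sigma> \<bullet> u \<sigma> - ?t + c * ?g = 0"
      by (simp add: inner_add_left inner_diff_left)
    \<comment> \<open>The centred face value is split: the half carrying the velocity at \<sigma>
      multiplies the total dual flux, while the other half forms the mixed terms that cancel after
      summation.\<close>
    have "?V \<sigma> * (div_conv D \<rho> u u \<sigma> \<bullet> u \<sigma>) = (\<Sum>K\<in>adjacent_cells D \<sigma>. \<Sum>\<sigma>'\<in>dual_neighbours K \<sigma>.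
        dual_flux D \<rho> u K \<sigma> \<sigma>' * (1/2 * (?U + u \<sigma>' \<bullet> u \<sigma>)))"
      using pos by (simp add: div_conv_def inner_sum_left inner_add_left)
    also have "\<dots> = (\<Sum>K\<in>adjacent_cells D \<sigma>. \<Sum>\<sigma>'\<in>dual_neighbours K \<sigma>.
        1/2 * (?U * dual_flux D \<rho> u K \<sigma> \<sigma>') + 1/2 * (dual_flux D \<rho> u K \<sigma> \<sigma>' * (u \<sigma> \<bullet> u \<sigma>')))"
      by (intro sum.cong refl) (simp add: inner_commute algebra_simps)
    also have "\<dots> = 1/2 * (?U * (\<Sum>K\<in>adjacent_cells D \<sigma>. \<Sum>\<sigma>'\<in>dual_neighbours K \<sigma>. dual_flux D \<rho> u K \<sigma> \<sigma>')) + 1/2 * ?X \<sigma>"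
      unfolding sum.distrib sum_distrib_left[symmetric] ..
    finally have conv: "?V \<sigma> * (div_conv D \<rho> u u \<sigma> \<bullet> u \<sigma>) =
      1/2 * (?U * (- (?V \<sigma> / dt) * (?r \<sigma> - ?r' \<sigma>))) + 1/2 * ?X \<sigma>"
      unfolding dual_mass_balance[OF mb dt u \<sigma>] .
    have "dt * ?V \<sigma> * ((1 / dt) * (?r \<sigma> * ?U - ?r' \<sigma> * ?W) + div_conv D \<rho> u u \<sigma> \<bullet> u \<sigma> - ?t + c * ?g) = 0"
      unfolding e by simp
    hence "?V \<sigma> * (?r \<sigma> * ?U - ?r' \<sigma> * ?W) + dt * (?V \<sigma> * (div_conv D \<rho> u u \<sigma> \<bullet> u \<sigma>)) - dt * (?V \<sigma> * ?t) + dt * (c * (?V \<sigma> * ?g)) = 0"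
      using dt by (simp add: algebra_simps)
    hence e2: "?V \<sigma> * (?r \<sigma> * ?U - ?r' \<sigma> * ?W) - 1/2 * (?V \<sigma> * (?U * (?r \<sigma> - ?r' \<sigma>))) + dt / 2 * ?X \<sigma>
       - dt * (?V \<sigma> * ?t) + dt * (c * (?V \<sigma> * ?g)) = 0"
      unfolding conv using dt by (simp add: algebra_simps)
    \<comment> \<open>The square dropped here is the numerical dissipation of the implicit time
      step.\<close>
    have "0 \<le> (u' \<sigma> - u \<sigma>) \<bullet> (u' \<sigma> - u \<sigma>)" by simp
    hence "2 * ?W \<le> ?U + u' \<sigma> \<bullet> u' \<sigma>" by (simp add: inner_diff_left inner_diff_right inner_commute)
    hence "?r' \<sigma> * (2 * ?W) \<le> ?r' \<sigma> * (?U + u' \<sigma> \<bullet> u' \<sigma>)"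
      by (rule mult_left_mono[OF _ dual_density_nonneg[OF \<rho>']])
    hence "?V \<sigma> * (?r' \<sigma> * (2 * ?W)) \<le> ?V \<sigma> * (?r' \<sigma> * (?U + u' \<sigma> \<bullet> u' \<sigma>))"
      by (rule mult_left_mono[OF _ less_imp_le[OF pos]])
    with e2 show ?thesis by (simp add: algebra_simps)
  qed
  have "(\<Sum>\<sigma>\<in>int_faces D. ?V \<sigma> * (?r \<sigma> * (u \<sigma> \<bullet> u \<sigma>)) / 2 - ?V \<sigma> * (?r' \<sigma> * (u' \<sigma> \<bullet> u' \<sigma>)) / 2 + dt / 2 * ?X \<sigma>
     - dt * (?V \<sigma> * (div_tau D \<mu> lam u \<sigma> \<bullet> u \<sigma>)) + dt * (c * (?V \<sigma> * (grad_disc D p \<sigma> \<bullet> u \<sigma>)))) \<le> 0"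
    by (intro sum_nonpos face)
  hence "kinetic_energy \<rho> u - kinetic_energy \<rho>' u' + dt / 2 * (\<Sum>\<sigma>\<in>int_faces D. ?X \<sigma>)
     - dt * (\<Sum>\<sigma>\<in>int_faces D. ?V \<sigma> * (div_tau D \<mu> lam u \<sigma> \<bullet> u \<sigma>)) + dt * (c * pressure_work p u) \<le> 0"
    unfolding kinetic_energy_def pressure_work_def sum_subtractf sum.distrib sum_distrib_left[symmetric] .
  moreover have "dt * (\<Sum>\<sigma>\<in>int_faces D. ?V \<sigma> * (div_tau D \<mu> lam u \<sigma> \<bullet> u \<sigma>)) \<le> 0"
    using dt diffusion_dissipates[OF u \<mu>] by (simp add: mult_nonneg_nonpos)
  ultimately show ?thesis unfolding dual_flux_mixed_terms[OF u] by simp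
qed

definition total_energy ::
  "real \<Rightarrow> real \<Rightarrow> ('d region \<Rightarrow> real) \<Rightarrow> ('d region \<Rightarrow> real^'d) \<Rightarrow> real" where
  "total_energy \<gamma> c \<rho> u = kinetic_energy \<rho> u + c * (\<Sum>K\<in>cells D. vol K * potential \<gamma> (\<rho> K))"

lemma total_energy_decrease:
  assumes mb: "mass_balance dt \<rho>' \<rho> u" and dt: "dt > 0" and u: "u \<in> H0 D" and \<gamma>: "\<gamma> \<ge> 1" and c: "c \<ge> 0"
    and \<rho>': "\<And>K. K \<in> cells D \<Longrightarrow> \<rho>' K > 0" and \<mu>: "\<mu> \<ge> 0" "\<mu> + lam \<ge> 0"
    and mom: "momentum_balance \<mu> lam dt c (\<lambda>K. \<rho> K powr \<gamma>) \<rho>' u' \<rho> u"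
  shows "total_energy \<gamma> c \<rho> u \<le> total_energy \<gamma> c \<rho>' u'"
proof -
  have "kinetic_energy \<rho> u - kinetic_energy \<rho>' u' + dt * (c * pressure_work (\<lambda>K. \<rho> K powr \<gamma>) u) \<le> 0"
    by (rule kinetic_energy_decrease[OF mb dt u less_imp_le[OF \<rho>'] \<mu> mom])
  moreover have "c * ((\<Sum>K\<in>cells D. vol K * potential \<gamma> (\<rho> K)) - (\<Sum>K\<in>cells D. vol K * potential \<gamma> (\<rho>' K)))
    \<le> c * (dt * pressure_work (\<lambda>K. \<rho> K powr \<gamma>) u)"
    by (rule mult_left_mono[OF potential_decrease[OF mb dt \<gamma> \<rho>'] c])
  ultimately show ?thesis by (simp add: total_energy_def algebra_simps)
qed

end

section \<open>Componentwise convergence\<close>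

lemma finite_positive_lower_bound:
  fixes f :: "'a \<Rightarrow> real"
  assumes "finite A" "\<And>a. a \<in> A \<Longrightarrow> 0 < f a"
  shows "\<exists>v>0. \<forall>a\<in>A. v \<le> f a"
  using assms
proof (induction A rule: finite_induct)
  case empty show ?case by (rule exI[of _ 1]) simp
next
  case (insert a A)
  then obtain v where "v > 0" "\<forall>a\<in>A. v \<le> f a" by auto
  thus ?case using insert.prems[of a] by (intro exI[of _ "min v (f a)"]) auto
qed

text \<open>A coordinate subspace, of finite dimension for finite \<open>A\<close> and
  finite-dimensional values: the common form of \<open>velocity_space\<close> and
  \<open>pressure_space\<close>, so that both are treated by the same lemmas.\<close>

definition supported_on :: "(nat \<times> 's) set \<Rightarrow> (nat \<Rightarrow> 's \<Rightarrow> 'v::zero) set" where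
  "supported_on A = {v. \<forall>n s. (n, s) \<notin> A \<longrightarrow> v n s = 0}"

text \<open>Expansion in the fields having one basis vector at one index and zero elsewhere,
  followed by the triangle inequality; the constant is the sum of the norms of these fields.\<close>

lemma discrete_norm_le:
  fixes nrm :: "(nat \<Rightarrow> 's \<Rightarrow> 'v::euclidean_space) \<Rightarrow> real"
  assumes A: "finite A" and nrm: "discrete_norm (supported_on A) nrm"
  shows "\<exists>C\<ge>0. \<forall>v\<in>supported_on A. nrm v \<le> C * (\<Sum>a\<in>A. norm (v (fst a) (snd a)))"
proof -
  define b :: "(nat \<times> 's) \<times> 'v \<Rightarrow> nat \<Rightarrow> 's \<Rightarrow> 'v"
    where "b j = (\<lambda>n s. if (n, s) = fst j then snd j else 0)" for j
  let ?J = "A \<times> (Basis :: 'v set)"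
  have J: "finite ?J" using A by simp
  have bX: "b j \<in> supported_on A" if "j \<in> ?J" for j
    using that by (auto simp: b_def supported_on_def)
  have nb: "0 \<le> nrm (b j)" if "j \<in> ?J" for j
    using nrm bX[OF that] by (simp add: discrete_norm_def)
  define C where "C = (\<Sum>j\<in>?J. nrm (b j))"
  have "nrm v \<le> C * (\<Sum>a\<in>A. norm (v (fst a) (snd a)))" if v: "v \<in> supported_on A" for v
  proof -
    let ?c = "\<lambda>j. v (fst (fst j)) (snd (fst j)) \<bullet> snd j"
    have rep: "(\<lambda>n s. \<Sum>j\<in>?J. ?c j *\<^sub>R b j n s) = v"
    proof (intro ext)
      fix n s
      have "(\<Sum>j\<in>?J. ?c j *\<^sub>R b j n s) = (\<Sum>a\<in>A. \<Sum>e\<in>Basis. ?c (a, e) *\<^sub>R b (a, e) n s)"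
        by (simp add: sum.cartesian_product split_def)
      also have "\<dots> = (\<Sum>a\<in>A. if a = (n, s) then (\<Sum>e\<in>Basis. (v n s \<bullet> e) *\<^sub>R e) else 0)"
        by (intro sum.cong refl) (auto simp: b_def)
      also have "\<dots> = v n s" using A v by (simp add: sum.delta euclidean_representation supported_on_def)
      finally show "(\<Sum>j\<in>?J. ?c j *\<^sub>R b j n s) = v n s" .
    qed
    have "nrm (\<lambda>n s. \<Sum>j\<in>?J. ?c j *\<^sub>R b j n s) \<le> (\<Sum>j\<in>?J. \<bar>?c j\<bar> * nrm (b j))"
      using discrete_norm_sum_le[OF nrm J _ bX, where c = ?c] by (auto simp: supported_on_def)
    hence "nrm v \<le> (\<Sum>j\<in>?J. \<bar>?c j\<bar> * nrm (b j))" unfolding rep .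
    also have "\<dots> \<le> (\<Sum>j\<in>?J. (\<Sum>a\<in>A. norm (v (fst a) (snd a))) * nrm (b j))"
    proof (intro sum_mono mult_right_mono nb)
      fix j assume j: "j \<in> ?J"
      have "\<bar>?c j\<bar> \<le> norm (v (fst (fst j)) (snd (fst j)))" using j by (intro Basis_le_norm) auto
      also have "\<dots> \<le> (\<Sum>a\<in>A. norm (v (fst a) (snd a)))"
        using j A by (intro member_le_sum) auto
      finally show "\<bar>?c j\<bar> \<le> (\<Sum>a\<in>A. norm (v (fst a) (snd a)))" .
    qed
    finally show ?thesis unfolding C_def sum_distrib_left[symmetric] by (simp only: mult.commute)
  qed
  moreover have "C \<ge> 0" unfolding C_def by (rule sum_nonneg[OF nb])
  ultimately show ?thesis by blast
qed

text \<open>The componentwise bound holds from some index on; the finitely many earlier norms enter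
  through a maximum.\<close>

lemma discrete_norm_bounded:
  fixes nrm :: "(nat \<Rightarrow> 's \<Rightarrow> 'v::euclidean_space) \<Rightarrow> real"
  assumes A: "finite A" and nrm: "discrete_norm (supported_on A) nrm"
    and v: "\<And>m. v m \<in> supported_on A" and ev: "\<forall>\<^sub>F m in sequentially. \<forall>n s. norm (v m n s) \<le> B"
  shows "\<exists>B. \<forall>m. nrm (v m) \<le> B"
proof -
  obtain C where C: "C \<ge> 0" "\<And>v. v \<in> supported_on A \<Longrightarrow> nrm v \<le> C * (\<Sum>a\<in>A. norm (v (fst a) (snd a)))"
    using discrete_norm_le[OF A nrm] by blast
  obtain M where M: "\<And>m. m \<ge> M \<Longrightarrow> \<forall>n s. norm (v m n s) \<le> B" using ev by (auto simp: eventually_sequentially)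
  have large: "nrm (v m) \<le> C * (\<Sum>a\<in>A. B)" if "m \<ge> M" for m
  proof -
    have "(\<Sum>a\<in>A. norm (v m (fst a) (snd a))) \<le> (\<Sum>a\<in>A. B)" by (rule sum_mono) (simp add: M[OF that])
    thus ?thesis using C(2)[OF v[of m]] mult_left_mono[OF _ C(1)] order_trans by blast
  qed
  have "nrm (v m) \<le> Max (insert (C * (\<Sum>a\<in>A. B)) ((\<lambda>m. nrm (v m)) ` {..<M}))" for m
  proof (cases "m < M")
    case True thus ?thesis by (intro Max_ge) auto
  next
    case False
    hence "nrm (v m) \<le> C * (\<Sum>a\<in>A. B)" using large by simp
    also have "\<dots> \<le> Max (insert (C * (\<Sum>a\<in>A. B)) ((\<lambda>m. nrm (v m)) ` {..<M}))" by (intro Max_ge) auto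
    finally show ?thesis .
  qed
  thus ?thesis by blast
qed

text \<open>This replaces the equivalence of norms in finite dimension: a bounded sequence that converges
  for one discrete norm has a subsequence converging componentwise, necessarily to the same limit.\<close>

lemma discrete_norm_componentwise_subsequence:
  fixes nrm :: "(nat \<Rightarrow> 's \<Rightarrow> 'v::euclidean_space) \<Rightarrow> real"
  assumes A: "finite A" and nrm: "discrete_norm (supported_on A) nrm"
    and v: "\<And>k. v k \<in> supported_on A" and l: "l \<in> supported_on A"
    and ev: "\<forall>\<^sub>F k in sequentially. \<forall>n s. norm (v k n s) \<le> B"
    and lim: "(\<lambda>k. nrm (\<lambda>n s. v k n s - l n s)) \<longlonglongrightarrow> 0"
  shows "\<exists>t. strict_mono (t :: nat \<Rightarrow> nat) \<and> (\<forall>n s. (\<lambda>k. v (t k) n s) \<longlonglongrightarrow> l n s)"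
proof -
  obtain C where C: "C \<ge> 0" "\<And>v. v \<in> supported_on A \<Longrightarrow> nrm v \<le> C * (\<Sum>a\<in>A. norm (v (fst a) (snd a)))"
    using discrete_norm_le[OF A nrm] by blast
  have "bounded (range (\<lambda>k. v k (fst a) (snd a)))" for a
    unfolding bounded_iff
  proof -
    have "Bseq (\<lambda>k. v k (fst a) (snd a))"
      by (rule BfunI) (use ev in \<open>auto elim!: eventually_mono\<close>)
    thus "\<exists>B. \<forall>x\<in>range (\<lambda>k. v k (fst a) (snd a)). norm x \<le> B" unfolding Bseq_def by blast
  qed
  then obtain t where t: "strict_mono (t :: nat \<Rightarrow> nat)"
    "\<forall>a\<in>A. \<exists>l. (\<lambda>k. v (t k) (fst a) (snd a)) \<longlonglongrightarrow> l"
    using common_convergent_subsequence[OF A, of "\<lambda>a k. v k (fst a) (snd a)"] by blast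
  then obtain f where f: "\<And>a. a \<in> A \<Longrightarrow> (\<lambda>k. v (t k) (fst a) (snd a)) \<longlonglongrightarrow> f a" by metis
  define l' where "l' n s = (if (n, s) \<in> A then f (n, s) else 0)" for n s
  have conv: "(\<lambda>k. v (t k) n s) \<longlonglongrightarrow> l' n s" for n s
  proof (cases "(n, s) \<in> A")
    case True thus ?thesis using f[OF True] by (simp add: l'_def)
  next
    case False
    hence "v (t k) n s = 0" for k using v by (simp add: supported_on_def)
    thus ?thesis using False by (simp add: l'_def)
  qed
  have dX: "(\<lambda>n s. x n s - y n s) \<in> supported_on A" if "x \<in> supported_on A" "y \<in> supported_on A"
    for x y :: "nat \<Rightarrow> 's \<Rightarrow> 'v" using that by (simp add: supported_on_def)
  have l': "l' \<in> supported_on A" by (simp add: l'_def supported_on_def)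
  have n1: "(\<lambda>k. nrm (\<lambda>n s. v (t k) n s - l n s)) \<longlonglongrightarrow> 0"
    using LIMSEQ_subseq_LIMSEQ[OF lim t(1)] by (simp add: o_def)
  have "(\<lambda>k. C * (\<Sum>a\<in>A. norm (v (t k) (fst a) (snd a) - l' (fst a) (snd a)))) \<longlonglongrightarrow> C * (\<Sum>a\<in>A. 0)"
    by (intro tendsto_mult tendsto_const tendsto_sum tendsto_norm_zero LIM_zero conv)
  hence s0: "(\<lambda>k. C * (\<Sum>a\<in>A. norm (v (t k) (fst a) (snd a) - l' (fst a) (snd a)))) \<longlonglongrightarrow> 0" by simp
  \<comment> \<open>Both terms on the right tend to zero, the second by componentwise convergence,
    so the two limits coincide by definiteness of the norm.\<close>
  have "nrm (\<lambda>n s. l' n s - l n s) \<le> nrm (\<lambda>n s. v (t k) n s - l n s) +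
    C * (\<Sum>a\<in>A. norm (v (t k) (fst a) (snd a) - l' (fst a) (snd a)))" for k
  proof -
    let ?x = "\<lambda>n s. v (t k) n s - l n s" and ?y = "\<lambda>n s. v (t k) n s - l' n s"
    have tri: "nrm (\<lambda>n s. a n s + b n s) \<le> nrm a + nrm b" if "a \<in> supported_on A" "b \<in> supported_on A" for a b
      using nrm that by (simp add: discrete_norm_def)
    have hom: "nrm (\<lambda>n s. c *\<^sub>R a n s) = \<bar>c\<bar> * nrm a" if "a \<in> supported_on A" for a c
      using nrm that by (simp add: discrete_norm_def)
    have y: "?y \<in> supported_on A" "(\<lambda>n s. (-1) *\<^sub>R ?y n s) \<in> supported_on A"
      using dX[OF v l'] by (simp_all add: supported_on_def)
    have "nrm (\<lambda>n s. ?x n s + (-1) *\<^sub>R ?y n s) \<le> nrm ?x + nrm (\<lambda>n s. (-1) *\<^sub>R ?y n s)"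
      by (rule tri[OF dX[OF v l] y(2)])
    also have "nrm (\<lambda>n s. (-1) *\<^sub>R ?y n s) = nrm ?y" using hom[OF y(1), of "-1"] by simp
    also have "nrm ?y \<le> C * (\<Sum>a\<in>A. norm (v (t k) (fst a) (snd a) - l' (fst a) (snd a)))" by (rule C(2)[OF y(1)])
    finally show ?thesis by simp
  qed
  hence "nrm (\<lambda>n s. l' n s - l n s) \<le> 0 + 0"
    by (intro LIMSEQ_le_const[OF tendsto_add[OF n1 s0]]) blast
  moreover have "nrm (\<lambda>n s. l' n s - l n s) \<ge> 0"
    "nrm (\<lambda>n s. l' n s - l n s) = 0 \<longleftrightarrow> (\<lambda>n s. l' n s - l n s) = (\<lambda>n s. 0)"
    using nrm dX[OF l' l] unfolding discrete_norm_def by blast+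
  ultimately have "(\<lambda>n s. l' n s - l n s) = (\<lambda>n s. 0)" by simp
  hence "l' n s = l n s" for n s by (metis eq_iff_diff_eq_0)
  thus ?thesis using conv t(1) by auto
qed

context staggered begin

section \<open>Discrete duality and projection\<close>

lemma velocity_space_eq: "velocity_space D N = supported_on ({0..N} \<times> int_faces D)"
proof (intro set_eqI iffI)
  fix v assume v: "v \<in> velocity_space D N"
  have "v n s = 0" if "(n, s) \<notin> {0..N} \<times> int_faces D" for n s
    using v that by (cases "n \<le> N") (auto simp: velocity_space_def H0_def)
  thus "v \<in> supported_on ({0..N} \<times> int_faces D)" by (simp add: supported_on_def)
qed (auto simp: velocity_space_def supported_on_def H0_def)

lemma pressure_space_eq: "pressure_space D N = supported_on ({1..N} \<times> cells D)"
  by (auto simp: pressure_space_def supported_on_def)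

lemma grad_disc_cong:
  assumes "\<sigma> \<in> int_faces D" "\<And>K. K \<in> cells D \<Longrightarrow> q K = q' K"
  shows "grad_disc D q \<sigma> = grad_disc D q' \<sigma>"
  using assms(1)
proof (rule int_faceE)
  fix K L assume KL: "K \<in> cells D" "L \<in> cells D" and h: "adjacent_cells D \<sigma> = {K, L}"
    "opposite D K \<sigma> = L" "opposite D L \<sigma> = K" "outward_normal L \<sigma> = - outward_normal K \<sigma>"
  show ?thesis unfolding grad_disc_eq[OF h] assms(2)[OF KL(1)] assms(2)[OF KL(2)] ..
qed

lemma grad_disc_linear_combination:
  assumes "\<sigma> \<in> int_faces D"
  shows "grad_disc D (\<lambda>K. q K + r * q' K) \<sigma> = grad_disc D q \<sigma> + r *\<^sub>R grad_disc D q' \<sigma>"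
  using assms
proof (rule int_faceE)
  fix K L assume h: "adjacent_cells D \<sigma> = {K, L}"
    "opposite D K \<sigma> = L" "opposite D L \<sigma> = K" "outward_normal L \<sigma> = - outward_normal K \<sigma>"
  have *: "x * (b + r * c - (d + r * e)) = x * (b - d) + r * (x * (c - e))" for x b c d e :: real
    by (simp add: algebra_simps)
  show ?thesis unfolding grad_disc_eq[OF h] scaleR_scaleR scaleR_add_left[symmetric] * ..
qed

lemma grad_disc_const: "\<sigma> \<in> int_faces D \<Longrightarrow> grad_disc D (\<lambda>K. c) \<sigma> = 0"
  by (erule int_faceE) (simp add: grad_disc_eq)

lemma grad_disc_sum:
  assumes "finite J" "\<sigma> \<in> int_faces D"
  shows "grad_disc D (\<lambda>K. \<Sum>j\<in>J. c j * q j K) \<sigma> = (\<Sum>j\<in>J. c j *\<^sub>R grad_disc D (q j) \<sigma>)"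
  using assms(1)
proof (induction J rule: finite_induct)
  case empty
  show ?case using grad_disc_const[OF assms(2), of 0] by simp
next
  case (insert j J)
  have "(\<lambda>K. \<Sum>j\<in>insert j J. c j * q j K) = (\<lambda>K. (\<Sum>j\<in>J. c j * q j K) + c j * q j K)"
    using insert by (simp add: add.commute)
  thus ?case using grad_disc_linear_combination[OF assms(2), of "\<lambda>K. \<Sum>j\<in>J. c j * q j K" "c j" "q j"] insert
    by (simp add: add.commute)
qed

text \<open>Summation by faces: each internal face is seen from both sides with opposite normals,
  which turns the cell values into a jump.\<close>

lemma grad_div_duality:
  assumes v: "v \<in> H0 D"
  shows "(\<Sum>\<sigma>\<in>int_faces D. vol (diamond D \<sigma>) * (grad_disc D q \<sigma> \<bullet> v \<sigma>)) =
    - (\<Sum>K\<in>cells D. vol K * (q K * div_vel v K))"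
proof -
  let ?f = "\<lambda>K \<sigma>. q K * (area \<sigma> * (v \<sigma> \<bullet> outward_normal K \<sigma>))"
  have "(\<Sum>K\<in>cells D. vol K * (q K * div_vel v K)) = (\<Sum>K\<in>cells D. \<Sum>\<sigma>\<in>cell_faces K. ?f K \<sigma>)"
  proof (rule sum.cong[OF refl])
    fix K assume "K \<in> cells D"
    hence "vol K \<noteq> 0" using vol_cell_pos by force
    thus "vol K * (q K * div_vel v K) = (\<Sum>\<sigma>\<in>cell_faces K. ?f K \<sigma>)"
      unfolding sum_distrib_left[symmetric] by (simp add: div_vel_def)
  qed
  also have "\<dots> = (\<Sum>\<sigma>\<in>int_faces D. \<Sum>K\<in>adjacent_cells D \<sigma>. ?f K \<sigma>)"
    using v by (intro sum_cells_int_faces) (simp add: H0_def)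
  also have "\<dots> = (\<Sum>\<sigma>\<in>int_faces D. - (vol (diamond D \<sigma>) * (grad_disc D q \<sigma> \<bullet> v \<sigma>)))"
  proof (rule sum.cong[OF refl])
    fix \<sigma> assume \<sigma>: "\<sigma> \<in> int_faces D"
    have pos: "vol (diamond D \<sigma>) > 0" using vol_diamond_pos \<sigma> int_faces_subset by blast
    show "(\<Sum>K\<in>adjacent_cells D \<sigma>. ?f K \<sigma>) = - (vol (diamond D \<sigma>) * (grad_disc D q \<sigma> \<bullet> v \<sigma>))"
      using \<sigma>
    proof (rule int_faceE)
      fix K L assume h: "K \<noteq> L" "adjacent_cells D \<sigma> = {K, L}" "opposite D K \<sigma> = L" "opposite D L \<sigma> = K"
        "outward_normal L \<sigma> = - outward_normal K \<sigma>"
      have "(\<Sum>K\<in>adjacent_cells D \<sigma>. ?f K \<sigma>) = area \<sigma> * ((q K - q L) * (v \<sigma> \<bullet> outward_normal K \<sigma>))"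
        unfolding h(2) using h(1,5) by (simp add: algebra_simps)
      also have "\<dots> = - (vol (diamond D \<sigma>) * (area \<sigma> / vol (diamond D \<sigma>) * (q L - q K) * (outward_normal K \<sigma> \<bullet> v \<sigma>)))"
      proof -
        have *: "vol (diamond D \<sigma>) * (area \<sigma> / vol (diamond D \<sigma>) * x * y) = area \<sigma> * (x * y)" for x y
          using pos by simp
        show ?thesis unfolding * by (simp add: inner_commute algebra_simps)
      qed
      finally show ?thesis unfolding grad_disc_eq[OF h(2-5)] inner_scaleR_left .
    qed
  qed
  finally show ?thesis by (simp add: sum_negf)
qed

text \<open>A discrete Hodge decomposition. The part of the velocity in the span of the gradients of
  cell indicators is subtracted; orthogonality of the rest to these gradients means, by duality,
  that it is divergence free, and duality also makes gradients orthogonal to all divergence-free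
  fields.\<close>

lemma L2_projection_decomposition:
  assumes f: "in_L2 (domain D) f"
  shows "\<exists>c. \<forall>\<sigma>\<in>int_faces D. initial_velocity D f \<sigma> - L2_projection D f \<sigma> = grad_disc D c \<sigma>"
    and "L2_projection D f \<in> H0 D"
proof -
  let ?V = "\<lambda>\<sigma>. vol (diamond D \<sigma>)" and ?u = "initial_velocity D f"
  let ?e = "\<lambda>K L. if L = K then 1 else 0 :: real"
  let ?g = "\<lambda>K. grad_disc D (?e K)"
  have V: "?V \<sigma> > 0" if "\<sigma> \<in> int_faces D" for \<sigma> using vol_diamond_pos that int_faces_subset by blast
  obtain c where c: "\<And>K. K \<in> cells D \<Longrightarrow>
    (\<Sum>\<sigma>\<in>int_faces D. ?V \<sigma> * ((?u \<sigma> - (\<Sum>K\<in>cells D. c K *\<^sub>R ?g K \<sigma>)) \<bullet> ?g K \<sigma>)) = 0"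
    using orthogonal_decomposition[OF finite_cells finite_int_faces, where w = ?V and x = ?u and g = ?g, OF V] by blast
  define P where "P \<sigma> = (if \<sigma> \<in> int_faces D then ?u \<sigma> - grad_disc D c \<sigma> else 0)" for \<sigma>
  have PH: "P \<in> H0 D" by (simp add: P_def H0_def)
  have P: "P \<sigma> = ?u \<sigma> - (\<Sum>K\<in>cells D. c K *\<^sub>R ?g K \<sigma>)" if "\<sigma> \<in> int_faces D" for \<sigma>
  proof -
    have "grad_disc D c \<sigma> = grad_disc D (\<lambda>L. \<Sum>K\<in>cells D. c K * ?e K L) \<sigma>"
      using that
    proof (rule grad_disc_cong)
      fix L assume L: "L \<in> cells D"
      have "(\<Sum>K\<in>cells D. c K * ?e K L) = (\<Sum>K\<in>cells D. if K = L then c K else 0)"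
        by (intro sum.cong refl) simp
      also have "\<dots> = c L" using L finite_cells by (simp add: sum.delta)
      finally show "c L = (\<Sum>K\<in>cells D. c K * ?e K L)" ..
    qed
    thus ?thesis using that grad_disc_sum[OF finite_cells that] by (simp add: P_def)
  qed
  have "div_vel P K = 0" if K: "K \<in> cells D" for K
  proof -
    have "0 = (\<Sum>\<sigma>\<in>int_faces D. ?V \<sigma> * (P \<sigma> \<bullet> ?g K \<sigma>))"
      using c[OF K] P by (simp cong: sum.cong)
    also have "\<dots> = - (\<Sum>L\<in>cells D. vol L * (?e K L * div_vel P L))"
      using grad_div_duality[OF PH, of "?e K"] by (simp add: inner_commute)
    also have "(\<Sum>L\<in>cells D. vol L * (?e K L * div_vel P L)) = (\<Sum>L\<in>cells D. if L = K then vol L * div_vel P L else 0)"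
      by (intro sum.cong refl) simp
    also have "\<dots> = vol K * div_vel P K" using K finite_cells by (simp add: sum.delta)
    finally show ?thesis using vol_cell_pos[OF K] by simp
  qed
  hence Pd: "P \<in> div_free D" using PH by (simp add: div_free_def)
  have orth: "(\<Sum>\<sigma>\<in>int_faces D. ?V \<sigma> * ((?u \<sigma> - P \<sigma>) \<bullet> v \<sigma>)) = 0" if "v \<in> div_free D" for v
  proof -
    have "(\<Sum>\<sigma>\<in>int_faces D. ?V \<sigma> * ((?u \<sigma> - P \<sigma>) \<bullet> v \<sigma>)) = (\<Sum>\<sigma>\<in>int_faces D. ?V \<sigma> * (grad_disc D c \<sigma> \<bullet> v \<sigma>))"
      by (simp add: P_def cong: sum.cong)
    also have "\<dots> = - (\<Sum>K\<in>cells D. vol K * (c K * div_vel v K))"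
      using that by (intro grad_div_duality) (simp add: div_free_def)
    also have "\<dots> = 0" using that by (simp add: div_free_def)
    finally show ?thesis .
  qed
  have H0v: "v \<in> H0 D" if "v \<in> div_free D" for v using that by (simp add: div_free_def)
  have proj: "L2_projection D f = P"
    unfolding L2_projection_def
  proof (rule the_equality)
    show "P \<in> div_free D \<and> (\<forall>v\<in>div_free D.
        (\<integral>x. (f x - face_function D P x) \<bullet> face_function D v x \<partial>lebesgue_on (domain D)) = 0)"
      using Pd orth by (simp add: integral_face_function[OF f H0v])
    fix Q assume Q: "Q \<in> div_free D \<and> (\<forall>v\<in>div_free D.
        (\<integral>x. (f x - face_function D Q x) \<bullet> face_function D v x \<partial>lebesgue_on (domain D)) = 0)"
    \<comment> \<open>Uniqueness, which the definite description requires: the difference of two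
      projections is itself an admissible test field, so it is orthogonal to itself.\<close>
    define w where "w = (\<lambda>\<sigma>. P \<sigma> - Q \<sigma>)"
    have "div_vel w K = div_vel P K - div_vel Q K" for K
      by (simp add: w_def div_vel_def inner_diff_left right_diff_distrib sum_subtractf diff_divide_distrib)
    hence w: "w \<in> div_free D"
      using Pd Q by (simp add: div_free_def H0_def) (simp add: w_def)
    have "(\<Sum>\<sigma>\<in>int_faces D. ?V \<sigma> * ((?u \<sigma> - Q \<sigma>) \<bullet> w \<sigma>)) = 0"
      using Q w by (simp add: integral_face_function[OF f H0v[OF w], symmetric])
    hence "(\<Sum>\<sigma>\<in>int_faces D. ?V \<sigma> * ((?u \<sigma> - Q \<sigma>) \<bullet> w \<sigma>)) - (\<Sum>\<sigma>\<in>int_faces D. ?V \<sigma> * ((?u \<sigma> - P \<sigma>) \<bullet> w \<sigma>)) = 0"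
      using orth[OF w] by simp
    hence s: "(\<Sum>\<sigma>\<in>int_faces D. ?V \<sigma> * (w \<sigma> \<bullet> w \<sigma>)) = 0"
      by (simp add: w_def sum_subtractf[symmetric] right_diff_distrib[symmetric] inner_diff_left[symmetric])
    have "w \<sigma> = 0" if \<sigma>: "\<sigma> \<in> int_faces D" for \<sigma>
    proof -
      have "?V \<sigma> * (w \<sigma> \<bullet> w \<sigma>) = 0"
        using s \<sigma> V by (subst (asm) sum_nonneg_eq_0_iff[OF finite_int_faces]) (auto simp: less_imp_le)
      thus ?thesis using V[OF \<sigma>] by simp
    qed
    moreover have "w \<sigma> = 0" if "\<sigma> \<notin> int_faces D" for \<sigma> using w that by (simp add: div_free_def H0_def)
    ultimately have "P \<sigma> - Q \<sigma> = 0" for \<sigma> unfolding w_def[symmetric] by (metis w_def)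
    thus "Q = P" by auto
  qed
  show "\<exists>c. \<forall>\<sigma>\<in>int_faces D. ?u \<sigma> - L2_projection D f \<sigma> = grad_disc D c \<sigma>"
    unfolding proj P_def by (intro exI[of _ c]) simp
  show "L2_projection D f \<in> H0 D" unfolding proj by (rule PH)
qed

text \<open>The initial velocity enters only through the first time difference, and a change by a
  gradient there can be moved into the pressure at time 1.\<close>

lemma incompressible_scheme_change_initial:
  assumes a: "\<And>\<sigma>. \<sigma> \<in> int_faces D \<Longrightarrow> a \<sigma> - b \<sigma> = grad_disc D c \<sigma>" and b: "b \<in> H0 D"
    and sch: "incompressible_scheme D \<mu> lam dt N (w(0 := a)) q"
  shows "\<exists>q. incompressible_scheme D \<mu> lam dt N (w(0 := b)) q"
proof -
  \<comment> \<open>The factor \<open>- (1 / dt)\<close> is that of the initial velocity in the time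
    difference. The guard \<open>1 \<le> N\<close> keeps \<open>q'\<close> in
    \<open>pressure_space\<close> when there are no time steps.\<close>
  define q' where "q' n K = (if n = 1 \<and> 1 \<le> N \<and> K \<in> cells D then q n K + (- (1 / dt)) * c K else q n K)" for n K
  have "incompressible_scheme D \<mu> lam dt N (w(0 := b)) q'"
    unfolding incompressible_scheme_def
  proof (intro conjI allI impI ballI)
    show "w(0 := b) \<in> velocity_space D N"
      using sch b by (auto simp: incompressible_scheme_def velocity_space_def)
    show "q' \<in> pressure_space D N"
      using sch by (auto simp: incompressible_scheme_def pressure_space_def q'_def)
    fix n assume n: "n < N"
    show "div_vel ((w(0 := b)) (Suc n)) K = 0" if "K \<in> cells D" for K
      using sch n that by (auto simp: incompressible_scheme_def)
    fix \<sigma> assume \<sigma>: "\<sigma> \<in> int_faces D"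
    have e: "(1 / dt) *\<^sub>R (w (Suc n) \<sigma> - (w(0 := a)) n \<sigma>) + div_conv D (\<lambda>K. 1) (w (Suc n)) (w (Suc n)) \<sigma>
         - div_tau D \<mu> lam (w (Suc n)) \<sigma> + grad_disc D (q (Suc n)) \<sigma> = 0"
      using sch n \<sigma> by (auto simp: incompressible_scheme_def)
    have "(1 / dt) *\<^sub>R (w (Suc n) \<sigma> - (w(0 := b)) n \<sigma>) + grad_disc D (q' (Suc n)) \<sigma> =
      (1 / dt) *\<^sub>R (w (Suc n) \<sigma> - (w(0 := a)) n \<sigma>) + grad_disc D (q (Suc n)) \<sigma>"
    proof (cases "n = 0")
      case True
      have "grad_disc D (q' (Suc n)) \<sigma> = grad_disc D (\<lambda>K. q (Suc n) K + (- (1 / dt)) * c K) \<sigma>"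
        using True n by (intro grad_disc_cong[OF \<sigma>]) (simp add: q'_def)
      also have "\<dots> = grad_disc D (q (Suc n)) \<sigma> + (- (1 / dt)) *\<^sub>R (a \<sigma> - b \<sigma>)"
        unfolding grad_disc_linear_combination[OF \<sigma>] a[OF \<sigma>] ..
      finally show ?thesis using True by (simp add: algebra_simps)
    next
      case False
      thus ?thesis using grad_disc_cong[OF \<sigma>, of "q' (Suc n)" "q (Suc n)"] by (simp add: q'_def)
    qed
    note eq = this
    have gen: "B + C - T + G' = 0" if "A + C - T + G = 0" "B + G' = A + G" for A B C T G G' :: "real^'d"
    proof -
      have "B + C - T + G' = (B + G') + (C - T)" by simp
      also have "\<dots> = A + C - T + G" unfolding that(2) by simp
      finally show ?thesis using that(1) by simp
    qed
    show "(1 / dt) *\<^sub>R ((w(0 := b)) (Suc n) \<sigma> - (w(0 := b)) n \<sigma>)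
         + div_conv D (\<lambda>K. 1) ((w(0 := b)) (Suc n)) ((w(0 := b)) (Suc n)) \<sigma>
         - div_tau D \<mu> lam ((w(0 := b)) (Suc n)) \<sigma> + grad_disc D (q' (Suc n)) \<sigma> = 0"
      unfolding fun_upd_other[OF nat.distinct(2)] by (rule gen[OF e eq])
  qed
  thus ?thesis by blast
qed

lemma incompressible_scheme_projection:
  assumes f: "in_L2 (domain D) f"
  shows "(\<exists>q. incompressible_scheme D \<mu> lam dt N (w(0 := initial_velocity D f)) q) \<longleftrightarrow>
    (\<exists>q. incompressible_scheme D \<mu> lam dt N (w(0 := L2_projection D f)) q)"
proof -
  obtain c where c: "\<And>\<sigma>. \<sigma> \<in> int_faces D \<Longrightarrow>
      initial_velocity D f \<sigma> - L2_projection D f \<sigma> = grad_disc D c \<sigma>"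
    using L2_projection_decomposition(1)[OF f] by blast
  have c': "L2_projection D f \<sigma> - initial_velocity D f \<sigma> = grad_disc D (\<lambda>K. 0 + (-1) * c K) \<sigma>"
    if \<sigma>: "\<sigma> \<in> int_faces D" for \<sigma>
  proof -
    have "grad_disc D (\<lambda>K. 0 + (-1) * c K) \<sigma> = - grad_disc D c \<sigma>"
      unfolding grad_disc_linear_combination[OF \<sigma>] grad_disc_const[OF \<sigma>] by simp
    thus ?thesis using c[OF \<sigma>] by (metis minus_diff_eq)
  qed
  show ?thesis
    using incompressible_scheme_change_initial[OF c L2_projection_decomposition(2)[OF f]]
      incompressible_scheme_change_initial[OF c' initial_velocity_H0] by blast
qed


section \<open>Bounds and limits of the discrete operators\<close>

text \<open>The dual density is a convex combination of cell densities, as the half-diamond volumes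
  add up to that of the diamond.\<close>

lemma dual_density_bounds:
  assumes \<sigma>: "\<sigma> \<in> faces D"
  shows "(\<And>K. K \<in> cells D \<Longrightarrow> \<rho> K \<le> b) \<Longrightarrow> dual_density D \<rho> \<sigma> \<le> b"
    and "(\<And>K. K \<in> cells D \<Longrightarrow> b \<le> \<rho> K) \<Longrightarrow> b \<le> dual_density D \<rho> \<sigma>"
proof -
  have pos: "vol (diamond D \<sigma>) > 0" by (rule vol_diamond_pos[OF \<sigma>])
  have b: "b * vol (diamond D \<sigma>) = (\<Sum>K\<in>adjacent_cells D \<sigma>. vol (half_dia D K \<sigma>) * b)"
    unfolding vol_diamond sum_distrib_left by (simp only: mult.commute)
  show "dual_density D \<rho> \<sigma> \<le> b" if "\<And>K. K \<in> cells D \<Longrightarrow> \<rho> K \<le> b"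
    unfolding dual_density_def pos_divide_le_eq[OF pos] b
  proof (intro sum_mono mult_left_mono)
    fix K assume "K \<in> adjacent_cells D \<sigma>"
    thus "\<rho> K \<le> b" by (intro that) (simp add: adjacent_cells_def)
  qed simp
  show "b \<le> dual_density D \<rho> \<sigma>" if "\<And>K. K \<in> cells D \<Longrightarrow> b \<le> \<rho> K"
    unfolding dual_density_def pos_le_divide_eq[OF pos] b
  proof (intro sum_mono mult_left_mono)
    fix K assume "K \<in> adjacent_cells D \<sigma>"
    thus "b \<le> \<rho> K" by (intro that) (simp add: adjacent_cells_def)
  qed simp
qed

lemma dual_density_one:
  assumes "\<sigma> \<in> faces D" shows "dual_density D (\<lambda>K. 1) \<sigma> = 1"
proof (rule order_antisym)
  show "dual_density D (\<lambda>K. 1) \<sigma> \<le> 1" by (rule dual_density_bounds(1)[OF assms]) simp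
  show "1 \<le> dual_density D (\<lambda>K. 1) \<sigma>" by (rule dual_density_bounds(2)[OF assms]) simp
qed

lemma opposite_in_cells:
  assumes "\<sigma> \<in> int_faces D" "K \<in> adjacent_cells D \<sigma>" shows "opposite D K \<sigma> \<in> cells D"
  using assms(1)
proof (rule int_faceE)
  fix K' L' assume h: "K' \<in> cells D" "L' \<in> cells D" "adjacent_cells D \<sigma> = {K', L'}"
    "opposite D K' \<sigma> = L'" "opposite D L' \<sigma> = K'"
  have "K = K' \<or> K = L'" using assms(2) unfolding h(3) by simp
  thus ?thesis using h(1,2,4,5) by (elim disjE) simp_all
qed

lemma adjacent_cells_iff: "K \<in> adjacent_cells D \<sigma> \<longleftrightarrow> K \<in> cells D \<and> \<sigma> \<in> cell_faces K"
  by (simp add: adjacent_cells_def)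

lemma primal_flux_bounded:
  assumes \<rho>: "\<And>K. K \<in> cells D \<Longrightarrow> \<bar>\<rho> K\<bar> \<le> R" and u: "\<And>\<sigma>. norm (u \<sigma>) \<le> B" and R: "0 \<le> R" and B: "0 \<le> B"
    and K: "K \<in> cells D" "\<sigma> \<in> cell_faces K"
  shows "\<bar>primal_flux D \<rho> u K \<sigma>\<bar> \<le> area \<sigma> * R * B"
proof (cases "\<sigma> \<in> int_faces D")
  case True
  let ?un = "u \<sigma> \<bullet> outward_normal K \<sigma>"
  have a: "area \<sigma> > 0" using face_area_pos True int_faces_subset by blast
  have L: "opposite D K \<sigma> \<in> cells D" using True K by (intro opposite_in_cells) (auto simp: adjacent_cells_iff)
  have "\<bar>?un\<bar> \<le> norm (u \<sigma>) * norm (outward_normal K \<sigma>)" by (rule Cauchy_Schwarz_ineq2)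
  hence un: "\<bar>?un\<bar> \<le> B" using u[of \<sigma>] norm_outward_normal[OF K] by simp
  have "\<bar>if ?un \<ge> 0 then \<rho> K else \<rho> (opposite D K \<sigma>)\<bar> \<le> R" using \<rho>[OF K(1)] \<rho>[OF L] by simp
  hence "area \<sigma> * \<bar>if ?un \<ge> 0 then \<rho> K else \<rho> (opposite D K \<sigma>)\<bar> * \<bar>?un\<bar> \<le> area \<sigma> * R * B"
    using un a R by (intro mult_mono mult_left_mono) auto
  thus ?thesis unfolding primal_flux_eq[OF True refl] abs_mult using a by simp
next
  case False
  have "area \<sigma> \<ge> 0" by (simp add: area_def)
  thus ?thesis using False R B by (simp add: primal_flux_ext)
qed

text \<open>The dual fluxes are fixed linear combinations of primal fluxes, each bounded in terms of
  \<open>R\<close> and \<open>B\<close>, so one constant serves all fields within these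
  bounds.\<close>

lemma div_conv_bounded:
  assumes R: "0 \<le> R" and B: "0 \<le> B"
  shows "\<exists>C. \<forall>\<rho> u. (\<forall>K\<in>cells D. \<bar>\<rho> K\<bar> \<le> R) \<longrightarrow> (\<forall>\<sigma>. norm (u \<sigma>) \<le> B) \<longrightarrow> norm (div_conv D \<rho> u u \<sigma>) \<le> C"
proof -
  let ?C = "(1 / vol (diamond D \<sigma>)) * (\<Sum>K\<in>adjacent_cells D \<sigma>. \<Sum>\<sigma>'\<in>dual_neighbours K \<sigma>.
    (\<Sum>\<sigma>''\<in>cell_faces K. \<bar>dual_coeff D K \<sigma> \<sigma>' \<sigma>''\<bar> * (area \<sigma>'' * R * B)) * B)"
  have "norm (div_conv D \<rho> u u \<sigma>) \<le> ?C"
    if \<rho>: "\<forall>K\<in>cells D. \<bar>\<rho> K\<bar> \<le> R" and u: "\<forall>\<sigma>. norm (u \<sigma>) \<le> B" for \<rho> u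
  proof -
    have "norm (div_conv D \<rho> u u \<sigma>) = (1 / vol (diamond D \<sigma>)) * norm (\<Sum>K\<in>adjacent_cells D \<sigma>.
      \<Sum>\<sigma>'\<in>dual_neighbours K \<sigma>. dual_flux D \<rho> u K \<sigma> \<sigma>' *\<^sub>R ((1/2) *\<^sub>R (u \<sigma> + u \<sigma>')))"
      by (simp add: div_conv_def)
    also have "\<dots> \<le> ?C"
    proof (intro mult_left_mono sum_norm_le)
      fix K \<sigma>' assume K: "K \<in> adjacent_cells D \<sigma>" and "\<sigma>' \<in> dual_neighbours K \<sigma>"
      have "\<bar>dual_flux D \<rho> u K \<sigma> \<sigma>'\<bar> \<le> (\<Sum>\<sigma>''\<in>cell_faces K. \<bar>dual_coeff D K \<sigma> \<sigma>' \<sigma>''\<bar> * (area \<sigma>'' * R * B))"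
        unfolding dual_flux_def
      proof (rule order_trans[OF sum_abs], rule sum_mono)
        fix \<sigma>'' assume "\<sigma>'' \<in> cell_faces K"
        hence "\<bar>primal_flux D \<rho> u K \<sigma>''\<bar> \<le> area \<sigma>'' * R * B"
          using K \<rho> u R B by (intro primal_flux_bounded) (auto simp: adjacent_cells_iff)
        thus "\<bar>dual_coeff D K \<sigma> \<sigma>' \<sigma>'' * primal_flux D \<rho> u K \<sigma>''\<bar> \<le>
          \<bar>dual_coeff D K \<sigma> \<sigma>' \<sigma>''\<bar> * (area \<sigma>'' * R * B)"
          unfolding abs_mult by (intro mult_left_mono) auto
      qed
      moreover have "norm ((1/2) *\<^sub>R (u \<sigma> + u \<sigma>')) \<le> B"
        using norm_triangle_ineq[of "u \<sigma>" "u \<sigma>'"] u[rule_format, of \<sigma>] u[rule_format, of \<sigma>'] by simp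
      ultimately show "norm (dual_flux D \<rho> u K \<sigma> \<sigma>' *\<^sub>R ((1/2) *\<^sub>R (u \<sigma> + u \<sigma>'))) \<le>
        (\<Sum>\<sigma>''\<in>cell_faces K. \<bar>dual_coeff D K \<sigma> \<sigma>' \<sigma>''\<bar> * (area \<sigma>'' * R * B)) * B"
        unfolding norm_scaleR[of "dual_flux D \<rho> u K \<sigma> \<sigma>'"] by (intro mult_mono) auto
    qed simp
    finally show ?thesis .
  qed
  thus ?thesis by blast
qed

text \<open>The sign of the normal velocity may change along the sequence, but whichever upwind
  density is selected, its distance to 1 is at most the sum of the two candidate distances.\<close>

lemma primal_flux_tendsto:
  assumes \<rho>: "\<And>K. K \<in> cells D \<Longrightarrow> (\<lambda>k. r k K) \<longlonglongrightarrow> 1" and u: "\<And>\<sigma>. (\<lambda>k. U k \<sigma>) \<longlonglongrightarrow> u \<sigma>"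
    and K: "K \<in> cells D" "\<sigma> \<in> cell_faces K"
  shows "(\<lambda>k. primal_flux D (r k) (U k) K \<sigma>) \<longlonglongrightarrow> primal_flux D (\<lambda>K. 1) u K \<sigma>"
proof (cases "\<sigma> \<in> int_faces D")
  case True
  let ?un = "\<lambda>k. U k \<sigma> \<bullet> outward_normal K \<sigma>"
  let ?r = "\<lambda>k. if ?un k \<ge> 0 then r k K else r k (opposite D K \<sigma>)"
  have L: "opposite D K \<sigma> \<in> cells D" using True K by (intro opposite_in_cells) (auto simp: adjacent_cells_iff)
  have "(\<lambda>k. ?r k - 1) \<longlonglongrightarrow> 0"
  proof (rule Lim_null_comparison)
    show "\<forall>\<^sub>F k in sequentially. norm (?r k - 1) \<le> \<bar>r k K - 1\<bar> + \<bar>r k (opposite D K \<sigma>) - 1\<bar>" by simp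
    have "(\<lambda>k. \<bar>r k K - 1\<bar> + \<bar>r k (opposite D K \<sigma>) - 1\<bar>) \<longlonglongrightarrow> \<bar>1 - 1\<bar> + \<bar>1 - 1\<bar>"
      by (intro tendsto_intros \<rho> K L)
    thus "(\<lambda>k. \<bar>r k K - 1\<bar> + \<bar>r k (opposite D K \<sigma>) - 1\<bar>) \<longlonglongrightarrow> 0" by simp
  qed
  hence "?r \<longlonglongrightarrow> 1" by (rule LIM_zero_cancel)
  hence "(\<lambda>k. area \<sigma> * ?r k * ?un k) \<longlonglongrightarrow> area \<sigma> * 1 * (u \<sigma> \<bullet> outward_normal K \<sigma>)"
    by (intro tendsto_mult tendsto_const tendsto_inner u)
  thus ?thesis unfolding primal_flux_eq[OF True refl] by simp
qed (simp add: primal_flux_ext)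

lemma div_mass_tendsto:
  assumes \<rho>: "\<And>K. K \<in> cells D \<Longrightarrow> (\<lambda>k. r k K) \<longlonglongrightarrow> 1" and u: "\<And>\<sigma>. (\<lambda>k. U k \<sigma>) \<longlonglongrightarrow> u \<sigma>"
    and K: "K \<in> cells D"
  shows "(\<lambda>k. div_mass D (r k) (U k) K) \<longlonglongrightarrow> div_mass D (\<lambda>K. 1) u K"
  unfolding div_mass_def
  by (intro tendsto_divide tendsto_sum primal_flux_tendsto \<rho> u K tendsto_const)
     (use vol_cell_pos[OF K] in auto)

lemma div_mass_one:
  assumes "u \<in> H0 D" shows "div_mass D (\<lambda>K. 1) u K = div_vel u K"
proof -
  have "primal_flux D (\<lambda>K. 1) u K \<sigma> = area \<sigma> * (u \<sigma> \<bullet> outward_normal K \<sigma>)" for \<sigma>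
    using assms by (simp add: primal_flux_def H0_def Let_def)
  thus ?thesis by (simp add: div_mass_def div_vel_def)
qed

lemma div_conv_tendsto:
  assumes \<rho>: "\<And>K. K \<in> cells D \<Longrightarrow> (\<lambda>k. r k K) \<longlonglongrightarrow> 1" and u: "\<And>\<sigma>. (\<lambda>k. U k \<sigma>) \<longlonglongrightarrow> u \<sigma>"
  shows "(\<lambda>k. div_conv D (r k) (U k) (U k) \<sigma>) \<longlonglongrightarrow> div_conv D (\<lambda>K. 1) u u \<sigma>"
  unfolding div_conv_def dual_flux_def
  by (intro tendsto_scaleR tendsto_sum tendsto_add tendsto_mult tendsto_const primal_flux_tendsto \<rho> u)
     (auto simp: adjacent_cells_iff)

lemma dual_density_tendsto:
  assumes \<rho>: "\<And>K. K \<in> cells D \<Longrightarrow> (\<lambda>k. r k K) \<longlonglongrightarrow> 1" and \<sigma>: "\<sigma> \<in> faces D"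
  shows "(\<lambda>k. dual_density D (r k) \<sigma>) \<longlonglongrightarrow> 1"
proof -
  have "(\<lambda>k. dual_density D (r k) \<sigma>) \<longlonglongrightarrow> dual_density D (\<lambda>K. 1) \<sigma>"
    unfolding dual_density_def
    by (intro tendsto_divide tendsto_sum tendsto_mult tendsto_const \<rho>)
       (use vol_diamond_pos[OF \<sigma>] in \<open>auto simp: adjacent_cells_iff\<close>)
  thus ?thesis by (simp add: dual_density_one[OF \<sigma>])
qed

lemma grad_disc_tendsto:
  assumes q: "\<And>K. K \<in> cells D \<Longrightarrow> (\<lambda>k. q k K) \<longlonglongrightarrow> q' K" and \<sigma>: "\<sigma> \<in> int_faces D"
  shows "(\<lambda>k. grad_disc D (q k) \<sigma>) \<longlonglongrightarrow> grad_disc D q' \<sigma>"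
  using \<sigma>
proof (rule int_faceE)
  fix K L assume KL: "K \<in> cells D" "L \<in> cells D" and h: "adjacent_cells D \<sigma> = {K, L}"
    "opposite D K \<sigma> = L" "opposite D L \<sigma> = K" "outward_normal L \<sigma> = - outward_normal K \<sigma>"
  show ?thesis unfolding grad_disc_eq[OF h] by (intro tendsto_intros q KL)
qed

text \<open>A gradient bound controls the jump across each internal face. The cells whose difference
  to a reference cell is eventually bounded are closed under adjacency, hence are all the cells; the
  zero mean then fixes the additive constant.\<close>

lemma pressure_bounded_of_gradient:
  fixes p :: "nat \<Rightarrow> nat \<Rightarrow> 'd region \<Rightarrow> real" and I :: "nat set"
  assumes mean: "\<And>m n. n \<in> I \<Longrightarrow> (\<Sum>K\<in>cells D. vol K * p m n K) = 0"
    and grad: "\<And>\<sigma>. \<sigma> \<in> int_faces D \<Longrightarrow>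
      \<exists>G. \<forall>\<^sub>F m in sequentially. \<forall>n\<in>I. norm (grad_disc D (p m n) \<sigma>) \<le> G"
  shows "\<exists>B\<ge>0. \<forall>\<^sub>F m in sequentially. \<forall>n\<in>I. \<forall>K\<in>cells D. \<bar>p m n K\<bar> \<le> B"
proof -
  have "cells D \<noteq> {}" using vol_domain_pos unfolding vol_domain by auto
  then obtain K0 where K0: "K0 \<in> cells D" by blast
  let ?P = "\<lambda>L M. \<forall>\<^sub>F m in sequentially. \<forall>n\<in>I. \<bar>p m n L - p m n K0\<bar> \<le> M"
  define R where "R = {L \<in> cells D. \<exists>M. ?P L M}"
  have "K0 \<in> R" using K0 by (auto simp: R_def intro!: exI[of _ 0])
  have "R = cells D"
  proof (rule cells_connected)
    show "R \<subseteq> cells D" by (auto simp: R_def)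
    show "R \<noteq> {}" using \<open>K0 \<in> R\<close> by blast
    fix \<sigma> K L assume \<sigma>: "\<sigma> \<in> int_faces D" and K: "K \<in> R" and adj: "adjacent_cells D \<sigma> = {K, L}"
    obtain G where G: "\<forall>\<^sub>F m in sequentially. \<forall>n\<in>I. norm (grad_disc D (p m n) \<sigma>) \<le> G" using grad[OF \<sigma>] by blast
    obtain M where M: "?P K M" using K by (auto simp: R_def)
    have a: "area \<sigma> > 0" using face_area_pos \<sigma> int_faces_subset by blast
    have V: "vol (diamond D \<sigma>) > 0" using vol_diamond_pos \<sigma> int_faces_subset by blast
    have diff: "norm (grad_disc D q \<sigma>) = area \<sigma> / vol (diamond D \<sigma>) * \<bar>q L - q K\<bar>" for q
      using \<sigma>
    proof (rule int_faceE)
      fix K' L' assume h: "K' \<in> cells D" "\<sigma> \<in> cell_faces K'" "adjacent_cells D \<sigma> = {K', L'}"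
        "opposite D K' \<sigma> = L'" "opposite D L' \<sigma> = K'" "outward_normal L' \<sigma> = - outward_normal K' \<sigma>"
      have "\<bar>q L' - q K'\<bar> = \<bar>q L - q K\<bar>"
        using adj unfolding h(3) by (auto simp: doubleton_eq_iff abs_minus_commute)
      thus ?thesis unfolding grad_disc_eq[OF h(3-6)] norm_scaleR norm_outward_normal[OF h(1,2)] abs_mult
        using a V by simp
    qed
    have "?P L (G * vol (diamond D \<sigma>) / area \<sigma> + M)"
      using G M
    proof eventually_elim
      case (elim m)
      show ?case
      proof
        fix n assume n: "n \<in> I"
        have "area \<sigma> / vol (diamond D \<sigma>) * \<bar>p m n L - p m n K\<bar> \<le> G" using elim(1) n diff by simp
        hence "\<bar>p m n L - p m n K\<bar> \<le> G * vol (diamond D \<sigma>) / area \<sigma>"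
          using a V by (simp add: field_simps)
        moreover have "\<bar>p m n K - p m n K0\<bar> \<le> M" using elim(2) n by simp
        ultimately show "\<bar>p m n L - p m n K0\<bar> \<le> G * vol (diamond D \<sigma>) / area \<sigma> + M" by linarith
      qed
    qed
    moreover have "L \<in> cells D" using adj by (auto simp: adjacent_cells_def)
    ultimately show "L \<in> R" unfolding R_def by blast
  qed
  hence "\<forall>L\<in>cells D. \<exists>M. ?P L M" by (auto simp: R_def)
  from bchoice[OF this] obtain M where M: "\<forall>L\<in>cells D. ?P L (M L)" ..
  \<comment> \<open>A common bound for all differences to \<open>K0\<close>. By the zero mean it
    also bounds the value at \<open>K0\<close>, whence the total \<open>?S + ?S\<close>.\<close>
  let ?S = "\<Sum>L\<in>cells D. \<bar>M L\<bar>"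
  have ev: "\<forall>\<^sub>F m in sequentially. \<forall>L\<in>cells D. \<forall>n\<in>I. \<bar>p m n L - p m n K0\<bar> \<le> M L"
    by (rule eventually_ball_finite[OF finite_cells M])
  have "\<forall>\<^sub>F m in sequentially. \<forall>n\<in>I. \<forall>K\<in>cells D. \<bar>p m n K\<bar> \<le> ?S + ?S"
    using ev
  proof eventually_elim
    case (elim m)
    show ?case
    proof (intro ballI)
      fix n K assume n: "n \<in> I" and K: "K \<in> cells D"
      have d: "\<bar>p m n L - p m n K0\<bar> \<le> ?S" if "L \<in> cells D" for L
      proof -
        have "\<bar>p m n L - p m n K0\<bar> \<le> \<bar>M L\<bar>" using elim that n by force
        also have "\<dots> \<le> ?S" using that finite_cells by (intro member_le_sum) auto
        finally show ?thesis .
      qed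
      have "vol (domain D) * p m n K0 = (\<Sum>L\<in>cells D. vol L * p m n K0)"
        unfolding vol_domain by (rule sum_distrib_right)
      also have "\<dots> = (\<Sum>L\<in>cells D. vol L * p m n K0 - vol L * p m n L)"
        using mean[OF n, of m] by (simp add: sum_subtractf)
      finally have "\<bar>vol (domain D) * p m n K0\<bar> \<le> (\<Sum>L\<in>cells D. \<bar>vol L * p m n K0 - vol L * p m n L\<bar>)"
        using sum_abs[of "\<lambda>L. vol L * p m n K0 - vol L * p m n L" "cells D"] by simp
      also have "\<dots> \<le> (\<Sum>L\<in>cells D. vol L * ?S)"
      proof (rule sum_mono)
        fix L assume L: "L \<in> cells D"
        have "\<bar>vol L * p m n K0 - vol L * p m n L\<bar> = vol L * \<bar>p m n L - p m n K0\<bar>"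
          by (simp add: right_diff_distrib[symmetric] abs_mult abs_minus_commute)
        also have "\<dots> \<le> vol L * ?S" using d[OF L] by (intro mult_left_mono) auto
        finally show "\<bar>vol L * p m n K0 - vol L * p m n L\<bar> \<le> vol L * ?S" .
      qed
      also have "\<dots> = vol (domain D) * ?S" unfolding vol_domain by (rule sum_distrib_right[symmetric])
      finally have "\<bar>p m n K0\<bar> \<le> ?S" using vol_domain_pos by (simp add: abs_mult)
      thus "\<bar>p m n K\<bar> \<le> ?S + ?S" using d[OF K] by linarith
    qed
  qed
  moreover have "0 \<le> ?S + ?S" by (simp add: sum_nonneg)
  ultimately show ?thesis by blast
qed

end

section \<open>Low Mach number limit\<close>

locale low_mach = staggered D for D :: "'d::finite discretization" +
  fixes \<gamma> \<mu> lam dt :: real and N :: nat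
    and \<epsilon> :: "nat \<Rightarrow> real"
    and \<rho>0 :: "nat \<Rightarrow> real^'d \<Rightarrow> real"
    and u0 :: "nat \<Rightarrow> real^'d \<Rightarrow> real^'d"
    and u0lim :: "real^'d \<Rightarrow> real^'d"
    and \<rho> :: "nat \<Rightarrow> nat \<Rightarrow> 'd region \<Rightarrow> real"
    and u :: "nat \<Rightarrow> nat \<Rightarrow> 'd region \<Rightarrow> real^'d"
  assumes \<gamma>: "\<gamma> \<ge> 1" and \<mu>: "\<mu> > 0" "\<mu> + lam > 0" and dt: "dt > 0"
    and \<epsilon>: "\<And>m. \<epsilon> m > 0" "\<epsilon> \<longlonglongrightarrow> 0"
    and ill: "ill_prepared (domain D) \<epsilon> \<rho>0 u0 u0lim"
    and scheme: "\<And>m. implicit_scheme D \<gamma> \<mu> lam dt N (\<epsilon> m) (\<rho>0 m) (u0 m) (\<rho> m) (u m)"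
begin

lemma u_velocity_space: "u m \<in> velocity_space D N"
  using scheme by (simp add: implicit_scheme_def)

lemma u_H0: "u m n \<in> H0 D"
  using u_velocity_space[of m] by (cases "n \<le> N") (auto simp: velocity_space_def H0_def)

lemma u_zero: "n > N \<Longrightarrow> u m n \<sigma> = 0" "\<sigma> \<notin> int_faces D \<Longrightarrow> u m n \<sigma> = 0"
  using u_velocity_space[of m] u_H0[of m n] by (auto simp: velocity_space_def H0_def)

lemma u_initial: "u m 0 = initial_velocity D (u0 m)"
  using scheme by (simp add: implicit_scheme_def)

lemma scheme_mass_balance: "n < N \<Longrightarrow> mass_balance dt (\<rho> m n) (\<rho> m (Suc n)) (u m (Suc n))"
  using scheme by (simp add: implicit_scheme_def mass_balance_def)

lemma scheme_momentum_balance: "n < N \<Longrightarrow> momentum_balance \<mu> lam dt (1 / (\<epsilon> m)\<^sup>2)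
    (\<lambda>K. \<rho> m (Suc n) K powr \<gamma>) (\<rho> m n) (u m n) (\<rho> m (Suc n)) (u m (Suc n))"
  using scheme by (simp add: implicit_scheme_def momentum_balance_def)

section \<open>A priori estimates from the energy\<close>

lemma initial_bounds:
  "\<exists>C\<ge>0. \<forall>m. (\<forall>K\<in>cells D. 0 < \<rho> m 0 K \<and> \<bar>\<rho> m 0 K - 1\<bar> \<le> C * \<epsilon> m) \<and> (\<forall>\<sigma>. norm (u m 0 \<sigma>) \<le> C)"
proof -
  have "\<rho> m 0 K = (LINT x:K|lebesgue. \<rho>0 m x) / vol K" if "K \<in> cells D" for m K
    using scheme that by (simp add: implicit_scheme_def)
  thus ?thesis using ill_prepared_bounds[OF ill \<epsilon>(1)] unfolding u_initial by simp
qed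

lemma scheme_density_pos:
  assumes "n \<le> N" "K \<in> cells D" shows "\<rho> m n K > 0"
  using assms
proof (induction n arbitrary: K)
  case 0
  thus ?case using initial_bounds by blast
next
  case (Suc n)
  thus ?case using density_pos[OF scheme_mass_balance[of n m] dt, of K] by simp
qed

lemma scheme_energy:
  assumes "n \<le> N"
  shows "total_energy \<gamma> (1 / (\<epsilon> m)\<^sup>2) (\<rho> m n) (u m n) \<le> total_energy \<gamma> (1 / (\<epsilon> m)\<^sup>2) (\<rho> m 0) (u m 0)"
  using assms
proof (induction n)
  case (Suc n)
  have "total_energy \<gamma> (1 / (\<epsilon> m)\<^sup>2) (\<rho> m (Suc n)) (u m (Suc n)) \<le> total_energy \<gamma> (1 / (\<epsilon> m)\<^sup>2) (\<rho> m n) (u m n)"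
  proof (rule total_energy_decrease)
    show "mass_balance dt (\<rho> m n) (\<rho> m (Suc n)) (u m (Suc n))" using Suc.prems by (intro scheme_mass_balance) simp
    show "momentum_balance \<mu> lam dt (1 / (\<epsilon> m)\<^sup>2) (\<lambda>K. \<rho> m (Suc n) K powr \<gamma>) (\<rho> m n) (u m n) (\<rho> m (Suc n)) (u m (Suc n))"
      using Suc.prems by (intro scheme_momentum_balance) simp
    show "\<rho> m n K > 0" if "K \<in> cells D" for K using scheme_density_pos that Suc.prems by simp
  qed (use dt \<gamma> \<mu> u_H0 in auto)
  thus ?case using Suc by simp
qed simp

lemma eventually_epsilon_small:
  assumes "\<delta> > 0" shows "\<forall>\<^sub>F m in sequentially. C * \<epsilon> m \<le> \<delta>"
proof -
  have "(\<lambda>m. C * \<epsilon> m) \<longlonglongrightarrow> C * 0" by (intro tendsto_mult tendsto_const \<epsilon>(2))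
  hence "\<forall>\<^sub>F m in sequentially. C * \<epsilon> m < \<delta>" using assms by (intro order_tendstoD(2)) auto
  thus ?thesis by eventually_elim simp
qed

text \<open>Ill-prepared densities deviate from 1 by O(\<epsilon>), so their potential is
  O(\<epsilon>^2), which exactly compensates the factor
  \<open>1 / (\<epsilon> m)\<^sup>2\<close>.\<close>

lemma initial_energy_bounded:
  "\<exists>B\<ge>0. \<forall>\<^sub>F m in sequentially. total_energy \<gamma> (1 / (\<epsilon> m)\<^sup>2) (\<rho> m 0) (u m 0) \<le> B"
proof -
  obtain C where C: "C \<ge> 0"
    "\<And>m K. K \<in> cells D \<Longrightarrow> \<bar>\<rho> m 0 K - 1\<bar> \<le> C * \<epsilon> m" "\<And>m \<sigma>. norm (u m 0 \<sigma>) \<le> C"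
    using initial_bounds by blast
  let ?g = "\<gamma> * 2 powr \<bar>\<gamma> - 2\<bar>"
  let ?B = "(\<Sum>\<sigma>\<in>int_faces D. vol (diamond D \<sigma>) * (2 * C\<^sup>2) / 2) + (\<Sum>K\<in>cells D. vol K * (?g * C\<^sup>2))"
  \<comment> \<open>The quadratic upper bound of the potential needs distance at most 1/2 to 1; this
    also keeps the dual densities below 2.\<close>
  have "\<forall>\<^sub>F m in sequentially. C * \<epsilon> m \<le> 1/2" by (rule eventually_epsilon_small) simp
  hence "\<forall>\<^sub>F m in sequentially. total_energy \<gamma> (1 / (\<epsilon> m)\<^sup>2) (\<rho> m 0) (u m 0) \<le> ?B"
  proof eventually_elim
    case (elim m)
    have half: "\<bar>\<rho> m 0 K - 1\<bar> \<le> 1/2" if "K \<in> cells D" for K using C(2)[OF that, of m] elim by linarith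
    have "kinetic_energy (\<rho> m 0) (u m 0) \<le> (\<Sum>\<sigma>\<in>int_faces D. vol (diamond D \<sigma>) * (2 * C\<^sup>2) / 2)"
      unfolding kinetic_energy_def
    proof (intro sum_mono divide_right_mono mult_left_mono mult_mono)
      fix \<sigma> assume "\<sigma> \<in> int_faces D"
      hence \<sigma>: "\<sigma> \<in> faces D" using int_faces_subset by blast
      show "dual_density D (\<rho> m 0) \<sigma> \<le> 2"
      proof (rule dual_density_bounds(1)[OF \<sigma>])
        fix K assume "K \<in> cells D" thus "\<rho> m 0 K \<le> 2" using half[of K] by linarith
      qed
      have "(norm (u m 0 \<sigma>))\<^sup>2 \<le> C\<^sup>2" using C(3) by (intro power_mono) auto
      thus "u m 0 \<sigma> \<bullet> u m 0 \<sigma> \<le> C\<^sup>2" by (simp add: power2_norm_eq_inner)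
    qed auto
    moreover have "1 / (\<epsilon> m)\<^sup>2 * (\<Sum>K\<in>cells D. vol K * potential \<gamma> (\<rho> m 0 K)) \<le> (\<Sum>K\<in>cells D. vol K * (?g * C\<^sup>2))"
      unfolding sum_distrib_left
    proof (rule sum_mono)
      fix K assume K: "K \<in> cells D"
      have "potential \<gamma> (\<rho> m 0 K) \<le> ?g * (\<rho> m 0 K - 1)\<^sup>2" by (rule potential_upper[OF \<gamma> half[OF K]])
      also have "\<dots> \<le> ?g * (C * \<epsilon> m)\<^sup>2"
        using C(2)[OF K, of m] \<gamma> by (intro mult_left_mono power2_le_iff_abs_le[THEN iffD2]) (auto simp: C(1) \<epsilon>(1) less_imp_le)
      finally have "vol K * potential \<gamma> (\<rho> m 0 K) \<le> vol K * (?g * (C * \<epsilon> m)\<^sup>2)"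
        using vol_cell_pos[OF K] by (intro mult_left_mono) auto
      hence "1 / (\<epsilon> m)\<^sup>2 * (vol K * potential \<gamma> (\<rho> m 0 K)) \<le> 1 / (\<epsilon> m)\<^sup>2 * (vol K * (?g * (C * \<epsilon> m)\<^sup>2))"
        by (rule mult_left_mono) simp
      also have "\<dots> = vol K * (?g * C\<^sup>2)" using \<epsilon>(1)[of m] by (simp add: power_mult_distrib)
      finally show "1 / (\<epsilon> m)\<^sup>2 * (vol K * potential \<gamma> (\<rho> m 0 K)) \<le> vol K * (?g * C\<^sup>2)" .
    qed
    ultimately show ?case unfolding total_energy_def by linarith
  qed
  moreover have "?B \<ge> 0" using \<gamma> by (intro add_nonneg_nonneg sum_nonneg) auto
  ultimately show ?thesis by blast
qed

text \<open>Both parts of the energy are sums of nonnegative terms, so each part, and each term of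
  the potential sum, inherits the bound.\<close>

lemma energy_bounded:
  "\<exists>B\<ge>0. \<forall>\<^sub>F m in sequentially. \<forall>n\<le>N.
     kinetic_energy (\<rho> m n) (u m n) \<le> B \<and> (\<forall>K\<in>cells D. vol K * potential \<gamma> (\<rho> m n K) \<le> B * (\<epsilon> m)\<^sup>2)"
proof -
  obtain B where B: "B \<ge> 0" "\<forall>\<^sub>F m in sequentially. total_energy \<gamma> (1 / (\<epsilon> m)\<^sup>2) (\<rho> m 0) (u m 0) \<le> B"
    using initial_energy_bounded by blast
  have "\<forall>\<^sub>F m in sequentially. \<forall>n\<le>N.
     kinetic_energy (\<rho> m n) (u m n) \<le> B \<and> (\<forall>K\<in>cells D. vol K * potential \<gamma> (\<rho> m n K) \<le> B * (\<epsilon> m)\<^sup>2)"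
    using B(2)
  proof eventually_elim
    case (elim m)
    show ?case
    proof (intro allI impI conjI ballI)
      fix n assume n: "n \<le> N"
      let ?S = "\<Sum>K\<in>cells D. vol K * potential \<gamma> (\<rho> m n K)"
      have E: "kinetic_energy (\<rho> m n) (u m n) + 1 / (\<epsilon> m)\<^sup>2 * ?S \<le> B"
        using scheme_energy[OF n, of m] elim unfolding total_energy_def by linarith
      have pot: "0 \<le> vol K * potential \<gamma> (\<rho> m n K)" if "K \<in> cells D" for K
        using potential_nonneg[OF \<gamma> scheme_density_pos[OF n that]] by simp
      have S: "0 \<le> ?S" by (rule sum_nonneg[OF pot])
      have kin: "0 \<le> kinetic_energy (\<rho> m n) (u m n)"
        unfolding kinetic_energy_def using scheme_density_pos[OF n]
        by (intro sum_nonneg divide_nonneg_nonneg mult_nonneg_nonneg dual_density_nonneg) (auto simp: less_imp_le)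
      have "0 \<le> 1 / (\<epsilon> m)\<^sup>2 * ?S" using S by (intro mult_nonneg_nonneg) auto
      thus "kinetic_energy (\<rho> m n) (u m n) \<le> B" using E by linarith
      fix K assume K: "K \<in> cells D"
      have "vol K * potential \<gamma> (\<rho> m n K) \<le> ?S"
        using pot K finite_cells by (intro member_le_sum) auto
      moreover have "1 / (\<epsilon> m)\<^sup>2 * ?S \<le> B" using E kin by linarith
      hence "?S \<le> B * (\<epsilon> m)\<^sup>2" using \<epsilon>(1)[of m] by (simp add: divide_le_eq)
      ultimately show "vol K * potential \<gamma> (\<rho> m n K) \<le> B * (\<epsilon> m)\<^sup>2" by linarith
    qed
  qed
  thus ?thesis using B(1) by blast
qed

lemma density_estimate:
  "\<exists>A\<ge>0. \<forall>\<^sub>F m in sequentially. \<forall>n\<le>N. \<forall>K\<in>cells D. \<bar>\<rho> m n K - 1\<bar> \<le> A * \<epsilon> m"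
proof -
  obtain B where B: "B \<ge> 0" "\<forall>\<^sub>F m in sequentially. \<forall>n\<le>N.
     kinetic_energy (\<rho> m n) (u m n) \<le> B \<and> (\<forall>K\<in>cells D. vol K * potential \<gamma> (\<rho> m n K) \<le> B * (\<epsilon> m)\<^sup>2)"
    using energy_bounded by blast
  obtain v where v: "v > 0" "\<And>K. K \<in> cells D \<Longrightarrow> v \<le> vol K"
    using finite_positive_lower_bound[OF finite_cells, of vol] vol_cell_pos by blast
  define c where "c = \<gamma> * 2 powr (- \<bar>\<gamma> - 2\<bar>)"
  have c: "c > 0" using \<gamma> by (simp add: c_def)
  \<comment> \<open>Chosen so that \<open>c * (A * \<epsilon> m)\<^sup>2\<close> is four times the
    bound \<open>B / v * (\<epsilon> m)\<^sup>2\<close> of the potential, matching the factor 4 in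
    \<open>potential_lower\<close>.\<close>
  define A where "A = sqrt (4 * (B / v) / c)"
  have A0: "A \<ge> 0" "A\<^sup>2 = 4 * (B / v) / c" using B(1) v(1) c by (auto simp: A_def)
  \<comment> \<open>Makes four times the potential at most \<open>c / 4\<close>, so that
    \<open>potential_lower\<close> applies.\<close>
  have "\<forall>\<^sub>F m in sequentially. A * \<epsilon> m \<le> 1/2" by (rule eventually_epsilon_small) simp
  with B(2) have "\<forall>\<^sub>F m in sequentially. \<forall>n\<le>N. \<forall>K\<in>cells D. \<bar>\<rho> m n K - 1\<bar> \<le> A * \<epsilon> m"
  proof eventually_elim
    case (elim m)
    show ?case
    proof (intro allI impI ballI)
      fix n K assume n: "n \<le> N" and K: "K \<in> cells D"
      have e0: "\<epsilon> m > 0" by (rule \<epsilon>(1))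
      have pos: "\<rho> m n K > 0" by (rule scheme_density_pos[OF n K])
      have "v * potential \<gamma> (\<rho> m n K) \<le> vol K * potential \<gamma> (\<rho> m n K)"
        by (intro mult_right_mono v(2)[OF K] potential_nonneg[OF \<gamma> pos])
      also have "\<dots> \<le> B * (\<epsilon> m)\<^sup>2" using elim(1) n K by blast
      finally have P: "potential \<gamma> (\<rho> m n K) \<le> B / v * (\<epsilon> m)\<^sup>2"
        using v(1) by (simp add: pos_le_divide_eq mult.commute)
      have "4 * (B / v) * (\<epsilon> m)\<^sup>2 = c * (A * \<epsilon> m)\<^sup>2" using c by (simp add: power_mult_distrib A0(2))
      moreover have "(A * \<epsilon> m)\<^sup>2 \<le> (1/2)\<^sup>2" using elim(2) A0(1) e0 by (intro power_mono) auto
      hence "c * (A * \<epsilon> m)\<^sup>2 \<le> c * (1/2)\<^sup>2" using c by (intro mult_left_mono) auto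
      moreover have "c * (1/2)\<^sup>2 < c" using c by (simp add: power2_eq_square)
      ultimately have P4: "4 * potential \<gamma> (\<rho> m n K) \<le> c * (A * \<epsilon> m)\<^sup>2" "4 * potential \<gamma> (\<rho> m n K) < c"
        using P by linarith+
      have "c * (\<rho> m n K - 1)\<^sup>2 \<le> 2 * (2 * potential \<gamma> (\<rho> m n K))"
        unfolding c_def by (rule potential_lower[OF \<gamma> pos]) (use P4(2) in \<open>simp add: c_def\<close>)
      hence "c * (\<rho> m n K - 1)\<^sup>2 \<le> c * (A * \<epsilon> m)\<^sup>2" using P4(1) by linarith
      hence "(\<rho> m n K - 1)\<^sup>2 \<le> (A * \<epsilon> m)\<^sup>2" using c by simp
      thus "\<bar>\<rho> m n K - 1\<bar> \<le> A * \<epsilon> m"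
        using A0(1) e0 abs_le_square_iff[of "\<rho> m n K - 1" "A * \<epsilon> m"] by simp
    qed
  qed
  thus ?thesis using A0(1) by blast
qed

lemma density_half:
  "\<forall>\<^sub>F m in sequentially. \<forall>n\<le>N. \<forall>K\<in>cells D. 1/2 \<le> \<rho> m n K \<and> \<rho> m n K \<le> 2"
proof -
  obtain A where "\<forall>\<^sub>F m in sequentially. \<forall>n\<le>N. \<forall>K\<in>cells D. \<bar>\<rho> m n K - 1\<bar> \<le> A * \<epsilon> m"
    using density_estimate by blast
  moreover have "\<forall>\<^sub>F m in sequentially. A * \<epsilon> m \<le> 1/2" by (rule eventually_epsilon_small) simp
  ultimately show ?thesis
  proof eventually_elim
    case (elim m)
    show ?case
    proof (intro allI impI ballI)
      fix n K assume "n \<le> N" "K \<in> cells D"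
      hence "\<bar>\<rho> m n K - 1\<bar> \<le> A * \<epsilon> m" using elim(1) by blast
      thus "1/2 \<le> \<rho> m n K \<and> \<rho> m n K \<le> 2" using elim(2) by linarith
    qed
  qed
qed

lemma velocity_estimate: "\<exists>B\<ge>0. \<forall>\<^sub>F m in sequentially. \<forall>n \<sigma>. norm (u m n \<sigma>) \<le> B"
proof -
  obtain B where B: "B \<ge> 0" "\<forall>\<^sub>F m in sequentially. \<forall>n\<le>N.
     kinetic_energy (\<rho> m n) (u m n) \<le> B \<and> (\<forall>K\<in>cells D. vol K * potential \<gamma> (\<rho> m n K) \<le> B * (\<epsilon> m)\<^sup>2)"
    using energy_bounded by blast
  have Vpos: "0 < vol (diamond D \<sigma>)" if "\<sigma> \<in> int_faces D" for \<sigma>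
    using vol_diamond_pos that int_faces_subset by blast
  obtain v where v: "v > 0" "\<And>\<sigma>. \<sigma> \<in> int_faces D \<Longrightarrow> v \<le> vol (diamond D \<sigma>)"
    using finite_positive_lower_bound[OF finite_int_faces, of "\<lambda>\<sigma>. vol (diamond D \<sigma>)"] Vpos by blast
  \<comment> \<open>The 4 combines the factor 1/2 of the kinetic energy with the lower bound 1/2 of
    the dual density.\<close>
  have "\<forall>\<^sub>F m in sequentially. \<forall>n \<sigma>. norm (u m n \<sigma>) \<le> sqrt (4 * B / v)"
    using B(2) density_half
  proof eventually_elim
    case (elim m)
    show ?case
    proof (intro allI)
      fix n \<sigma>
      show "norm (u m n \<sigma>) \<le> sqrt (4 * B / v)"
      proof (cases "n \<le> N \<and> \<sigma> \<in> int_faces D")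
        case False
        hence "u m n \<sigma> = 0" using u_zero by (meson not_le)
        thus ?thesis using B(1) v(1) by simp
      next
        case True
        hence n: "n \<le> N" and \<sigma>: "\<sigma> \<in> int_faces D" by auto
        have \<sigma>f: "\<sigma> \<in> faces D" using \<sigma> int_faces_subset by blast
        let ?t = "\<lambda>\<sigma>. vol (diamond D \<sigma>) * (dual_density D (\<rho> m n) \<sigma> * (u m n \<sigma> \<bullet> u m n \<sigma>)) / 2"
        have dd: "1/2 \<le> dual_density D (\<rho> m n) \<sigma>"
          by (rule dual_density_bounds(2)[OF \<sigma>f]) (use elim(2) n in blast)
        have "0 \<le> ?t \<sigma>" for \<sigma>
          using scheme_density_pos[OF n]
          by (intro divide_nonneg_nonneg mult_nonneg_nonneg dual_density_nonneg) (auto simp: less_imp_le)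
        hence "?t \<sigma> \<le> kinetic_energy (\<rho> m n) (u m n)"
          unfolding kinetic_energy_def using \<sigma> finite_int_faces by (intro member_le_sum) auto
        also have "\<dots> \<le> B" using elim(1) n by blast
        finally have tB: "?t \<sigma> \<le> B" .
        have "v * (1/2 * (u m n \<sigma> \<bullet> u m n \<sigma>)) / 2 \<le> ?t \<sigma>"
          using v(1) v(2)[OF \<sigma>] dd by (intro divide_right_mono mult_mono) auto
        hence "u m n \<sigma> \<bullet> u m n \<sigma> \<le> 4 * B / v" using tB v(1) by (simp add: pos_le_divide_eq mult.commute)
        thus ?thesis unfolding norm_eq_sqrt_inner by (rule real_sqrt_le_mono)
      qed
    qed
  qed
  thus ?thesis using B(1) v(1) by (intro exI[of _ "sqrt (4 * B / v)"]) auto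
qed

section \<open>Estimates of the pressure fluctuation\<close>

abbreviation dp :: "nat \<Rightarrow> nat \<Rightarrow> 'd region \<Rightarrow> real" where
  "dp m \<equiv> pressure_fluctuation D \<gamma> N (\<epsilon> m) (\<rho> m)"

lemma dp_pressure_space: "dp m \<in> pressure_space D N"
  by (simp add: pressure_space_def pressure_fluctuation_def)

text \<open>Subtracting the mean does not change the gradient, so the momentum balance can be
  written with the fluctuation and no singular factor remains.\<close>

lemma grad_dp:
  assumes n: "n < N" and \<sigma>: "\<sigma> \<in> int_faces D"
  shows "(1 / (\<epsilon> m)\<^sup>2) *\<^sub>R grad_disc D (\<lambda>K. \<rho> m (Suc n) K powr \<gamma>) \<sigma> = grad_disc D (dp m (Suc n)) \<sigma>"
proof -
  let ?p = "\<lambda>K. \<rho> m (Suc n) K powr \<gamma>"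
  define M where "M = (\<Sum>L\<in>cells D. vol L * ?p L) / vol (domain D)"
  have "grad_disc D (dp m (Suc n)) \<sigma> = grad_disc D (\<lambda>K. - M / (\<epsilon> m)\<^sup>2 + (1 / (\<epsilon> m)\<^sup>2) * ?p K) \<sigma>"
    by (rule grad_disc_cong[OF \<sigma>]) (use n in \<open>simp add: pressure_fluctuation_def M_def[symmetric] diff_divide_distrib\<close>)
  also have "\<dots> = (1 / (\<epsilon> m)\<^sup>2) *\<^sub>R grad_disc D ?p \<sigma>"
    unfolding grad_disc_linear_combination[OF \<sigma>] grad_disc_const[OF \<sigma>] by simp
  finally show ?thesis by simp
qed

lemma dp_mean_zero:
  assumes "n \<in> {1..N}" shows "(\<Sum>K\<in>cells D. vol K * dp m n K) = 0"
proof -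
  let ?p = "\<lambda>K. \<rho> m n K powr \<gamma>"
  define M where "M = (\<Sum>L\<in>cells D. vol L * ?p L) / vol (domain D)"
  have "(\<Sum>K\<in>cells D. vol K * dp m n K) = (\<Sum>K\<in>cells D. (vol K * ?p K - vol K * M) / (\<epsilon> m)\<^sup>2)"
    using assms by (intro sum.cong refl) (simp add: pressure_fluctuation_def M_def[symmetric] right_diff_distrib)
  also have "\<dots> = ((\<Sum>K\<in>cells D. vol K * ?p K) - (\<Sum>K\<in>cells D. vol K) * M) / (\<epsilon> m)\<^sup>2"
    by (simp add: sum_divide_distrib[symmetric] sum_subtractf sum_distrib_right)
  also have "\<dots> = 0" unfolding M_def vol_domain[symmetric] using vol_domain_pos by simp
  finally show ?thesis .
qed

text \<open>The momentum balance is solved for the gradient of the fluctuation. The other terms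
  involve only densities between 1/2 and 2, bounded velocities and the fixed time step.\<close>

lemma dp_gradient_bounded:
  assumes \<sigma>: "\<sigma> \<in> int_faces D"
  shows "\<exists>G. \<forall>\<^sub>F m in sequentially. \<forall>n\<in>{1..N}. norm (grad_disc D (dp m n) \<sigma>) \<le> G"
proof -
  obtain B where B: "B \<ge> 0" "\<forall>\<^sub>F m in sequentially. \<forall>n \<sigma>. norm (u m n \<sigma>) \<le> B" using velocity_estimate by blast
  have \<sigma>f: "\<sigma> \<in> faces D" using \<sigma> int_faces_subset by blast
  have "\<exists>C. \<forall>\<rho> u. (\<forall>K\<in>cells D. \<bar>\<rho> K\<bar> \<le> 2) \<longrightarrow> (\<forall>\<sigma>. norm (u \<sigma>) \<le> B) \<longrightarrow> norm (div_conv D \<rho> u u \<sigma>) \<le> C"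
    by (rule div_conv_bounded) (use B(1) in simp_all)
  then obtain C1 where "\<forall>\<rho> u. (\<forall>K\<in>cells D. \<bar>\<rho> K\<bar> \<le> 2) \<longrightarrow> (\<forall>\<sigma>. norm (u \<sigma>) \<le> B) \<longrightarrow> norm (div_conv D \<rho> u u \<sigma>) \<le> C1" ..
  note C1 = this[rule_format]
  obtain C2 where C2: "\<And>u. (\<forall>\<sigma>. norm (u \<sigma>) \<le> B) \<Longrightarrow> norm (div_tau D \<mu> lam u \<sigma>) \<le> C2"
    using div_tau_bounded[OF \<sigma>f, of B \<mu> lam] by blast
  have "\<forall>\<^sub>F m in sequentially. \<forall>n\<in>{1..N}. norm (grad_disc D (dp m n) \<sigma>) \<le> (1 / dt) * (2 * B + 2 * B) + C1 + C2"
    using B(2) density_half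
  proof eventually_elim
    case (elim m)
    show ?case
    proof
      fix n' assume "n' \<in> {1..N}"
      then obtain n where n: "n' = Suc n" "n < N" by (cases n') auto
      have \<rho>2: "1/2 \<le> \<rho> m k K" "\<rho> m k K \<le> 2" if "k \<le> N" "K \<in> cells D" for k K using elim(2) that by auto
      have dd: "\<bar>dual_density D (\<rho> m k) \<sigma>\<bar> \<le> 2" if k: "k \<le> N" for k
        using dual_density_bounds(1)[OF \<sigma>f, of "\<rho> m k" 2] dual_density_bounds(2)[OF \<sigma>f, where \<rho> = "\<rho> m k" and b = "1/2"] \<rho>2[OF k]
        by force
      let ?a = "\<lambda>k. dual_density D (\<rho> m k) \<sigma> *\<^sub>R u m k \<sigma>"
      have a: "norm (?a k) \<le> 2 * B" if k: "k \<le> N" for k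
        unfolding norm_scaleR using dd[OF k] elim(1) by (intro mult_mono) auto
      have "norm (?a (Suc n) - ?a n) \<le> 2 * B + 2 * B"
        using norm_triangle_ineq4[of "?a (Suc n)" "?a n"] a[of "Suc n"] a[of n] n by linarith
      hence t1: "norm ((1 / dt) *\<^sub>R (?a (Suc n) - ?a n)) \<le> (1 / dt) * (2 * B + 2 * B)"
        unfolding norm_scaleR using dt by (intro mult_mono) auto
      have t2: "norm (div_conv D (\<rho> m (Suc n)) (u m (Suc n)) (u m (Suc n)) \<sigma>) \<le> C1"
        using elim(1) \<rho>2[of "Suc n"] n by (intro C1) force+
      have t3: "norm (div_tau D \<mu> lam (u m (Suc n)) \<sigma>) \<le> C2" using elim(1) by (intro C2) blast
      have "(1 / dt) *\<^sub>R (?a (Suc n) - ?a n) + div_conv D (\<rho> m (Suc n)) (u m (Suc n)) (u m (Suc n)) \<sigma>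
        - div_tau D \<mu> lam (u m (Suc n)) \<sigma> + grad_disc D (dp m n') \<sigma> = 0"
        using scheme_momentum_balance[OF n(2), of m] \<sigma>
        unfolding momentum_balance_def n(1) grad_dp[OF n(2) \<sigma>, symmetric] by blast
      hence "grad_disc D (dp m n') \<sigma> = - ((1 / dt) *\<^sub>R (?a (Suc n) - ?a n) +
          div_conv D (\<rho> m (Suc n)) (u m (Suc n)) (u m (Suc n)) \<sigma> - div_tau D \<mu> lam (u m (Suc n)) \<sigma>)"
        by (rule minus_unique[symmetric])
      hence "norm (grad_disc D (dp m n') \<sigma>) = norm ((1 / dt) *\<^sub>R (?a (Suc n) - ?a n) +
          div_conv D (\<rho> m (Suc n)) (u m (Suc n)) (u m (Suc n)) \<sigma> - div_tau D \<mu> lam (u m (Suc n)) \<sigma>)"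
        by (simp only: norm_minus_cancel)
      also have "\<dots> \<le> norm ((1 / dt) *\<^sub>R (?a (Suc n) - ?a n)) +
          norm (div_conv D (\<rho> m (Suc n)) (u m (Suc n)) (u m (Suc n)) \<sigma>) + norm (div_tau D \<mu> lam (u m (Suc n)) \<sigma>)"
        by (rule order_trans[OF norm_triangle_ineq4 add_right_mono[OF norm_triangle_ineq]])
      finally show "norm (grad_disc D (dp m n') \<sigma>) \<le> (1 / dt) * (2 * B + 2 * B) + C1 + C2"
        using t1 t2 t3 by linarith
    qed
  qed
  thus ?thesis by blast
qed

lemma dp_estimate: "\<exists>B\<ge>0. \<forall>\<^sub>F m in sequentially. \<forall>n K. norm (dp m n K) \<le> B"
proof -
  obtain B where B: "B \<ge> 0" "\<forall>\<^sub>F m in sequentially. \<forall>n\<in>{1..N}. \<forall>K\<in>cells D. \<bar>dp m n K\<bar> \<le> B"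
    using pressure_bounded_of_gradient[of "{1..N}" dp, OF dp_mean_zero dp_gradient_bounded] by blast
  have "\<forall>\<^sub>F m in sequentially. \<forall>n K. norm (dp m n K) \<le> B"
    using B(2)
  proof eventually_elim
    case (elim m)
    show ?case
    proof (intro allI)
      fix n K
      show "norm (dp m n K) \<le> B"
      proof (cases "n \<in> {1..N} \<and> K \<in> cells D")
        case True thus ?thesis using elim by simp
      next
        case False
        hence "dp m n K = 0" by (auto simp: pressure_fluctuation_def)
        thus ?thesis using B(1) by simp
      qed
    qed
  qed
  thus ?thesis using B(1) by blast
qed

lemma density_norm_estimate:
  assumes q: "1 \<le> q"
  shows "\<exists>C>0. \<forall>\<^sub>F m in sequentially.
    Linf_Lq_norm (domain D) N q (\<lambda>n x. cell_function D (\<rho> m n) x - 1) \<le> C * \<epsilon> m"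
proof -
  obtain A where A: "A \<ge> 0" "\<forall>\<^sub>F m in sequentially. \<forall>n\<le>N. \<forall>K\<in>cells D. \<bar>\<rho> m n K - 1\<bar> \<le> A * \<epsilon> m"
    using density_estimate by blast
  let ?w = "vol (domain D) powr (1/q)"
  \<comment> \<open>The added 1 makes the constant positive even when \<open>A\<close> is
    zero.\<close>
  have "\<forall>\<^sub>F m in sequentially. Linf_Lq_norm (domain D) N q (\<lambda>n x. cell_function D (\<rho> m n) x - 1) \<le> (A * ?w + 1) * \<epsilon> m"
    using A(2)
  proof eventually_elim
    case (elim m)
    have "Lq_norm (domain D) q (\<lambda>x. cell_function D (\<rho> m n) x - 1) \<le> (A * ?w + 1) * \<epsilon> m" if "n \<le> N" for n
    proof -
      have "Lq_norm (domain D) q (\<lambda>x. cell_function D (\<rho> m n) x - 1) \<le> A * \<epsilon> m * ?w"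
        using elim that A(1) \<epsilon>(1)[of m] by (intro Lq_norm_cell_function_le[OF q]) auto
      also have "\<dots> \<le> (A * ?w + 1) * \<epsilon> m" using \<epsilon>(1)[of m] by (simp add: algebra_simps)
      finally show ?thesis .
    qed
    thus ?case unfolding Linf_Lq_norm_def by (intro Max.boundedI) auto
  qed
  moreover have "A * ?w + 1 > 0" using A(1) by (intro add_nonneg_pos mult_nonneg_nonneg) auto
  ultimately show ?thesis by blast
qed

lemma density_converges:
  assumes q: "1 \<le> q"
  shows "(\<lambda>m. Linf_Lq_norm (domain D) N q (\<lambda>n x. cell_function D (\<rho> m n) x - 1)) \<longlonglongrightarrow> 0"
proof -
  obtain C where C: "\<forall>\<^sub>F m in sequentially.
    Linf_Lq_norm (domain D) N q (\<lambda>n x. cell_function D (\<rho> m n) x - 1) \<le> C * \<epsilon> m"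
    using density_norm_estimate[OF q] by blast
  have nn: "0 \<le> Linf_Lq_norm (domain D) N q f" for f
  proof -
    have "0 \<le> Lq_norm (domain D) q (f 0)" by (simp add: Lq_norm_def)
    also have "\<dots> \<le> Linf_Lq_norm (domain D) N q f" unfolding Linf_Lq_norm_def by (intro Max_ge) auto
    finally show ?thesis .
  qed
  have "(\<lambda>m. C * \<epsilon> m) \<longlonglongrightarrow> C * 0" by (intro tendsto_mult tendsto_const \<epsilon>(2))
  hence z: "(\<lambda>m. C * \<epsilon> m) \<longlonglongrightarrow> 0" by simp
  show ?thesis
    by (rule tendsto_sandwich[OF _ C tendsto_const z]) (simp add: nn)
qed

section \<open>Passage to the limit\<close>

lemma density_tendsto:
  assumes "n \<le> N" "K \<in> cells D" shows "(\<lambda>m. \<rho> m n K) \<longlonglongrightarrow> 1"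
proof -
  obtain A where A: "\<forall>\<^sub>F m in sequentially. \<forall>n\<le>N. \<forall>K\<in>cells D. \<bar>\<rho> m n K - 1\<bar> \<le> A * \<epsilon> m"
    using density_estimate by blast
  have "(\<lambda>m. \<rho> m n K - 1) \<longlonglongrightarrow> 0"
  proof (rule Lim_null_comparison)
    show "\<forall>\<^sub>F m in sequentially. norm (\<rho> m n K - 1) \<le> A * \<epsilon> m"
      using A by eventually_elim (use assms in simp)
    have "(\<lambda>m. A * \<epsilon> m) \<longlonglongrightarrow> A * 0" by (intro tendsto_mult tendsto_const \<epsilon>(2))
    thus "(\<lambda>m. A * \<epsilon> m) \<longlonglongrightarrow> 0" by simp
  qed
  thus ?thesis by (rule LIM_zero_cancel)
qed

lemma limit_scheme:
  assumes s: "strict_mono (s :: nat \<Rightarrow> nat)"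
    and v: "v \<in> velocity_space D N" "\<And>n \<sigma>. (\<lambda>k. u (s k) n \<sigma>) \<longlonglongrightarrow> v n \<sigma>"
    and q: "q \<in> pressure_space D N" "\<And>n K. (\<lambda>k. dp (s k) n K) \<longlonglongrightarrow> q n K"
  shows "incompressible_scheme D \<mu> lam dt N v q \<and> v 0 = initial_velocity D u0lim"
proof
  have \<rho>1: "(\<lambda>k. \<rho> (s k) n K) \<longlonglongrightarrow> 1" if "n \<le> N" "K \<in> cells D" for n K
    by (rule LIMSEQ_subseq_LIMSEQ[OF density_tendsto[OF that] s, unfolded o_def])
  have vH: "v n \<in> H0 D" if "n \<le> N" for n using v(1) that by (simp add: velocity_space_def)
  show "incompressible_scheme D \<mu> lam dt N v q"
    unfolding incompressible_scheme_def
  proof (intro conjI v(1) q(1) allI impI ballI)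
    fix n assume n: "n < N"
    note \<rho>S = \<rho>1[of "Suc n"] and \<rho>n = \<rho>1[of n]
    show "div_vel (v (Suc n)) K = 0" if K: "K \<in> cells D" for K
    proof -
      have "(\<lambda>k. (\<rho> (s k) (Suc n) K - \<rho> (s k) n K) / dt + div_mass D (\<rho> (s k) (Suc n)) (u (s k) (Suc n)) K)
        \<longlonglongrightarrow> (1 - 1) / dt + div_mass D (\<lambda>K. 1) (v (Suc n)) K"
        using n dt by (intro tendsto_intros div_mass_tendsto \<rho>S \<rho>n v(2) K) auto
      moreover have "(\<rho> (s k) (Suc n) K - \<rho> (s k) n K) / dt + div_mass D (\<rho> (s k) (Suc n)) (u (s k) (Suc n)) K = 0" for k
        using scheme_mass_balance[OF n, of "s k"] K by (simp add: mass_balance_def)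
      ultimately have "div_mass D (\<lambda>K. 1) (v (Suc n)) K = 0"
        by (simp add: LIMSEQ_const_iff)
      thus ?thesis using div_mass_one[OF vH[of "Suc n"]] n by simp
    qed
    fix \<sigma> assume \<sigma>: "\<sigma> \<in> int_faces D"
    have \<sigma>f: "\<sigma> \<in> faces D" using \<sigma> int_faces_subset by blast
    let ?L = "\<lambda>k. (1 / dt) *\<^sub>R (dual_density D (\<rho> (s k) (Suc n)) \<sigma> *\<^sub>R u (s k) (Suc n) \<sigma>
        - dual_density D (\<rho> (s k) n) \<sigma> *\<^sub>R u (s k) n \<sigma>)
        + div_conv D (\<rho> (s k) (Suc n)) (u (s k) (Suc n)) (u (s k) (Suc n)) \<sigma>
        - div_tau D \<mu> lam (u (s k) (Suc n)) \<sigma> + grad_disc D (dp (s k) (Suc n)) \<sigma>"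
    have "?L \<longlonglongrightarrow> (1 / dt) *\<^sub>R (1 *\<^sub>R v (Suc n) \<sigma> - 1 *\<^sub>R v n \<sigma>) + div_conv D (\<lambda>K. 1) (v (Suc n)) (v (Suc n)) \<sigma>
        - div_tau D \<mu> lam (v (Suc n)) \<sigma> + grad_disc D (q (Suc n)) \<sigma>"
      using n by (intro tendsto_add tendsto_diff tendsto_scaleR tendsto_const dual_density_tendsto \<rho>S \<rho>n \<sigma>f v(2)
          div_conv_tendsto div_tau_tendsto grad_disc_tendsto \<sigma> q(2)) auto
    moreover have "?L k = 0" for k
      using scheme_momentum_balance[OF n, of "s k"] \<sigma>
      unfolding momentum_balance_def grad_dp[OF n \<sigma>, symmetric] by blast
    ultimately show "(1 / dt) *\<^sub>R (v (Suc n) \<sigma> - v n \<sigma>) + div_conv D (\<lambda>K. 1) (v (Suc n)) (v (Suc n)) \<sigma>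
        - div_tau D \<mu> lam (v (Suc n)) \<sigma> + grad_disc D (q (Suc n)) \<sigma> = 0"
      by (simp add: LIMSEQ_const_iff)
  qed
  \<comment> \<open>The scheme does not determine the initial value of the limit; it comes from the
    weak convergence of the initial velocities.\<close>
  show "v 0 = initial_velocity D u0lim"
  proof
    fix \<sigma>
    have w: "weakly_tends_L2 (domain D) u0 u0lim" "\<And>m. in_L2 (domain D) (u0 m)"
      using ill by (simp_all add: ill_prepared_def)
    have "(\<lambda>k. u (s k) 0 \<sigma>) \<longlonglongrightarrow> initial_velocity D u0lim \<sigma>"
      using LIMSEQ_subseq_LIMSEQ[OF initial_velocity_tendsto[OF w, of \<sigma>] s] by (simp add: u_initial o_def)
    thus "v 0 \<sigma> = initial_velocity D u0lim \<sigma>" using v(2)[of 0 \<sigma>] LIMSEQ_unique by blast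
  qed
qed

text \<open>Two further extractions, one for the velocity and one for the pressure, turn norm
  convergence into componentwise convergence to the same limits. The limit equations concern these
  limits only, so extracting loses nothing.\<close>

lemma limit_of_subsequence:
  assumes r: "strict_mono (r :: nat \<Rightarrow> nat)"
    and nrmu: "discrete_norm (velocity_space D N) nrmu" and nrmp: "discrete_norm (pressure_space D N) nrmp"
    and v: "v \<in> velocity_space D N" and q: "q \<in> pressure_space D N"
    and limu: "(\<lambda>k. nrmu (\<lambda>n \<sigma>. u (r k) n \<sigma> - v n \<sigma>)) \<longlonglongrightarrow> 0"
    and limp: "(\<lambda>k. nrmp (\<lambda>n K. dp (r k) n K - q n K)) \<longlonglongrightarrow> 0"
  shows "incompressible_scheme D \<mu> lam dt N v q \<and> v 0 = initial_velocity D u0lim"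
proof -
  have sub: "\<forall>\<^sub>F k in sequentially. P (t k)"
    if "\<forall>\<^sub>F m in sequentially. P m" "strict_mono t" for P and t :: "nat \<Rightarrow> nat"
    using that by (rule eventually_subseq[rotated])
  obtain Bu where Bu: "\<forall>\<^sub>F m in sequentially. \<forall>n \<sigma>. norm (u m n \<sigma>) \<le> Bu" using velocity_estimate by blast
  obtain Bp where Bp: "\<forall>\<^sub>F m in sequentially. \<forall>n K. norm (dp m n K) \<le> Bp" using dp_estimate by blast
  have finu: "finite ({0..N} \<times> int_faces D)" and finp: "finite ({1..N} \<times> cells D)"
    using finite_int_faces finite_cells by simp_all
  obtain t1 where t1: "strict_mono (t1 :: nat \<Rightarrow> nat)" "\<forall>n \<sigma>. (\<lambda>k. u (r (t1 k)) n \<sigma>) \<longlonglongrightarrow> v n \<sigma>"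
    using discrete_norm_componentwise_subsequence[OF finu nrmu[unfolded velocity_space_eq],
        of "\<lambda>k. u (r k)", OF u_velocity_space[unfolded velocity_space_eq] v[unfolded velocity_space_eq] sub[OF Bu r] limu]
    by blast
  have limp1: "(\<lambda>k. nrmp (\<lambda>n K. dp (r (t1 k)) n K - q n K)) \<longlonglongrightarrow> 0"
    using LIMSEQ_subseq_LIMSEQ[OF limp t1(1)] by (simp add: o_def)
  obtain t2 where t2: "strict_mono (t2 :: nat \<Rightarrow> nat)" "\<forall>n K. (\<lambda>k. dp (r (t1 (t2 k))) n K) \<longlonglongrightarrow> q n K"
    using discrete_norm_componentwise_subsequence[OF finp nrmp[unfolded pressure_space_eq],
        of "\<lambda>k. dp (r (t1 k))", OF dp_pressure_space[unfolded pressure_space_eq] q[unfolded pressure_space_eq]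
        sub[OF sub[OF Bp r] t1(1)] limp1]
    by blast
  have u2: "(\<lambda>k. u (r (t1 (t2 k))) n \<sigma>) \<longlonglongrightarrow> v n \<sigma>" for n \<sigma>
    using LIMSEQ_subseq_LIMSEQ[OF t1(2)[rule_format] t2(1)] by (simp add: o_def)
  have "strict_mono (\<lambda>k. r (t1 (t2 k)))"
    using r t1(1) t2(1) by (simp add: strict_mono_def)
  thus ?thesis using limit_scheme[of "\<lambda>k. r (t1 (t2 k))" v q] v u2 q t2(2) by blast
qed

end

theorem theorem5p7:
  fixes D :: "('d::finite) discretization"
    and \<gamma> \<mu> lam T dt :: real and N :: nat
    and \<epsilon> :: "nat \<Rightarrow> real"
    and \<rho>0 :: "nat \<Rightarrow> real^'d \<Rightarrow> real"
    and u0 :: "nat \<Rightarrow> real^'d \<Rightarrow> real^'d"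
    and u0lim :: "real^'d \<Rightarrow> real^'d"
    and \<rho> :: "nat \<Rightarrow> nat \<Rightarrow> 'd region \<Rightarrow> real"
    and u :: "nat \<Rightarrow> nat \<Rightarrow> 'd region \<Rightarrow> real^'d"
  assumes "CARD('d) = 2 \<or> CARD('d) = 3"
    and "staggered_discretization D"
    and "\<gamma> \<ge> 1" and "\<mu> > 0" and "\<mu> + lam > 0"
    and "T > 0" and "dt > 0" and "N = nat \<lfloor>T / dt\<rfloor>"
    and "\<And>m. \<epsilon> m > 0" and "\<epsilon> \<longlonglongrightarrow> 0"
    and "ill_prepared (domain D) \<epsilon> \<rho>0 u0 u0lim"
    and "\<And>m. implicit_scheme D \<gamma> \<mu> lam dt N (\<epsilon> m) (\<rho>0 m) (u0 m) (\<rho> m) (u m)"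
  shows
    "((\<lambda>m. Linf_Lq_norm (domain D) N \<gamma> (\<lambda>n x. cell_function D (\<rho> m n) x - 1)) \<longlonglongrightarrow> 0 \<and>
      (\<forall>q. 1 \<le> q \<and> q \<le> min 2 \<gamma> \<longrightarrow>
         (\<exists>C>0. \<forall>\<^sub>F m in sequentially.
            Linf_Lq_norm (domain D) N q (\<lambda>n x. cell_function D (\<rho> m n) x - 1) \<le> C * \<epsilon> m)))
     \<and>
     ((\<forall>nrm. discrete_norm (velocity_space D N) nrm \<longrightarrow> (\<exists>B. \<forall>m. nrm (u m) \<le> B)) \<and>
      (\<forall>nrm. discrete_norm (pressure_space D N) nrm \<longrightarrow>
         (\<exists>B. \<forall>m. nrm (pressure_fluctuation D \<gamma> N (\<epsilon> m) (\<rho> m)) \<le> B)))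
     \<and>
     ((\<forall>r nrmu nrmp ulim dplim.
         strict_mono r \<and>
         discrete_norm (velocity_space D N) nrmu \<and> discrete_norm (pressure_space D N) nrmp \<and>
         ulim \<in> velocity_space D N \<and> dplim \<in> pressure_space D N \<and>
         (\<lambda>k. nrmu (\<lambda>n \<sigma>. u (r k) n \<sigma> - ulim n \<sigma>)) \<longlonglongrightarrow> 0 \<and>
         (\<lambda>k. nrmp (\<lambda>n K. pressure_fluctuation D \<gamma> N (\<epsilon> (r k)) (\<rho> (r k)) n K - dplim n K))
            \<longlonglongrightarrow> 0
         \<longrightarrow> incompressible_scheme D \<mu> lam dt N ulim dplim \<and>
             ulim 0 = initial_velocity D u0lim) \<and>
      (\<forall>w. (\<exists>q. incompressible_scheme D \<mu> lam dt N (w(0 := initial_velocity D u0lim)) q) \<longleftrightarrow>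
           (\<exists>q. incompressible_scheme D \<mu> lam dt N (w(0 := L2_projection D u0lim)) q)))"
proof -
  interpret low_mach D \<gamma> \<mu> lam dt N \<epsilon> \<rho>0 u0 u0lim \<rho> u
    using assms by unfold_locales
  have lim: "in_L2 (domain D) u0lim"
    using ill by (simp add: ill_prepared_def weakly_tends_L2_def)
  have finu: "finite ({0..N} \<times> int_faces D)" and finp: "finite ({1..N} \<times> cells D)"
    using finite_int_faces finite_cells by simp_all
  show ?thesis
  proof (intro conjI allI impI)
    show "(\<lambda>m. Linf_Lq_norm (domain D) N \<gamma> (\<lambda>n x. cell_function D (\<rho> m n) x - 1)) \<longlonglongrightarrow> 0"
      by (rule density_converges[OF \<gamma>])
  next
    fix q assume "1 \<le> q \<and> q \<le> min 2 \<gamma>"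
    thus "\<exists>C>0. \<forall>\<^sub>F m in sequentially.
            Linf_Lq_norm (domain D) N q (\<lambda>n x. cell_function D (\<rho> m n) x - 1) \<le> C * \<epsilon> m"
      by (intro density_norm_estimate) simp
  next
    fix nrm :: "(nat \<Rightarrow> 'd region \<Rightarrow> real^'d) \<Rightarrow> real"
    assume nrm: "discrete_norm (velocity_space D N) nrm"
    obtain B where "\<forall>\<^sub>F m in sequentially. \<forall>n \<sigma>. norm (u m n \<sigma>) \<le> B" using velocity_estimate by blast
    thus "\<exists>B. \<forall>m. nrm (u m) \<le> B"
      by (rule discrete_norm_bounded[OF finu nrm[unfolded velocity_space_eq] u_velocity_space[unfolded velocity_space_eq]])
  next
    fix nrm :: "(nat \<Rightarrow> 'd region \<Rightarrow> real) \<Rightarrow> real"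
    assume nrm: "discrete_norm (pressure_space D N) nrm"
    obtain B where "\<forall>\<^sub>F m in sequentially. \<forall>n K. norm (dp m n K) \<le> B" using dp_estimate by blast
    thus "\<exists>B. \<forall>m. nrm (dp m) \<le> B"
      by (rule discrete_norm_bounded[OF finp nrm[unfolded pressure_space_eq] dp_pressure_space[unfolded pressure_space_eq]])
  next
    fix r nrmu nrmp ulim dplim
    assume h: "strict_mono r \<and>
         discrete_norm (velocity_space D N) nrmu \<and> discrete_norm (pressure_space D N) nrmp \<and>
         ulim \<in> velocity_space D N \<and> dplim \<in> pressure_space D N \<and>
         (\<lambda>k. nrmu (\<lambda>n \<sigma>. u (r k) n \<sigma> - ulim n \<sigma>)) \<longlonglongrightarrow> 0 \<and>
         (\<lambda>k. nrmp (\<lambda>n K. dp (r k) n K - dplim n K)) \<longlonglongrightarrow> 0"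
    from h limit_of_subsequence[of r nrmu nrmp ulim dplim]
    show "incompressible_scheme D \<mu> lam dt N ulim dplim" "ulim 0 = initial_velocity D u0lim"
      by blast+
  next
    fix w
    show "(\<exists>q. incompressible_scheme D \<mu> lam dt N (w(0 := initial_velocity D u0lim)) q) \<longleftrightarrow>
           (\<exists>q. incompressible_scheme D \<mu> lam dt N (w(0 := L2_projection D u0lim)) q)"
      by (rule incompressible_scheme_projection[OF lim])
  qed
qed

end
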